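(* Let $\mathcal{M}=(M,+,<,\dots)$ be an $\aleph_0$-saturated weakly o-minimal expansion of an ordered group. Then: (1) $\mathcal{M}^{\mathrm{eq}}$ has uniform finiteness if and only if the collection of definable convex subgroups of $(M,+)$ has uniform finiteness. (2) If, moreover, $\mathcal{M}$ is an expansion of an ordered field, then $\mathcal{M}^{\mathrm{eq}}$ has uniform finiteness if and only if the collection of definable convex valuation subrings of $M$ has uniform finiteness.
   Context: A linearly ordered structure $\mathcal{M}$ is weakly o-minimal if every definable subset of $M$ is a finite union of convex sets. (Since $\mathcal{M}$ is $\aleph_0$-saturated, its theory is then weakly o-minimal.) Convention: "definable" means definable in $\mathcal{M}^{\mathrm{eq}}$, with parameters. A definable set $X$ (in $\mathcal{M}^{\mathrm{eq}}$) has uniform finiteness if for every definable family $\{Y_t\subseteq X: t\in T\}$ there is $n\in\mathbb{N}$ such that for all $t\in T$: $|Y_t|=\infty \iff |Y_t|>n$. We say that $\mathcal{M}^{\mathrm{eq}}$ has uniform finiteness if every definable set in $\mathcal{M}^{\mathrm{eq}}$ has uniform finiteness. Let $\mathcal{D}$ be a (not necessarily definable) collection of definable subsets of $\bigcup_n M^n$. A definable set $X$ (in $\mathcal{M}^{\mathrm{eq}}$) is a set of imaginaries from $\mathcal{D}$ if there is a definable relation $R\subseteq X\times M^n$ such that the map $x\mapsto R_x:=\{m\in M^n:(x,m)\in R\}$ is injective and $R_x\in\mathcal{D}$ for every $x\in X$. The collection $\mathcal{D}$ has uniform finiteness if every definable set of imaginaries from $\mathcal{D}$ has uniform finiteness.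 *)

theory Defs
  imports "HOL-Algebra.Subrings"
begin

section \<open>Many-sorted first-order structures\<close>

text \<open>
  A structure carries its signature. Arguments are passed as lists, and the interpretations matter
  only on lists of elements of the sorts prescribed by the signature. The universes of different
  sorts may overlap: every statement below refers to elements together with their sorts.
\<close>

record ('s, 'f, 'r, 'a) mstruct =
  sorts :: "'s set"
  univ :: "'s \<Rightarrow> 'a set"
  fun_args :: "'f \<Rightarrow> 's list"
  fun_res :: "'f \<Rightarrow> 's"
  rel_args :: "'r \<Rightarrow> 's list"
  fun_int :: "'f \<Rightarrow> 'a list \<Rightarrow> 'a"
  rel_int :: "'r \<Rightarrow> 'a list \<Rightarrow> bool"

definition tuples :: "('s, 'f, 'r, 'a) mstruct \<Rightarrow> 's list \<Rightarrow> 'a list set" where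
  "tuples S ss = {xs. list_all2 (\<lambda>x s. x \<in> univ S s) xs ss}"

datatype 'f tm = Var nat | App 'f "'f tm list"

text \<open>
  Variables are de Bruijn indices into a context, the list of the sorts of the free variables;
  the quantifier binds variable 0.
\<close>

datatype ('s, 'f, 'r) fm =
    Eq "'f tm" "'f tm"
  | Rel 'r "'f tm list"
  | Neg "('s, 'f, 'r) fm"
  | Conj "('s, 'f, 'r) fm" "('s, 'f, 'r) fm"
  | Ex 's "('s, 'f, 'r) fm"

text \<open>
  The side condition on the result sort discards those function symbols whose result sort
  is not among the sorts of the structure; they are not part of the language.
\<close>

inductive has_sort :: "('s, 'f, 'r, 'a) mstruct \<Rightarrow> 's list \<Rightarrow> 'f tm \<Rightarrow> 's \<Rightarrow> bool"
  for S \<Gamma> where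
  Var: "i < length \<Gamma> \<Longrightarrow> has_sort S \<Gamma> (Var i) (\<Gamma> ! i)"
| App: "list_all2 (has_sort S \<Gamma>) ts (fun_args S f) \<Longrightarrow> fun_res S f \<in> sorts S \<Longrightarrow>
        has_sort S \<Gamma> (App f ts) (fun_res S f)"

primrec wf_fm :: "('s, 'f, 'r, 'a) mstruct \<Rightarrow> 's list \<Rightarrow> ('s, 'f, 'r) fm \<Rightarrow> bool" where
  "wf_fm S \<Gamma> (Eq t u) \<longleftrightarrow> (\<exists>s. has_sort S \<Gamma> t s \<and> has_sort S \<Gamma> u s)"
| "wf_fm S \<Gamma> (Rel r ts) \<longleftrightarrow> list_all2 (has_sort S \<Gamma>) ts (rel_args S r)"
| "wf_fm S \<Gamma> (Neg \<phi>) \<longleftrightarrow> wf_fm S \<Gamma> \<phi>"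
| "wf_fm S \<Gamma> (Conj \<phi> \<psi>) \<longleftrightarrow> wf_fm S \<Gamma> \<phi> \<and> wf_fm S \<Gamma> \<psi>"
| "wf_fm S \<Gamma> (Ex s \<phi>) \<longleftrightarrow> s \<in> sorts S \<and> wf_fm S (s # \<Gamma>) \<phi>"

primrec eval_tm :: "('s, 'f, 'r, 'a) mstruct \<Rightarrow> 'a list \<Rightarrow> 'f tm \<Rightarrow> 'a" where
  "eval_tm S xs (Var i) = xs ! i"
| "eval_tm S xs (App f ts) = fun_int S f (map (eval_tm S xs) ts)"

primrec sat :: "('s, 'f, 'r, 'a) mstruct \<Rightarrow> 'a list \<Rightarrow> ('s, 'f, 'r) fm \<Rightarrow> bool" where
  "sat S xs (Eq t u) \<longleftrightarrow> eval_tm S xs t = eval_tm S xs u"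
| "sat S xs (Rel r ts) \<longleftrightarrow> rel_int S r (map (eval_tm S xs) ts)"
| "sat S xs (Neg \<phi>) \<longleftrightarrow> \<not> sat S xs \<phi>"
| "sat S xs (Conj \<phi> \<psi>) \<longleftrightarrow> sat S xs \<phi> \<and> sat S xs \<psi>"
| "sat S xs (Ex s \<phi>) \<longleftrightarrow> (\<exists>a\<in>univ S s. sat S (a # xs) \<phi>)"

text \<open>
  \<open>definable_over S A ss X\<close>: \<open>X\<close> is a subset of the product of the sorts \<open>ss\<close> that is definable
  with parameters from \<open>A\<close>; \<open>ps\<close> is the tuple of parameters and \<open>ts\<close> lists their sorts.
\<close>

definition definable_over ::
  "('s, 'f, 'r, 'a) mstruct \<Rightarrow> 'a set \<Rightarrow> 's list \<Rightarrow> 'a list set \<Rightarrow> bool" where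
  "definable_over S A ss X \<longleftrightarrow>
    set ss \<subseteq> sorts S \<and>
    (\<exists>ts ps \<phi>. set ts \<subseteq> sorts S \<and> ps \<in> tuples S ts \<and> set ps \<subseteq> A \<and> wf_fm S (ss @ ts) \<phi> \<and>
      X = {xs \<in> tuples S ss. sat S (xs @ ps) \<phi>})"

definition definable :: "('s, 'f, 'r, 'a) mstruct \<Rightarrow> 's list \<Rightarrow> 'a list set \<Rightarrow> bool" where
  "definable S ss X \<longleftrightarrow> definable_over S UNIV ss X"


section \<open>One-sorted structures\<close>

text \<open>
  With \<^typ>\<open>unit\<close> as type of sorts, the arity of a symbol is the length of its list of
  argument sorts.
\<close>

type_synonym ('f, 'r, 'a) struct = "(unit, 'f, 'r, 'a) mstruct"

abbreviation carr :: "('f, 'r, 'a) struct \<Rightarrow> 'a set" where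
  "carr M \<equiv> univ M ()"

definition cart_pow :: "('f, 'r, 'a) struct \<Rightarrow> nat \<Rightarrow> 'a list set" where
  "cart_pow M n = tuples M (replicate n ())"

definition is_struct :: "('f, 'r, 'a) struct \<Rightarrow> bool" where
  "is_struct M \<longleftrightarrow>
    sorts M = {()} \<and> carr M \<noteq> {} \<and>
    (\<forall>f. \<forall>xs \<in> tuples M (fun_args M f). fun_int M f xs \<in> carr M)"

text \<open>
  Every set of formulas in one free variable over a finite tuple \<open>ps\<close> of parameters that is
  finitely satisfiable in \<open>M\<close> is realised in \<open>M\<close>.
\<close>

definition aleph0_saturated :: "('f, 'r, 'a) struct \<Rightarrow> bool" where
  "aleph0_saturated M \<longleftrightarrow>
    (\<forall>k. \<forall>ps \<in> cart_pow M k. \<forall>\<Phi>.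
      (\<forall>\<phi>\<in>\<Phi>. wf_fm M (replicate (Suc k) ()) \<phi>) \<and>
      (\<forall>\<Phi>0. finite \<Phi>0 \<and> \<Phi>0 \<subseteq> \<Phi> \<longrightarrow> (\<exists>a\<in>carr M. \<forall>\<phi>\<in>\<Phi>0. sat M (a # ps) \<phi>)) \<longrightarrow>
      (\<exists>a\<in>carr M. \<forall>\<phi>\<in>\<Phi>. sat M (a # ps) \<phi>))"


section \<open>Imaginaries\<close>

text \<open>
  The sorts of \<open>M\<^sup>e\<^sup>q\<close> are the home sort and one sort \<open>M\<^sup>n / E\<close> for every equivalence relation \<open>E\<close> on
  \<open>M\<^sup>n\<close> that is definable without parameters. Besides the symbols of \<open>M\<close>, its language has for each
  such \<open>E\<close> the quotient map \<open>M\<^sup>n \<rightarrow> M\<^sup>n / E\<close>.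
\<close>

datatype 'a eq_sort = HomeSort | QuotSort nat "('a list \<times> 'a list) set"

datatype 'a eq_elem = Real (the_real: 'a) | Imag "'a list set"

datatype ('f, 'a) eq_fun = Base 'f | Proj nat "('a list \<times> 'a list) set"

definition zero_definable_equiv ::
  "('f, 'r, 'a) struct \<Rightarrow> nat \<Rightarrow> ('a list \<times> 'a list) set \<Rightarrow> bool" where
  "zero_definable_equiv M n E \<longleftrightarrow>
    equiv (cart_pow M n) E \<and>
    definable_over M {} (replicate (n + n) ()) {xs @ ys | xs ys. (xs, ys) \<in> E}"

definition eq_struct ::
  "('f, 'r, 'a) struct \<Rightarrow> ('a eq_sort, ('f, 'a) eq_fun, 'r, 'a eq_elem) mstruct" where
  "eq_struct M = \<lparr>
    sorts = insert HomeSort {QuotSort n E | n E. zero_definable_equiv M n E},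
    univ = (\<lambda>s. case s of HomeSort \<Rightarrow> Real ` carr M | QuotSort n E \<Rightarrow> Imag ` (cart_pow M n // E)),
    fun_args = (\<lambda>f. case f of Base g \<Rightarrow> replicate (length (fun_args M g)) HomeSort
                            | Proj n E \<Rightarrow> replicate n HomeSort),
    fun_res = (\<lambda>f. case f of Base g \<Rightarrow> HomeSort | Proj n E \<Rightarrow> QuotSort n E),
    rel_args = (\<lambda>r. replicate (length (rel_args M r)) HomeSort),
    fun_int = (\<lambda>f xs. case f of Base g \<Rightarrow> Real (fun_int M g (map the_real xs))
                              | Proj n E \<Rightarrow> Imag (E `` {map the_real xs})),
    rel_int = (\<lambda>r xs. rel_int M r (map the_real xs)) \<rparr>"

abbreviation eq_definable ::
  "('f, 'r, 'a) struct \<Rightarrow> 'a eq_sort list \<Rightarrow> 'a eq_elem list set \<Rightarrow> bool" where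
  "eq_definable M \<equiv> definable (eq_struct M)"


section \<open>Uniform finiteness\<close>

definition uniformly_finite_set ::
  "('f, 'r, 'a) struct \<Rightarrow> 'a eq_sort list \<Rightarrow> 'a eq_elem list set \<Rightarrow> bool" where
  "uniformly_finite_set M ss X \<longleftrightarrow>
    (\<forall>ts T Y. eq_definable M ts T \<and> eq_definable M (ts @ ss) Y \<and>
        Y \<subseteq> {t @ x | t x. t \<in> T \<and> x \<in> X} \<longrightarrow>
      (\<exists>n. \<forall>t\<in>T. infinite {x \<in> X. t @ x \<in> Y} \<longleftrightarrow>
        infinite {x \<in> X. t @ x \<in> Y} \<or> card {x \<in> X. t @ x \<in> Y} > n))"

definition eq_uniform_finiteness :: "('f, 'r, 'a) struct \<Rightarrow> bool" where
  "eq_uniform_finiteness M \<longleftrightarrow>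
    (\<forall>ss X. eq_definable M ss X \<longrightarrow> uniformly_finite_set M ss X)"

definition imaginaries_from ::
  "('f, 'r, 'a) struct \<Rightarrow> 'a list set set \<Rightarrow> 'a eq_sort list \<Rightarrow> 'a eq_elem list set \<Rightarrow> bool" where
  "imaginaries_from M \<D> ss X \<longleftrightarrow>
    (\<exists>n R. eq_definable M (ss @ replicate n HomeSort) R \<and>
      R \<subseteq> {x @ map Real m | x m. x \<in> X \<and> m \<in> cart_pow M n} \<and>
      inj_on (\<lambda>x. {m \<in> cart_pow M n. x @ map Real m \<in> R}) X \<and>
      (\<forall>x\<in>X. {m \<in> cart_pow M n. x @ map Real m \<in> R} \<in> \<D>))"

definition collection_uniform_finiteness ::
  "('f, 'r, 'a) struct \<Rightarrow> 'a list set set \<Rightarrow> bool" where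
  "collection_uniform_finiteness M \<D> \<longleftrightarrow>
    (\<forall>ss X. eq_definable M ss X \<and> imaginaries_from M \<D> ss X \<longrightarrow> uniformly_finite_set M ss X)"


section \<open>Expansions of ordered groups and fields\<close>

text \<open>
  Here \<open>p\<close>, \<open>t\<close> and \<open>l\<close> are the symbols for addition, multiplication and the strict order, and
  \<open>z\<close> and \<open>u\<close> the zero and the unit. Ordered groups are not assumed to be commutative.
\<close>

definition less_rel :: "('f, 'r, 'a) struct \<Rightarrow> 'r \<Rightarrow> ('a \<times> 'a) set" where
  "less_rel M l = {(x, y). x \<in> carr M \<and> y \<in> carr M \<and> rel_int M l [x, y]}"

definition linearly_ordered :: "('f, 'r, 'a) struct \<Rightarrow> 'r \<Rightarrow> bool" where
  "linearly_ordered M l \<longleftrightarrow>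
    rel_args M l = [(), ()] \<and> strict_linear_order_on (carr M) (less_rel M l)"

definition order_convex :: "('f, 'r, 'a) struct \<Rightarrow> 'r \<Rightarrow> 'a set \<Rightarrow> bool" where
  "order_convex M l C \<longleftrightarrow>
    C \<subseteq> carr M \<and>
    (\<forall>x\<in>C. \<forall>y\<in>C. \<forall>w\<in>carr M. (x, w) \<in> less_rel M l \<and> (w, y) \<in> less_rel M l \<longrightarrow> w \<in> C)"

text \<open>
  Definability in \<open>M\<close> and in \<open>M\<^sup>e\<^sup>q\<close> agree for subsets of the home sort; weak o-minimality, a notion about
  arbitrary linearly ordered structures, is phrased with the former.
\<close>

definition weakly_o_minimal :: "('f, 'r, 'a) struct \<Rightarrow> 'r \<Rightarrow> bool" where
  "weakly_o_minimal M l \<longleftrightarrow>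
    linearly_ordered M l \<and>
    (\<forall>X. definable M [()] {[x] | x. x \<in> X} \<longrightarrow>
      (\<exists>\<C>. finite \<C> \<and> (\<forall>C\<in>\<C>. order_convex M l C) \<and> X = \<Union> \<C>))"

definition additive_group :: "('f, 'r, 'a) struct \<Rightarrow> 'f \<Rightarrow> 'a \<Rightarrow> 'a monoid" where
  "additive_group M p z = \<lparr> carrier = carr M, mult = (\<lambda>x y. fun_int M p [x, y]), one = z \<rparr>"

definition ring_of :: "('f, 'r, 'a) struct \<Rightarrow> 'f \<Rightarrow> 'a \<Rightarrow> 'f \<Rightarrow> 'a \<Rightarrow> 'a ring" where
  "ring_of M p z t u =
    \<lparr> carrier = carr M, mult = (\<lambda>x y. fun_int M t [x, y]), one = u,
      zero = z, add = (\<lambda>x y. fun_int M p [x, y]) \<rparr>"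

definition expands_ordered_group :: "('f, 'r, 'a) struct \<Rightarrow> 'r \<Rightarrow> 'f \<Rightarrow> 'a \<Rightarrow> bool" where
  "expands_ordered_group M l p z \<longleftrightarrow>
    linearly_ordered M l \<and> fun_args M p = [(), ()] \<and> group (additive_group M p z) \<and>
    (\<forall>x\<in>carr M. \<forall>y\<in>carr M. \<forall>w\<in>carr M. (x, y) \<in> less_rel M l \<longrightarrow>
      (fun_int M p [w, x], fun_int M p [w, y]) \<in> less_rel M l \<and>
      (fun_int M p [x, w], fun_int M p [y, w]) \<in> less_rel M l)"

definition expands_ordered_field ::
  "('f, 'r, 'a) struct \<Rightarrow> 'r \<Rightarrow> 'f \<Rightarrow> 'a \<Rightarrow> 'f \<Rightarrow> 'a \<Rightarrow> bool" where
  "expands_ordered_field M l p z t u \<longleftrightarrow>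
    expands_ordered_group M l p z \<and> fun_args M t = [(), ()] \<and> field (ring_of M p z t u) \<and>
    (\<forall>x\<in>carr M. \<forall>y\<in>carr M. (z, x) \<in> less_rel M l \<and> (z, y) \<in> less_rel M l \<longrightarrow>
      (z, fun_int M t [x, y]) \<in> less_rel M l)"

text \<open>A subset \<open>H\<close> of the home sort is regarded as a set of lists of length one.\<close>

definition definable_convex_subgroups ::
  "('f, 'r, 'a) struct \<Rightarrow> 'r \<Rightarrow> 'f \<Rightarrow> 'a \<Rightarrow> 'a list set set" where
  "definable_convex_subgroups M l p z =
    {{[h] | h. h \<in> H} | H. eq_definable M [HomeSort] {[Real h] | h. h \<in> H} \<and>
      order_convex M l H \<and> subgroup H (additive_group M p z)}"

definition valuation_subring :: "'a set \<Rightarrow> ('a, 'b) ring_scheme \<Rightarrow> bool" where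
  "valuation_subring V K \<longleftrightarrow>
    subring V K \<and> (\<forall>x \<in> carrier K - {\<zero>\<^bsub>K\<^esub>}. x \<in> V \<or> inv\<^bsub>K\<^esub> x \<in> V)"

definition definable_convex_valuation_subrings ::
  "('f, 'r, 'a) struct \<Rightarrow> 'r \<Rightarrow> 'f \<Rightarrow> 'a \<Rightarrow> 'f \<Rightarrow> 'a \<Rightarrow> 'a list set set" where
  "definable_convex_valuation_subrings M l p z t u =
    {{[v] | v. v \<in> V} | V. eq_definable M [HomeSort] {[Real v] | v. v \<in> V} \<and>
      order_convex M l V \<and> valuation_subring V (ring_of M p z t u)}"

end

theory Submission
  imports Defs "HOL-Library.Nat_Bijection"
begin

text \<open>
  Instead of codes for definable sets we count the members \<open>S x\<close> of a definable family themselves;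
  \<open>S\<close> has uniform finiteness if for every definable relation \<open>Z\<close> the cardinalities of the
  finite sets among \<open>{S x | x. Z t x}\<close> are bounded. An imaginary is its equivalence class, so all
  families of subsets of the \<open>M\<^sup>n\<close> have to be treated. Johnson's induction on \<open>n\<close> reduces to
  \<open>n = 1\<close>. By saturation the members of a family of unary sets have boundedly many convex
  components, so that they are determined by boundedly many cuts.

  Let \<open>Y\<close> be a finite set of cuts, all with the same stabilizer \<open>H\<close> and all (or none) of them having
  a largest coset of \<open>H\<close>. For small \<open>\<epsilon> > H\<close> the union of the sets \<open>(C + \<epsilon>) \<setminus> C\<close> over \<open>C \<in> Y\<close>
  has at least \<open>|Y|\<close> convex components, which bounds \<open>|Y|\<close>. As stabilizers are convex subgroups, this
  reduces uniform finiteness to convex subgroups. In the case of a field the same argument,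
  applied to the multiplicative group of positive elements, bounds the number of convex
  subgroups \<open>A\<close> with a given multiplier ring \<open>{y. y A \<subseteq> A}\<close>, which is a convex valuation ring.
\<close>

section \<open>Renaming of variables\<close>

text \<open>All families are defined without parameters; parameters are absorbed into the indices,
  so that one bound serves all of them. In particular the union of the differences between
  \<open>C \<epsilon>\<close> and \<open>C\<close> is not built from a list of cuts: it runs over
  all members of the family that have the stabilizer and the kind of one given member. So its
  parameters are \<open>\<epsilon>\<close>, \<open>t\<close> and one index, however many cuts there
  are.

  The obstacle is a pair of cuts with the same stabilizer \<open>H\<close> of which the larger
  exceeds the smaller by a single coset of \<open>H\<close>. Then no \<epsilon> above
  \<open>H\<close> moves the smaller cut to a set bounded strictly inside the larger one. The larger
  cut of such a pair has a largest coset. Comparing only cuts of the same kind leaves the case that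
  the smaller one has a largest coset too, and this is excluded by square roots, which give a coset
  strictly between the two largest ones. Groups are written multiplicatively, since both the
  additive group and the positive elements of a field are instances.\<close>

primrec ren_tm :: "(nat \<Rightarrow> nat) \<Rightarrow> 'f tm \<Rightarrow> 'f tm" where
  "ren_tm f (Var i) = Var (f i)"
| "ren_tm f (App g ts) = App g (map (ren_tm f) ts)"

primrec ren_fm :: "(nat \<Rightarrow> nat) \<Rightarrow> ('s, 'f, 'r) fm \<Rightarrow> ('s, 'f, 'r) fm" where
  "ren_fm f (Eq t u) = Eq (ren_tm f t) (ren_tm f u)"
| "ren_fm f (Rel r ts) = Rel r (map (ren_tm f) ts)"
| "ren_fm f (Neg \<phi>) = Neg (ren_fm f \<phi>)"
| "ren_fm f (Conj \<phi> \<psi>) = Conj (ren_fm f \<phi>) (ren_fm f \<psi>)"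
| "ren_fm f (Ex s \<phi>) = Ex s (ren_fm (case_nat 0 (\<lambda>i. Suc (f i))) \<phi>)"

lemma has_sort_ren:
  assumes "has_sort S \<Gamma> t s" and "\<And>i. i < length \<Gamma> \<Longrightarrow> f i < length \<Delta> \<and> \<Delta> ! f i = \<Gamma> ! i"
  shows "has_sort S \<Delta> (ren_tm f t) s"
  using assms(1)
proof induction
  case (Var i)
  then show ?case using assms(2)[of i] has_sort.Var[of "f i" \<Delta> S] by simp
next
  case (App ts g)
  then show ?case
    by (auto intro!: has_sort.App simp: list_all2_conv_all_nth)
qed

lemma wf_fm_ren:
  assumes "wf_fm S \<Gamma> \<phi>" and "\<And>i. i < length \<Gamma> \<Longrightarrow> f i < length \<Delta> \<and> \<Delta> ! f i = \<Gamma> ! i"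
  shows "wf_fm S \<Delta> (ren_fm f \<phi>)"
  using assms
proof (induction \<phi> arbitrary: \<Gamma> \<Delta> f)
  case (Eq t u)
  then show ?case using has_sort_ren[OF _ Eq(2), of S] by fastforce
next
  case (Rel r ts)
  then show ?case using has_sort_ren[OF _ Rel(2), of S]
    by (auto simp: list_all2_conv_all_nth)
next
  case (Neg \<phi>)
  from Neg.IH[of \<Gamma> f \<Delta>] Neg.prems show ?case by simp
next
  case (Conj \<phi> \<psi>)
  from Conj.IH(1)[of \<Gamma> f \<Delta>] Conj.IH(2)[of \<Gamma> f \<Delta>] Conj.prems show ?case by simp
next
  case (Ex s \<phi>)
  have "wf_fm S (s # \<Delta>) (ren_fm (case_nat 0 (\<lambda>i. Suc (f i))) \<phi>)"
    using Ex.prems by (intro Ex.IH[of "s # \<Gamma>"]) (auto split: nat.split)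
  then show ?case using Ex by auto
qed

lemma eval_tm_ren:
  assumes "has_sort S \<Gamma> t s" and "\<And>i. i < length \<Gamma> \<Longrightarrow> ys ! f i = xs ! i"
  shows "eval_tm S ys (ren_tm f t) = eval_tm S xs t"
  using assms(1)
proof induction
  case (Var i)
  then show ?case using assms(2) by simp
next
  case (App ts g)
  then have "map (eval_tm S ys \<circ> ren_tm f) ts = map (eval_tm S xs) ts"
    by (auto simp: list_all2_conv_all_nth in_set_conv_nth)
  then show ?case by (metis eval_tm.simps(2) ren_tm.simps(2) map_map)
qed

lemma sat_ren:
  assumes "wf_fm S \<Gamma> \<phi>" and "\<And>i. i < length \<Gamma> \<Longrightarrow> ys ! f i = xs ! i"
  shows "sat S ys (ren_fm f \<phi>) \<longleftrightarrow> sat S xs \<phi>"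
  using assms
proof (induction \<phi> arbitrary: \<Gamma> xs ys f)
  case (Eq t u)
  have "eval_tm S ys (ren_tm f t) = eval_tm S xs t" if "has_sort S \<Gamma> t s" for t s
    using that Eq(2) by (rule eval_tm_ren)
  moreover obtain s where "has_sort S \<Gamma> t s" "has_sort S \<Gamma> u s" using Eq(1) by auto
  ultimately show ?case by simp
next
  case (Rel r ts)
  have "eval_tm S ys (ren_tm f t) = eval_tm S xs t" if "has_sort S \<Gamma> t s" for t s
    using that Rel(2) by (rule eval_tm_ren)
  then have "map (eval_tm S ys \<circ> ren_tm f) ts = map (eval_tm S xs) ts"
    using Rel(1) by (fastforce simp: list_all2_conv_all_nth in_set_conv_nth)
  then show ?case by (metis sat.simps(2) ren_fm.simps(2) map_map)
next
  case (Neg \<phi>)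
  from Neg.IH[of \<Gamma> ys f xs] Neg.prems show ?case by simp
next
  case (Conj \<phi> \<psi>)
  from Conj.IH(1)[of \<Gamma> ys f xs] Conj.IH(2)[of \<Gamma> ys f xs] Conj.prems show ?case by simp
next
  case (Ex s \<phi>)
  have "sat S (a # ys) (ren_fm (case_nat 0 (\<lambda>i. Suc (f i))) \<phi>) \<longleftrightarrow> sat S (a # xs) \<phi>" for a
    using Ex.prems by (intro Ex.IH[of "s # \<Gamma>"]) (auto split: nat.split simp: nth_Cons)
  then show ?case by simp
qed

section \<open>Predicates definable without parameters\<close>

text \<open>
  A tuple is given as a sequence \<open>e :: nat \<Rightarrow> 'a\<close> of which a formula sees only an initial segment.
  This makes the handling of contexts uniform: two tuples are interleaved into one, and a
  quantified variable is pushed in front of the sequence.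
\<close>

named_theorems dfn_intros

locale fo_structure =
  fixes M :: "('f, 'r, 'a) struct"
  assumes M: "is_struct M"
begin

definition Env :: "(nat \<Rightarrow> 'a) set" where
  "Env = {e. \<forall>i. e i \<in> carr M}"

definition dfn :: "((nat \<Rightarrow> 'a) \<Rightarrow> bool) \<Rightarrow> bool" where
  "dfn P \<longleftrightarrow> (\<exists>n \<phi>. wf_fm M (replicate n ()) \<phi> \<and>
    (\<forall>e\<in>Env. P e \<longleftrightarrow> sat M (map e [0..<n]) \<phi>))"

definition dfn_tm :: "((nat \<Rightarrow> 'a) \<Rightarrow> 'a) \<Rightarrow> bool" where
  "dfn_tm g \<longleftrightarrow> (\<exists>n t. has_sort M (replicate n ()) t () \<and>
    (\<forall>e\<in>Env. g e = eval_tm M (map e [0..<n]) t))"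

lemma EnvD: "e \<in> Env \<Longrightarrow> e i \<in> carr M"
  by (simp add: Env_def)

lemma EnvI [intro]: "(\<And>i. e i \<in> carr M) \<Longrightarrow> e \<in> Env"
  by (simp add: Env_def)

lemma Env_case_nat [simp]: "case_nat a e \<in> Env \<longleftrightarrow> a \<in> carr M \<and> e \<in> Env"
  by (auto simp: Env_def split: nat.splits)

lemma sorts_M [simp]: "sorts M = {()}"
  using M by (simp add: is_struct_def)

lemma ex_carr: "\<exists>a. a \<in> carr M"
  using M by (auto simp: is_struct_def)

lemma Env_nonempty: "\<exists>e. e \<in> Env"
  using ex_carr by (auto simp: Env_def)

lemma tuples_M: "tuples M (replicate n ()) = {xs. length xs = n \<and> set xs \<subseteq> carr M}"
  by (auto simp: tuples_def list_all2_conv_all_nth set_conv_nth)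

lemma map_Env [simp]: "e \<in> Env \<Longrightarrow> map e xs \<in> tuples M (replicate (length xs) ())"
  by (auto simp: tuples_M EnvD)

lemma Env_extend:
  assumes "xs \<in> tuples M (replicate n ())"
  obtains e where "e \<in> Env" "xs = map e [0..<n]"
proof -
  obtain a where a: "a \<in> carr M" using ex_carr by blast
  let ?e = "\<lambda>i. if i < n then xs ! i else a"
  have "?e \<in> Env" using assms a nth_mem[of _ xs] by (auto simp: Env_def tuples_M)
  moreover have "xs = map ?e [0..<n]"
    using assms by (intro nth_equalityI) (auto simp: tuples_M)
  ultimately show ?thesis by (rule that)
qed

lemma unit_list: "(xs :: unit list) = replicate (length xs) ()"
  by (induction xs) auto

lemma fun_int_closed: "length xs = length (fun_args M f) \<Longrightarrow> set xs \<subseteq> carr M \<Longrightarrow> fun_int M f xs \<in> carr M"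
  using M tuples_M[of "length (fun_args M f)"] unfolding unit_list[of "fun_args M f", symmetric]
  by (auto simp: is_struct_def)

lemma sat_ren_Env:
  assumes "wf_fm M (replicate n ()) \<phi>" "\<forall>i<n. f i < m"
  shows "sat M (map e [0..<m]) (ren_fm f \<phi>) \<longleftrightarrow> sat M (map (\<lambda>i. e (f i)) [0..<n]) \<phi>"
  using assms(2) by (intro sat_ren[OF assms(1)]) auto

lemma eval_tm_ren_Env:
  assumes "has_sort M (replicate n ()) t s" "\<forall>i<n. f i < m"
  shows "eval_tm M (map e [0..<m]) (ren_tm f t) = eval_tm M (map (\<lambda>i. e (f i)) [0..<n]) t"
  using assms(2) by (intro eval_tm_ren[OF assms(1)]) auto

text \<open>A formula can be read in any longer context. A threshold instead of a single context
  allows two predicates to be brought into the same context.\<close>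

lemma dfn_mono:
  assumes "dfn P"
  shows "\<exists>n. \<forall>m\<ge>n. \<exists>\<phi>. wf_fm M (replicate m ()) \<phi> \<and> (\<forall>e\<in>Env. P e \<longleftrightarrow> sat M (map e [0..<m]) \<phi>)"
proof -
  obtain n \<phi> where \<phi>: "wf_fm M (replicate n ()) \<phi>" "\<forall>e\<in>Env. P e \<longleftrightarrow> sat M (map e [0..<n]) \<phi>"
    using assms unfolding dfn_def by blast
  have "wf_fm M (replicate m ()) (ren_fm id \<phi>) \<and>
      (\<forall>e\<in>Env. P e \<longleftrightarrow> sat M (map e [0..<m]) (ren_fm id \<phi>))" if "m \<ge> n" for m
    using that \<phi> wf_fm_ren[OF \<phi>(1), of id "replicate m ()"]
      sat_ren[OF \<phi>(1), of "map _ [0..<m]" id "map _ [0..<n]"] by auto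
  then show ?thesis by blast
qed

lemma dfn_tm_mono:
  assumes "dfn_tm g"
  shows "\<exists>n. \<forall>m\<ge>n. \<exists>t. has_sort M (replicate m ()) t () \<and> (\<forall>e\<in>Env. g e = eval_tm M (map e [0..<m]) t)"
proof -
  obtain n t where t: "has_sort M (replicate n ()) t ()" "\<forall>e\<in>Env. g e = eval_tm M (map e [0..<n]) t"
    using assms unfolding dfn_tm_def by blast
  have "has_sort M (replicate m ()) (ren_tm id t) () \<and>
      (\<forall>e\<in>Env. g e = eval_tm M (map e [0..<m]) (ren_tm id t))" if "m \<ge> n" for m
    using that t has_sort_ren[OF t(1), of id "replicate m ()"]
      eval_tm_ren[OF t(1), of "map _ [0..<m]" id "map _ [0..<n]"] by auto
  then show ?thesis by blast
qed

lemma dfn_cong: "(\<And>e. e \<in> Env \<Longrightarrow> P e \<longleftrightarrow> Q e) \<Longrightarrow> dfn P \<Longrightarrow> dfn Q"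
  unfolding dfn_def by metis

lemma dfn_reindex:
  assumes "dfn P"
  shows "dfn (\<lambda>e. P (\<lambda>i. e (f i)))"
proof -
  obtain n \<phi> where \<phi>: "wf_fm M (replicate n ()) \<phi>" "\<forall>e\<in>Env. P e \<longleftrightarrow> sat M (map e [0..<n]) \<phi>"
    using assms unfolding dfn_def by blast
  obtain m where m: "\<forall>i<n. f i < m"
    using finite_nat_set_iff_bounded[of "f ` {..<n}"] by auto
  have "(\<lambda>i. e (f i)) \<in> Env" if "e \<in> Env" for e using that by (auto simp: Env_def)
  then show ?thesis unfolding dfn_def using \<phi> m
    by (intro exI[of _ m] exI[of _ "ren_fm f \<phi>"])
       (auto intro!: wf_fm_ren[OF \<phi>(1)] simp: sat_ren_Env[OF \<phi>(1)])
qed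

text \<open>The lower bound on \<open>k\<close> is needed because a formula without free variables cannot
  mention any term if there are no constant symbols.\<close>

lemma dfn_support:
  assumes "dfn P" and "k > 0"
    and "\<And>e e'. e \<in> Env \<Longrightarrow> e' \<in> Env \<Longrightarrow> (\<And>i. i < k \<Longrightarrow> e i = e' i) \<Longrightarrow> P e \<longleftrightarrow> P e'"
  shows "\<exists>\<phi>. wf_fm M (replicate k ()) \<phi> \<and> (\<forall>e\<in>Env. P e \<longleftrightarrow> sat M (map e [0..<k]) \<phi>)"
proof -
  obtain n \<phi> where \<phi>: "wf_fm M (replicate n ()) \<phi>" "\<forall>e\<in>Env. P e \<longleftrightarrow> sat M (map e [0..<n]) \<phi>"
    using assms unfolding dfn_def by blast
  \<comment> \<open>All variables beyond \<open>k - 1\<close> are identified with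
    \<open>k - 1\<close>, which is a legal variable because \<open>k > 0\<close>; \<open>P\<close>
    does not depend on the values that this overwrites.\<close>
  let ?f = "\<lambda>i. min i (k - 1)"
  have "P e \<longleftrightarrow> sat M (map e [0..<k]) (ren_fm ?f \<phi>)" if e: "e \<in> Env" for e
  proof -
    have e': "(\<lambda>i. e (?f i)) \<in> Env" using e by (auto simp: Env_def)
    have "P e \<longleftrightarrow> P (\<lambda>i. e (?f i))"
      using assms(2) by (intro assms(3)[OF e e']) (auto simp: min_def)
    also have "\<dots> \<longleftrightarrow> sat M (map (\<lambda>i. e (?f i)) [0..<n]) \<phi>" using \<phi>(2) e' by blast
    also have "\<dots> \<longleftrightarrow> sat M (map e [0..<k]) (ren_fm ?f \<phi>)"
      using assms(2) by (intro sat_ren[OF \<phi>(1), symmetric]) (auto simp: min_def)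
    finally show ?thesis .
  qed
  moreover have "wf_fm M (replicate k ()) (ren_fm ?f \<phi>)"
    using assms(2) by (intro wf_fm_ren[OF \<phi>(1)]) auto
  ultimately show ?thesis by blast
qed

lemma dfn_finite_support:
  assumes "dfn P"
  obtains k where "\<And>e e'. e \<in> Env \<Longrightarrow> e' \<in> Env \<Longrightarrow> (\<And>i. i < k \<Longrightarrow> e i = e' i) \<Longrightarrow> P e \<longleftrightarrow> P e'"
proof -
  obtain n \<phi> where \<phi>: "\<forall>e\<in>Env. P e \<longleftrightarrow> sat M (map e [0..<n]) \<phi>"
    using assms unfolding dfn_def by blast
  have "P e \<longleftrightarrow> P e'" if "e \<in> Env" "e' \<in> Env" "\<And>i. i < n \<Longrightarrow> e i = e' i" for e e'
  proof -
    have "map e [0..<n] = map e' [0..<n]" using that(3) by auto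
    then show ?thesis using \<phi> that(1,2) by metis
  qed
  then show ?thesis by (rule that)
qed

section \<open>Closure of definability under connectives and quantifiers\<close>

lemma dfn_not [dfn_intros]: "dfn P \<Longrightarrow> dfn (\<lambda>e. \<not> P e)"
  unfolding dfn_def by (metis wf_fm.simps(3) sat.simps(3))

lemma dfn_conj [dfn_intros]:
  assumes "dfn P" "dfn Q" shows "dfn (\<lambda>e. P e \<and> Q e)"
proof -
  obtain n where n: "\<forall>m\<ge>n. \<exists>\<phi>. wf_fm M (replicate m ()) \<phi> \<and> (\<forall>e\<in>Env. P e \<longleftrightarrow> sat M (map e [0..<m]) \<phi>)"
    using dfn_mono[OF assms(1)] by blast
  obtain k where k: "\<forall>m\<ge>k. \<exists>\<phi>. wf_fm M (replicate m ()) \<phi> \<and> (\<forall>e\<in>Env. Q e \<longleftrightarrow> sat M (map e [0..<m]) \<phi>)"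
    using dfn_mono[OF assms(2)] by blast
  obtain \<phi> where "wf_fm M (replicate (n+k) ()) \<phi>" "\<forall>e\<in>Env. P e \<longleftrightarrow> sat M (map e [0..<n+k]) \<phi>"
    using n by (meson le_add1)
  moreover obtain \<psi> where "wf_fm M (replicate (n+k) ()) \<psi>" "\<forall>e\<in>Env. Q e \<longleftrightarrow> sat M (map e [0..<n+k]) \<psi>"
    using k by (meson le_add2)
  ultimately show ?thesis unfolding dfn_def
    by (intro exI[of _ "n+k"] exI[of _ "Conj \<phi> \<psi>"]) simp
qed

lemma dfn_imp [dfn_intros]: "dfn P \<Longrightarrow> dfn Q \<Longrightarrow> dfn (\<lambda>e. P e \<longrightarrow> Q e)"
  using dfn_not[OF dfn_conj[of P "\<lambda>e. \<not> Q e"]] dfn_not[of Q] by simp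

lemma dfn_disj [dfn_intros]: "dfn P \<Longrightarrow> dfn Q \<Longrightarrow> dfn (\<lambda>e. P e \<or> Q e)"
  using dfn_imp[of "\<lambda>e. \<not> P e" Q] dfn_not[of P] by (simp add: disj_imp)

lemma dfn_iff [dfn_intros]: "dfn P \<Longrightarrow> dfn Q \<Longrightarrow> dfn (\<lambda>e. P e \<longleftrightarrow> Q e)"
  using dfn_conj[OF dfn_imp[of P Q] dfn_imp[of Q P]] by (simp add: iff_conv_conj_imp)

lemma dfn_ex [dfn_intros]:
  assumes "dfn (\<lambda>e. Q (\<lambda>i. e (Suc i)) (e 0))"
  shows "dfn (\<lambda>e. \<exists>a\<in>carr M. Q e a)"
proof -
  obtain n \<phi> where \<phi>: "wf_fm M (replicate (Suc n) ()) \<phi>"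
    "\<forall>e\<in>Env. Q (\<lambda>i. e (Suc i)) (e 0) \<longleftrightarrow> sat M (map e [0..<Suc n]) \<phi>"
    using dfn_mono[OF assms] by (meson le_SucI order_refl)
  have "Q e a \<longleftrightarrow> sat M (a # map e [0..<n]) \<phi>" if "e \<in> Env" "a \<in> carr M" for e a
    using bspec[OF \<phi>(2), of "case_nat a e"] that
    by (simp add: map_upt_Suc del: upt_Suc)
  then show ?thesis unfolding dfn_def using \<phi>(1)
    by (intro exI[of _ n] exI[of _ "Ex () \<phi>"]) auto
qed

lemma dfn_all [dfn_intros]:
  assumes "dfn (\<lambda>e. Q (\<lambda>i. e (Suc i)) (e 0))"
  shows "dfn (\<lambda>e. \<forall>a\<in>carr M. Q e a)"
  using dfn_not[OF dfn_ex[OF dfn_not[OF assms]]] by simp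

lemma dfn_True [dfn_intros]: "dfn (\<lambda>e. True)"
  unfolding dfn_def
  by (rule exI[of _ 1], rule exI[of _ "Eq (Var 0) (Var 0)"]) (auto intro: exI[of _ "()"] has_sort.Var[of 0 "[()]" M, simplified])

lemma dfn_const [dfn_intros]: "dfn (\<lambda>e. b)"
  using dfn_True dfn_not[OF dfn_True] by (cases b) auto

lemma dfn_ball_finite:
  assumes "finite I" "\<And>i. i \<in> I \<Longrightarrow> dfn (P i)"
  shows "dfn (\<lambda>e. \<forall>i\<in>I. P i e)"
  using assms by (induction I) (auto intro!: dfn_intros)

lemma dfn_all_less: "(\<And>i. i < n \<Longrightarrow> dfn (P i)) \<Longrightarrow> dfn (\<lambda>e. \<forall>i<n. P i e)" for n :: nat
  using dfn_ball_finite[of "{..<n}" P] by (simp add: Ball_def)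

section \<open>Terms and atomic formulas\<close>

lemma dfn_tm_var [dfn_intros]: "dfn_tm (\<lambda>e. e i)"
  unfolding dfn_tm_def
  by (intro exI[of _ "Suc i"] exI[of _ "Var i"])
     (use has_sort.Var[of i "replicate (Suc i) ()" M] in \<open>auto simp del: replicate_Suc upt_Suc\<close>)

lemma dfn_tm_list:
  assumes "\<And>g. g \<in> set gs \<Longrightarrow> dfn_tm g"
  shows "\<exists>n. \<forall>m\<ge>n. \<exists>ts. list_all2 (has_sort M (replicate m ())) ts (replicate (length gs) ()) \<and>
    (\<forall>e\<in>Env. map (\<lambda>g. g e) gs = map (eval_tm M (map e [0..<m])) ts)"
  using assms
proof (induction gs)
  case Nil
  then show ?case by (auto intro: exI[of _ "[]"])
next
  case (Cons g gs)
  obtain n where n: "\<And>m. m\<ge>n \<Longrightarrow> \<exists>ts. list_all2 (has_sort M (replicate m ())) ts (replicate (length gs) ()) \<and>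
    (\<forall>e\<in>Env. map (\<lambda>g. g e) gs = map (eval_tm M (map e [0..<m])) ts)"
    using Cons by force
  obtain n' where n': "\<And>m. m\<ge>n' \<Longrightarrow> \<exists>t. has_sort M (replicate m ()) t () \<and> (\<forall>e\<in>Env. g e = eval_tm M (map e [0..<m]) t)"
    using dfn_tm_mono[of g] Cons(2) by force
  show ?case
  proof (intro exI[of _ "n + n'"] allI impI)
    fix m assume m: "n + n' \<le> m"
    obtain ts where ts: "list_all2 (has_sort M (replicate m ())) ts (replicate (length gs) ())"
      "\<forall>e\<in>Env. map (\<lambda>g. g e) gs = map (eval_tm M (map e [0..<m])) ts"
      using n[of m] m by auto
    obtain t where "has_sort M (replicate m ()) t ()" "\<forall>e\<in>Env. g e = eval_tm M (map e [0..<m]) t"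
      using n'[of m] m by auto
    with ts show "\<exists>ts. list_all2 (has_sort M (replicate m ())) ts (replicate (length (g # gs)) ()) \<and>
      (\<forall>e\<in>Env. map (\<lambda>g. g e) (g # gs) = map (eval_tm M (map e [0..<m])) ts)"
      by (intro exI[of _ "t # ts"]) auto
  qed
qed

lemma dfn_tm_app:
  assumes "\<And>g. g \<in> set gs \<Longrightarrow> dfn_tm g" "length gs = length (fun_args M f)"
  shows "dfn_tm (\<lambda>e. fun_int M f (map (\<lambda>g. g e) gs))"
proof -
  obtain n ts where ts: "list_all2 (has_sort M (replicate n ())) ts (replicate (length gs) ())"
    "\<forall>e\<in>Env. map (\<lambda>g. g e) gs = map (eval_tm M (map e [0..<n])) ts"
    using dfn_tm_list[OF assms(1)] by blast
  have "has_sort M (replicate n ()) (App f ts) ()"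
    using has_sort.App[of M "replicate n ()" ts f] ts(1) unfolding assms(2) unit_list[symmetric] by simp
  then show ?thesis unfolding dfn_tm_def using ts(2)
    by (intro exI[of _ n] exI[of _ "App f ts"]) simp
qed

lemma dfn_rel:
  assumes "\<And>g. g \<in> set gs \<Longrightarrow> dfn_tm g" "length gs = length (rel_args M r)"
  shows "dfn (\<lambda>e. rel_int M r (map (\<lambda>g. g e) gs))"
proof -
  obtain n ts where ts: "list_all2 (has_sort M (replicate n ())) ts (replicate (length gs) ())"
    "\<forall>e\<in>Env. map (\<lambda>g. g e) gs = map (eval_tm M (map e [0..<n])) ts"
    using dfn_tm_list[OF assms(1)] by blast
  have "wf_fm M (replicate n ()) (Rel r ts)"
    using ts(1) unfolding assms(2) unit_list[symmetric] by simp
  then show ?thesis unfolding dfn_def using ts(2)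
    by (intro exI[of _ n] exI[of _ "Rel r ts"]) simp
qed

lemma dfn_eq [dfn_intros]:
  assumes "dfn_tm g" "dfn_tm h"
  shows "dfn (\<lambda>e. g e = h e)"
proof -
  have "dfn_tm f" if "f \<in> set [g, h]" for f using that assms by auto
  then obtain n ts where ts: "list_all2 (has_sort M (replicate n ())) ts (replicate (length [g, h]) ())"
    "\<forall>e\<in>Env. map (\<lambda>g. g e) [g, h] = map (eval_tm M (map e [0..<n])) ts"
    using dfn_tm_list by blast
  then obtain t u where tu: "ts = [t, u]" by (auto simp: list_all2_Cons2)
  show ?thesis unfolding dfn_def using ts
    by (intro exI[of _ n] exI[of _ "Eq t u"]) (auto simp: tu)
qed

lemma eval_tm_closed:
  assumes "has_sort M (replicate n ()) t s" "e \<in> Env"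
  shows "eval_tm M (map e [0..<n]) t \<in> carr M"
  using assms(1)
proof induction
  case (Var i)
  then show ?case using assms(2) by (simp add: EnvD)
next
  case (App ts f)
  then have "set (map (eval_tm M (map e [0..<n])) ts) \<subseteq> carr M"
    by (auto simp: list_all2_conv_all_nth in_set_conv_nth)
  moreover have "length (map (eval_tm M (map e [0..<n])) ts) = length (fun_args M f)"
    using App by (auto simp: list_all2_conv_all_nth)
  ultimately show ?case by (simp add: fun_int_closed)
qed

lemma dfn_tm_closed: "dfn_tm g \<Longrightarrow> e \<in> Env \<Longrightarrow> g e \<in> carr M"
  unfolding dfn_tm_def using eval_tm_closed by metis

text \<open>A block of \<open>k\<close> quantifiers is written as one quantifier over a sequence
  whose entries from \<open>k\<close> on are ignored. The induction peels off the last entry of the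
  block, which is the outermost quantifier.\<close>

lemma dfn_ex_initial:
  assumes "dfn P"
  shows "dfn (\<lambda>e. \<exists>x\<in>Env. P (\<lambda>i. if i < k then x i else e (i - k)))"
  using assms
proof (induction k)
  case 0
  then show ?case using Env_nonempty by simp
next
  case (Suc k)
  let ?F = "\<lambda>e. \<exists>x\<in>Env. P (\<lambda>i. if i < k then x i else e (i - k))"
  have "dfn (\<lambda>e. \<exists>a\<in>carr M. ?F (case_nat a e))"
  proof (rule dfn_ex)
    show "dfn (\<lambda>e. ?F (case_nat (e 0) (\<lambda>i. e (Suc i))))"
    proof (rule dfn_cong[OF _ Suc.IH[OF Suc.prems]])
      fix e :: "nat \<Rightarrow> 'a"
      have *: "case_nat (e 0) (\<lambda>i. e (Suc i)) = e" by (auto split: nat.split)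
      show "?F e \<longleftrightarrow> ?F (case_nat (e 0) (\<lambda>i. e (Suc i)))" by (simp only: *)
    qed
  qed
  then show ?case
  proof (rule dfn_cong[rotated])
    fix e :: "nat \<Rightarrow> 'a"
    have shift: "(\<lambda>i. if i < k then x i else case_nat a e (i - k)) =
        (\<lambda>i. if i < Suc k then (x(k := a)) i else e (i - Suc k))" for x :: "nat \<Rightarrow> 'a" and a
    proof
      fix i
      consider "i < k" | "i = k" | j where "i = Suc (k + j)"
        by (metis less_imp_Suc_add linorder_neqE_nat)
      then show "(if i < k then x i else case_nat a e (i - k)) =
          (if i < Suc k then (x(k := a)) i else e (i - Suc k))"
        by cases (simp_all add: Suc_diff_le)
    qed
    show "(\<exists>a\<in>carr M. ?F (case_nat a e)) \<longleftrightarrow> (\<exists>x\<in>Env. P (\<lambda>i. if i < Suc k then x i else e (i - Suc k)))" (is "?L \<longleftrightarrow> ?R")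
    proof
      assume ?L
      then obtain a x where ax: "a \<in> carr M" "x \<in> Env" "P (\<lambda>i. if i < k then x i else case_nat a e (i - k))" by blast
      from ax(3) show ?R using ax(1,2) by (intro bexI[of _ "x(k := a)"]) (auto simp: Env_def shift)
    next
      assume ?R
      then obtain x where x: "x \<in> Env" "P (\<lambda>i. if i < Suc k then x i else e (i - Suc k))" by blast
      have "P (\<lambda>i. if i < k then x i else case_nat (x k) e (i - k))"
        unfolding shift using x(2) by (simp only: fun_upd_triv)
      then show ?L using x(1) EnvD[OF x(1)] by blast
    qed
  qed
qed

text \<open>A quantifier over an infinite sequence is still first-order because \<open>Q\<close>
  depends on finitely many entries only.\<close>

lemma dfn_ex_Env [dfn_intros]:
  assumes "dfn (\<lambda>e. Q (\<lambda>i. e (2 * i)) (\<lambda>i. e (Suc (2 * i))))"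
  shows "dfn (\<lambda>e. \<exists>x\<in>Env. Q e x)"
proof -
  obtain n where n: "\<And>e e'. e \<in> Env \<Longrightarrow> e' \<in> Env \<Longrightarrow> (\<And>i. i < n \<Longrightarrow> e i = e' i) \<Longrightarrow>
      Q (\<lambda>i. e (2 * i)) (\<lambda>i. e (Suc (2 * i))) \<longleftrightarrow> Q (\<lambda>i. e' (2 * i)) (\<lambda>i. e' (Suc (2 * i)))"
    using dfn_finite_support[OF assms] by blast
  \<comment> \<open>Being positive, \<open>k\<close> leaves at least one entry, so that entry 0 can
    stand in for every entry beyond the support.\<close>
  define k where "k = Suc n"
  have Q: "Q e x \<longleftrightarrow> Q e x'" if "e \<in> Env" "x \<in> Env" "x' \<in> Env" "\<And>i. i < k \<Longrightarrow> x i = x' i" for e x x'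
    using n[of "\<lambda>i. if even i then e (i div 2) else x (i div 2)" "\<lambda>i. if even i then e (i div 2) else x' (i div 2)"]
      that by (auto simp: Env_def k_def)
  have "dfn (\<lambda>w. Q (\<lambda>i. w (k + i)) (\<lambda>i. w (if i < k then i else 0)))"
    using dfn_reindex[OF assms, of "\<lambda>i. if even i then k + i div 2 else if i div 2 < k then i div 2 else 0"]
    by (simp cong: if_cong)
  moreover have "(if (if i < k then i else 0) < k then x (if i < k then i else 0) else y) =
      x (if i < k then i else 0)" for x :: "nat \<Rightarrow> 'a" and i y
    by (simp add: k_def)
  ultimately have "dfn (\<lambda>e. \<exists>x\<in>Env. Q e (\<lambda>i. x (if i < k then i else 0)))"
    using dfn_ex_initial[of "\<lambda>w. Q (\<lambda>i. w (k + i)) (\<lambda>i. w (if i < k then i else 0))" k]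
    by (simp only: not_add_less1 if_False diff_add_inverse)
  then show ?thesis
  proof (rule dfn_cong[rotated])
    fix e assume e: "e \<in> Env"
    have "Q e (\<lambda>i. x (if i < k then i else 0)) \<longleftrightarrow> Q e x" if "x \<in> Env" for x
      using that by (intro Q[OF e]) (auto simp: Env_def)
    then show "(\<exists>x\<in>Env. Q e (\<lambda>i. x (if i < k then i else 0))) \<longleftrightarrow> (\<exists>x\<in>Env. Q e x)" by blast
  qed
qed

text \<open>Terms are substituted without touching formulas: a quantified sequence \<open>x\<close>
  is tied to the terms by the equations \<open>x i = g i e\<close>, of which the finite support of
  \<open>P\<close> needs only finitely many.\<close>

lemma dfn_subst:
  assumes "dfn P" "\<And>i. dfn_tm (g i)"
  shows "dfn (\<lambda>e. P (\<lambda>i. g i e))"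
proof -
  obtain n where n: "\<And>e e'. e \<in> Env \<Longrightarrow> e' \<in> Env \<Longrightarrow> (\<And>i. i < n \<Longrightarrow> e i = e' i) \<Longrightarrow> P e \<longleftrightarrow> P e'"
    using dfn_finite_support[OF assms(1)] by blast
  have g: "dfn_tm (\<lambda>e. g i (\<lambda>j. e (f j)))" for i f
  proof -
    obtain n t where t: "has_sort M (replicate n ()) t ()" "\<forall>e\<in>Env. g i e = eval_tm M (map e [0..<n]) t"
      using assms(2)[of i] unfolding dfn_tm_def by blast
    obtain m where m: "\<forall>i<n. f i < m"
      using finite_nat_set_iff_bounded[of "f ` {..<n}"] by auto
    have "(\<lambda>i. e (f i)) \<in> Env" if "e \<in> Env" for e using that by (auto simp: Env_def)
    then show ?thesis unfolding dfn_tm_def using t m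
      by (intro exI[of _ m] exI[of _ "ren_tm f t"])
        (auto intro!: has_sort_ren[OF t(1)] simp: eval_tm_ren_Env[OF t(1)])
  qed
  have "dfn (\<lambda>e. \<exists>x\<in>Env. (\<forall>i<n. x i = g i e) \<and> P x)"
    by (intro dfn_intros dfn_all_less g dfn_reindex[OF assms(1)])
  then show ?thesis
  proof (rule dfn_cong[rotated])
    fix e assume e: "e \<in> Env"
    then have gE: "(\<lambda>i. g i e) \<in> Env" using dfn_tm_closed[OF assms(2)] by auto
    show "(\<exists>x\<in>Env. (\<forall>i<n. x i = g i e) \<and> P x) \<longleftrightarrow> P (\<lambda>i. g i e)"
    proof
      assume "\<exists>x\<in>Env. (\<forall>i<n. x i = g i e) \<and> P x"
      then obtain x where "x \<in> Env" "\<And>i. i < n \<Longrightarrow> x i = g i e" "P x" by blast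
      then show "P (\<lambda>i. g i e)" using n[of x "\<lambda>i. g i e"] gE by simp
    next
      assume "P (\<lambda>i. g i e)"
      then show "\<exists>x\<in>Env. (\<forall>i<n. x i = g i e) \<and> P x" by (intro bexI[OF _ gE]) simp
    qed
  qed
qed

end

section \<open>Uniform finiteness of definable families\<close>

lemma card_le_product:
  assumes "finite J" and fin: "\<And>j. j \<in> J \<Longrightarrow> finite (\<phi> j ` X)"
    and le: "\<And>j. j \<in> J \<Longrightarrow> card (\<phi> j ` X) \<le> N"
    and v: "\<And>x y. x \<in> X \<Longrightarrow> y \<in> X \<Longrightarrow> (\<And>j. j \<in> J \<Longrightarrow> \<phi> j x = \<phi> j y) \<Longrightarrow> v x = v y"
  shows "card (v ` X) \<le> N ^ card J"
proof -
  define \<Phi> where "\<Phi> x = restrict (\<lambda>j. \<phi> j x) J" for x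
  define w where "w f = v (SOME x. x \<in> X \<and> \<Phi> x = f)" for f
  have "v x = w (\<Phi> x)" if "x \<in> X" for x
  proof -
    have s: "(SOME y. y \<in> X \<and> \<Phi> y = \<Phi> x) \<in> X \<and> \<Phi> (SOME y. y \<in> X \<and> \<Phi> y = \<Phi> x) = \<Phi> x"
      using that by (intro someI[of "\<lambda>y. y \<in> X \<and> \<Phi> y = \<Phi> x"]) auto
    have "\<phi> j x = \<phi> j (SOME y. y \<in> X \<and> \<Phi> y = \<Phi> x)" if "j \<in> J" for j
      using fun_cong[OF conjunct2[OF s], of j] that by (simp add: \<Phi>_def)
    then show ?thesis unfolding w_def using s that by (intro v) auto
  qed
  then have "v ` X = w ` \<Phi> ` X" by (auto simp: image_image)
  moreover have sub: "\<Phi> ` X \<subseteq> PiE J (\<lambda>j. \<phi> j ` X)" by (auto simp: \<Phi>_def)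
  moreover have fP: "finite (PiE J (\<lambda>j. \<phi> j ` X))" using assms(1) fin by (intro finite_PiE)
  ultimately have "card (v ` X) \<le> card (PiE J (\<lambda>j. \<phi> j ` X))"
    by (metis card_image_le card_mono finite_subset le_trans)
  also have "\<dots> = (\<Prod>j\<in>J. card (\<phi> j ` X))" by (rule card_PiE[OF assms(1)])
  also have "\<dots> \<le> (\<Prod>j\<in>J. N)" by (rule prod_mono) (simp add: le)
  finally show ?thesis by simp
qed

lemma card_le_fibres:
  assumes "finite A" "card (f ` A) \<le> n" "\<And>a. a \<in> A \<Longrightarrow> card {b \<in> A. f b = f a} \<le> k"
  shows "card A \<le> n * k"
proof -
  have "card A = (\<Sum>c\<in>f ` A. card {b \<in> A. f b = c})"
    using assms(1) sum.image_gen[OF assms(1), of "\<lambda>_. 1::nat" f] by simp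
  also have "\<dots> \<le> (\<Sum>c\<in>f ` A. k)" by (intro sum_mono) (use assms(3) in auto)
  also have "\<dots> \<le> n * k" using assms(2) by simp
  finally show ?thesis .
qed

lemma case_nat_comp: "(\<lambda>i. e (case_nat a f i)) = case_nat (e a) (\<lambda>i. e (f i))"
  by (auto split: nat.split)

lemma case_nat_eta: "case_nat (e 0) (\<lambda>i. e (Suc i)) = e"
  by (auto split: nat.split)

context fo_structure
begin

lemma Env_comp [simp]: "e \<in> Env \<Longrightarrow> (\<lambda>i. e (f i)) \<in> Env"
  by (simp add: Env_def)

text \<open>Entry 0 of the coded sequence is the point, the rest is the index. Parameters of a
  definable family of subsets of \<open>M\<close> are further entries of the index
  \<open>x\<close>.\<close>

definition dfam :: "((nat \<Rightarrow> 'a) \<Rightarrow> 'a set) \<Rightarrow> bool" where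
  "dfam S \<longleftrightarrow> (\<forall>x\<in>Env. S x \<subseteq> carr M) \<and> dfn (\<lambda>e. e 0 \<in> S (\<lambda>i. e (Suc i)))"

definition drel :: "((nat \<Rightarrow> 'a) \<Rightarrow> (nat \<Rightarrow> 'a) \<Rightarrow> bool) \<Rightarrow> bool" where
  "drel Z \<longleftrightarrow> dfn (\<lambda>e. Z (\<lambda>i. e (2 * i)) (\<lambda>i. e (Suc (2 * i))))"

text \<open>A subset of a power of \<open>M\<close> is represented by the cylinder over it in
  \<open>Env\<close>. The dimension is hidden in the finite support of \<open>R\<close> and can vary
  in an induction.\<close>

definition slice :: "((nat \<Rightarrow> 'a) \<Rightarrow> (nat \<Rightarrow> 'a) \<Rightarrow> bool) \<Rightarrow> (nat \<Rightarrow> 'a) \<Rightarrow> (nat \<Rightarrow> 'a) set" where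
  "slice R x = {m \<in> Env. R x m}"

text \<open>The type of the members is left open because both subsets of \<open>M\<close> and
  slices, which are sets of sequences, are counted.\<close>

definition ufin :: "((nat \<Rightarrow> 'a) \<Rightarrow> 'b set) \<Rightarrow> bool" where
  "ufin S \<longleftrightarrow> (\<forall>Z. drel Z \<longrightarrow> (\<exists>N. \<forall>t\<in>Env. finite (S ` slice Z t) \<longrightarrow> card (S ` slice Z t) \<le> N))"

lemma ufinD:
  assumes "ufin S" "drel Z"
  obtains N where "\<And>t. t \<in> Env \<Longrightarrow> finite (S ` slice Z t) \<Longrightarrow> card (S ` slice Z t) \<le> N"
  using assms unfolding ufin_def by blast

lemma dfam_subset: "dfam S \<Longrightarrow> x \<in> Env \<Longrightarrow> a \<in> S x \<Longrightarrow> a \<in> carr M"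
  by (auto simp: dfam_def)

lemma dfn_mem:
  assumes "dfam S" "dfn_tm g"
  shows "dfn (\<lambda>e. g e \<in> S (\<lambda>i. e (f i)))"
proof -
  have "dfn_tm (case_nat g (\<lambda>i e. e (f i)) i)" for i
    using assms(2) by (cases i) (auto intro: dfn_intros)
  then show ?thesis
    using dfn_subst[of "\<lambda>e. e 0 \<in> S (\<lambda>i. e (Suc i))" "case_nat g (\<lambda>i e. e (f i))"] assms(1)
    by (simp add: dfam_def)
qed

lemma dfn_drel:
  assumes "drel Z"
  shows "dfn (\<lambda>e. Z (\<lambda>i. e (f i)) (\<lambda>i. e (g i)))"
  using dfn_reindex[OF assms[unfolded drel_def], of "\<lambda>i. if even i then f (i div 2) else g (i div 2)"]
  by simp

lemma dfamI:
  "dfn (\<lambda>e. P (\<lambda>i. e (Suc i)) (e 0)) \<Longrightarrow> dfam (\<lambda>x. {a \<in> carr M. P x a})"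
  unfolding dfam_def by (auto elim!: dfn_cong[rotated] simp: EnvD)

lemma dfam_cong:
  assumes "\<And>x. x \<in> Env \<Longrightarrow> S x = T x" and "dfam S"
  shows "dfam T"
proof -
  have "dfn (\<lambda>e. e 0 \<in> S (\<lambda>i. e (Suc i)))" using assms(2) by (simp add: dfam_def)
  then have "dfn (\<lambda>e. e 0 \<in> T (\<lambda>i. e (Suc i)))"
    by (rule dfn_cong[rotated]) (simp add: assms(1))
  then show ?thesis using assms by (simp add: dfam_def)
qed

lemma dfam_finite_support:
  assumes "dfam S"
  obtains n where "\<And>x y. x \<in> Env \<Longrightarrow> y \<in> Env \<Longrightarrow> (\<And>i. i < n \<Longrightarrow> x i = y i) \<Longrightarrow> S x = S y"
proof -
  obtain n where n: "\<And>e e'. e \<in> Env \<Longrightarrow> e' \<in> Env \<Longrightarrow> (\<And>i. i < n \<Longrightarrow> e i = e' i) \<Longrightarrow>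
      e 0 \<in> S (\<lambda>i. e (Suc i)) \<longleftrightarrow> e' 0 \<in> S (\<lambda>i. e' (Suc i))"
    using dfn_finite_support[of "\<lambda>e. e 0 \<in> S (\<lambda>i. e (Suc i))"] assms unfolding dfam_def by blast
  have "S x = S y" if xy: "x \<in> Env" "y \<in> Env" "\<And>i. i < n \<Longrightarrow> x i = y i" for x y
  proof -
    have "a \<in> S x \<longleftrightarrow> a \<in> S y" if "a \<in> carr M" for a
      using n[of "case_nat a x" "case_nat a y"] that xy by (auto split: nat.splits)
    then show ?thesis using dfam_subset[OF assms] xy by blast
  qed
  then show ?thesis by (rule that)
qed

text \<open>
  Johnson's reduction to unary sets. Finitely many sets \<open>A\<close> of \<open>(n + 1)\<close>-tuples have finitely
  many sets \<open>{a. A\<^sub>a \<noteq> B\<^sub>a}\<close> of points separating them, hence a bounded number \<open>k\<close> of these; picking a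
  point in each of them, every \<open>A\<close> is determined by \<open>k\<close> sections, each with boundedly many values.
\<close>

lemma ufin_slice_if_unary:
  assumes unary: "\<And>S. dfam S \<Longrightarrow> ufin S"
    and "drel R"
    and "\<And>x m m'. x \<in> Env \<Longrightarrow> m \<in> Env \<Longrightarrow> m' \<in> Env \<Longrightarrow> (\<And>i. i < b \<Longrightarrow> m i = m' i) \<Longrightarrow> R x m \<longleftrightarrow> R x m'"
  shows "ufin (slice R)"
  using assms(2,3)
proof (induction b arbitrary: R)
  case 0
  have "slice R ` slice Z t \<subseteq> {{}, Env}" for Z t
    using 0(2) by (auto simp: slice_def)
  then have "card (slice R ` slice Z t) \<le> card {{}, Env}" for Z t
    by (intro card_mono) auto
  then show ?case unfolding ufin_def by blast
next
  case (Suc b)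
  \<comment> \<open>\<open>R'\<close> makes the first coordinate a part of the index and so has
    support \<open>b\<close>. In \<open>S\<close> the index \<open>w\<close> interleaves two indices
    of \<open>R\<close>, and the member consists of the points at which the two sections
    differ.\<close>
  define R' where "R' w m \<longleftrightarrow> R (\<lambda>i. w (Suc i)) (case_nat (w 0) m)" for w m
  define S where "S w = {a \<in> carr M. \<exists>m\<in>Env. R (\<lambda>i. w (2 * i)) (case_nat a m) \<noteq> R (\<lambda>i. w (Suc (2 * i))) (case_nat a m)}" for w
  have dR': "drel R'"
    unfolding drel_def R'_def
    using dfn_drel[OF Suc.prems(1), of "\<lambda>i. 2 * Suc i" "case_nat 0 (\<lambda>i. Suc (2 * i))"]
    by (simp add: case_nat_comp)
  have "R' x m \<longleftrightarrow> R' x m'" if "x \<in> Env" "m \<in> Env" "m' \<in> Env" "\<And>i. i < b \<Longrightarrow> m i = m' i" for x m m'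
    unfolding R'_def using that by (intro Suc.prems(2)) (auto simp: EnvD split: nat.split)
  from Suc.IH[OF dR' this] have uR': "ufin (slice R')" .
  have "dfam S"
    unfolding S_def
  proof (rule dfamI, rule dfn_ex_Env)
    show "dfn (\<lambda>e. R (\<lambda>i. e (2 * Suc (2 * i))) (case_nat (e (2 * 0)) (\<lambda>i. e (Suc (2 * i)))) \<noteq>
         R (\<lambda>i. e (2 * Suc (Suc (2 * i)))) (case_nat (e (2 * 0)) (\<lambda>i. e (Suc (2 * i)))))"
      using dfn_not[OF dfn_iff[OF dfn_drel[OF Suc.prems(1), of "\<lambda>i. 2 * Suc (2 * i)" "case_nat (2 * 0) (\<lambda>i. Suc (2 * i))"]
        dfn_drel[OF Suc.prems(1), of "\<lambda>i. 2 * Suc (Suc (2 * i))" "case_nat (2 * 0) (\<lambda>i. Suc (2 * i))"]]]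
      by (simp only: case_nat_comp)
  qed
  then have uS: "ufin S" by (rule unary)
  show ?case unfolding ufin_def
  proof (intro allI impI)
    fix Z assume Z: "drel Z"
    \<comment> \<open>Requiring \<open>w 0 = s 0\<close> gives all indices the same first
      coordinate, so that the members counted are the sections at one fixed point.\<close>
    have "drel (\<lambda>s w. Z (\<lambda>i. s (Suc i)) (\<lambda>i. w (Suc i)) \<and> w 0 = s 0)"
      unfolding drel_def by (intro dfn_intros dfn_drel[OF Z])
    from ufinD[OF uR' this] obtain N1 where N1: "\<And>s. s \<in> Env \<Longrightarrow>
      finite (slice R' ` slice (\<lambda>s w. Z (\<lambda>i. s (Suc i)) (\<lambda>i. w (Suc i)) \<and> w 0 = s 0) s) \<Longrightarrow>
      card (slice R' ` slice (\<lambda>s w. Z (\<lambda>i. s (Suc i)) (\<lambda>i. w (Suc i)) \<and> w 0 = s 0) s) \<le> N1" by blast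
    have "drel (\<lambda>t w. Z t (\<lambda>i. w (2 * i)) \<and> Z t (\<lambda>i. w (Suc (2 * i))))"
      unfolding drel_def by (intro dfn_intros dfn_drel[OF Z])
    from ufinD[OF uS this] obtain N2 where N2: "\<And>t. t \<in> Env \<Longrightarrow>
      finite (S ` slice (\<lambda>t w. Z t (\<lambda>i. w (2 * i)) \<and> Z t (\<lambda>i. w (Suc (2 * i)))) t) \<Longrightarrow>
      card (S ` slice (\<lambda>t w. Z t (\<lambda>i. w (2 * i)) \<and> Z t (\<lambda>i. w (Suc (2 * i)))) t) \<le> N2" by blast
    have "card (slice R ` slice Z t) \<le> (max 1 N1) ^ N2"
      if t: "t \<in> Env" and fin: "finite (slice R ` slice Z t)" for t
    proof -
      define F where "F = slice R ` slice Z t"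
      define sec where "sec a A = {m \<in> Env. case_nat a m \<in> A}" for a and A :: "(nat \<Rightarrow> 'a) set"
      define D where "D A B = {a \<in> carr M. sec a A \<noteq> sec a B}" for A B
      have sec_R: "slice R' (case_nat a x) = sec a (slice R x)" if "a \<in> carr M" "x \<in> Env" for a x
        using that by (auto simp: slice_def R'_def sec_def)
      have secs: "slice R' ` slice (\<lambda>s w. Z (\<lambda>i. s (Suc i)) (\<lambda>i. w (Suc i)) \<and> w 0 = s 0) (case_nat a t) = sec a ` F"
        if a: "a \<in> carr M" for a
      proof -
        have "slice (\<lambda>s w. Z (\<lambda>i. s (Suc i)) (\<lambda>i. w (Suc i)) \<and> w 0 = s 0) (case_nat a t) = case_nat a ` slice Z t"
        proof (intro Set.set_eqI iffI)
          fix w assume w: "w \<in> slice (\<lambda>s w. Z (\<lambda>i. s (Suc i)) (\<lambda>i. w (Suc i)) \<and> w 0 = s 0) (case_nat a t)"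
          then have "w = case_nat a (\<lambda>i. w (Suc i))" using case_nat_eta[of w] by (simp add: slice_def)
          then show "w \<in> case_nat a ` slice Z t" using w by (intro image_eqI) (auto simp: slice_def)
        qed (use a in \<open>auto simp: slice_def\<close>)
        then show ?thesis unfolding F_def image_image
          by (simp only: image_image) (auto intro!: image_cong sec_R[OF a] simp: slice_def[of Z])
      qed
      have card_sec: "card (sec a ` F) \<le> max 1 N1" if "a \<in> carr M" for a
        using N1[of "case_nat a t"] that t fin unfolding secs[OF that] by (simp add: F_def)
      have SD: "S w = D (slice R (\<lambda>i. w (2 * i))) (slice R (\<lambda>i. w (Suc (2 * i))))" if "w \<in> Env" for w
        using that by (auto simp: S_def D_def sec_def slice_def)
      define J where "J = (\<lambda>(A, B). D A B) ` (F \<times> F)"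
      have J: "S ` slice (\<lambda>t w. Z t (\<lambda>i. w (2 * i)) \<and> Z t (\<lambda>i. w (Suc (2 * i)))) t = J"
      proof (intro Set.set_eqI iffI)
        fix j assume "j \<in> J"
        then obtain x y where xy: "x \<in> slice Z t" "y \<in> slice Z t" "j = D (slice R x) (slice R y)"
          by (auto simp: J_def F_def)
        define w where "w i = (if even i then x (i div 2) else y (i div 2))" for i
        have "w \<in> Env" using xy by (auto simp: Env_def w_def slice_def)
        then show "j \<in> S ` slice (\<lambda>t w. Z t (\<lambda>i. w (2 * i)) \<and> Z t (\<lambda>i. w (Suc (2 * i)))) t"
          using xy SD[of w] by (intro image_eqI[of _ _ w]) (auto simp: slice_def w_def)
      next
        fix j assume "j \<in> S ` slice (\<lambda>t w. Z t (\<lambda>i. w (2 * i)) \<and> Z t (\<lambda>i. w (Suc (2 * i)))) t"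
        then obtain w where w: "w \<in> Env" "Z t (\<lambda>i. w (2 * i))" "Z t (\<lambda>i. w (Suc (2 * i)))" "j = S w"
          by (auto simp: slice_def[of "\<lambda>t w. _ t w \<and> _ t w"])
        then have "(\<lambda>i. w (2 * i)) \<in> slice Z t" "(\<lambda>i. w (Suc (2 * i)))  \<in> slice Z t"
          by (auto simp: slice_def Env_def)
        then show "j \<in> J" unfolding J_def F_def w(4) SD[OF w(1)] by blast
      qed
      have finJ: "finite J" using fin by (simp add: J_def F_def)
      have "card J \<le> N2" using N2[OF t] finJ unfolding J by simp
      \<comment> \<open>The empty set of separating points is discarded: it has no point to pick,
        and it arises only from equal members.\<close>
      then have J': "card (J - {{}}) \<le> N2" using finJ by (meson Diff_subset card_mono le_trans)
      define pt where "pt j = (SOME a. a \<in> j)" for j :: "'a set"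
      have pt: "pt j \<in> j" "pt j \<in> carr M" if "j \<in> J - {{}}" for j
      proof -
        show "pt j \<in> j" using that unfolding pt_def by (metis DiffD2 insertI1 some_in_eq)
        then show "pt j \<in> carr M" using that by (auto simp: J_def D_def)
      qed
      have "card (id ` F) \<le> (max 1 N1) ^ card (J - {{}})"
      proof (rule card_le_product[where \<phi> = "\<lambda>j. sec (pt j)"])
        fix A B assume A: "A \<in> F" and B: "B \<in> F"
          and eq: "\<And>j. j \<in> J - {{}} \<Longrightarrow> sec (pt j) A = sec (pt j) B"
        have "D A B \<in> J" using A B by (auto simp: J_def)
        then have D: "D A B = {}" using eq[of "D A B"] pt[of "D A B"] by (auto simp: D_def)
        have "e \<in> A \<longleftrightarrow> e \<in> B" if e: "e \<in> Env" for e
        proof -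
          have "sec (e 0) A = sec (e 0) B" using D e by (auto simp: D_def EnvD)
          then have "(\<lambda>i. e (Suc i)) \<in> sec (e 0) A \<longleftrightarrow> (\<lambda>i. e (Suc i)) \<in> sec (e 0) B" by simp
          then show ?thesis using e by (simp add: sec_def case_nat_eta)
        qed
        moreover have "A \<subseteq> Env" "B \<subseteq> Env" using A B by (auto simp: F_def slice_def)
        ultimately show "id A = id B" by auto
      qed (use finJ card_sec pt fin in \<open>auto simp: F_def\<close>)
      also have "\<dots> \<le> (max 1 N1) ^ N2" using J' by (intro power_increasing) auto
      finally show ?thesis by (simp add: F_def)
    qed
    then show "\<exists>N. \<forall>t\<in>Env. finite (slice R ` slice Z t) \<longrightarrow> card (slice R ` slice Z t) \<le> N" by blast
  qed
qed

lemma ufin_slice: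
  assumes "\<And>S. dfam S \<Longrightarrow> ufin S" and "drel R"
  shows "ufin (slice R)"
proof -
  obtain k where k: "\<And>e e'. e \<in> Env \<Longrightarrow> e' \<in> Env \<Longrightarrow> (\<And>i. i < k \<Longrightarrow> e i = e' i) \<Longrightarrow>
      R (\<lambda>i. e (2 * i)) (\<lambda>i. e (Suc (2 * i))) \<longleftrightarrow> R (\<lambda>i. e' (2 * i)) (\<lambda>i. e' (Suc (2 * i)))"
    using dfn_finite_support[OF assms(2)[unfolded drel_def]] by blast
  have "R x m \<longleftrightarrow> R x m'" if "x \<in> Env" "m \<in> Env" "m' \<in> Env" "\<And>i. i < k \<Longrightarrow> m i = m' i" for x m m'
    using k[of "\<lambda>i. if even i then x (i div 2) else m (i div 2)" "\<lambda>i. if even i then x (i div 2) else m' (i div 2)"]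
      that by (auto simp: Env_def)
  then show ?thesis using ufin_slice_if_unary[OF assms] by blast
qed

text \<open>Both directions of the equivalence are used. Since \<open>S x\<close> determines
  \<open>T j x\<close>, finitely many members of \<open>S\<close> leave finitely many of each
  \<open>T j\<close>; since the \<open>T j x\<close> together determine \<open>S x\<close>, the
  bounds for the \<open>T j\<close> multiply to one for \<open>S\<close>.\<close>

lemma ufin_determined:
  assumes "finite J" "\<And>j. j \<in> J \<Longrightarrow> ufin (T j)"
    and det: "\<And>x y. x \<in> Env \<Longrightarrow> y \<in> Env \<Longrightarrow> S x = S y \<longleftrightarrow> (\<forall>j\<in>J. T j x = T j y)"
  shows "ufin S"
  unfolding ufin_def
proof (intro allI impI)
  fix Z assume Z: "drel Z"
  have "\<forall>j\<in>J. \<exists>N. \<forall>t\<in>Env. finite (T j ` slice Z t) \<longrightarrow> card (T j ` slice Z t) \<le> N"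
    using assms(2) Z unfolding ufin_def by blast
  then obtain N where N: "\<And>j t. j \<in> J \<Longrightarrow> t \<in> Env \<Longrightarrow> finite (T j ` slice Z t) \<Longrightarrow> card (T j ` slice Z t) \<le> N j"
    by metis
  have "card (S ` slice Z t) \<le> Max (insert 0 (N ` J)) ^ card J" if t: "t \<in> Env" "finite (S ` slice Z t)" for t
  proof (rule card_le_product[OF assms(1)])
    fix j assume j: "j \<in> J"
    define w where "w A = T j (SOME x. x \<in> slice Z t \<and> S x = A)" for A
    have "T j x = w (S x)" if "x \<in> slice Z t" for x
    proof -
      have "(SOME y. y \<in> slice Z t \<and> S y = S x) \<in> slice Z t \<and> S (SOME y. y \<in> slice Z t \<and> S y = S x) = S x"
        using that by (intro someI[of "\<lambda>y. y \<in> slice Z t \<and> S y = S x"]) auto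
      then show ?thesis unfolding w_def using det[of x "SOME y. y \<in> slice Z t \<and> S y = S x"] j that
        by (auto simp: slice_def)
    qed
    then have "T j ` slice Z t = w ` S ` slice Z t" by (auto simp: image_image)
    then show fin: "finite (T j ` slice Z t)" using t by simp
    have "N j \<le> Max (insert 0 (N ` J))" using assms(1) j by (intro Max_ge) auto
    then show "card (T j ` slice Z t) \<le> Max (insert 0 (N ` J))" using N[OF j t(1) fin] by linarith
  qed (use det in \<open>auto simp: slice_def\<close>)
  then show "\<exists>N. \<forall>t\<in>Env. finite (S ` slice Z t) \<longrightarrow> card (S ` slice Z t) \<le> N" by blast
qed

end

section \<open>Weak o-minimality and saturation\<close>

locale wom_structure = fo_structure M for M :: "('f, 'r, 'a) struct" +
  fixes l :: 'r
  assumes saturated: "aleph0_saturated M" and wom: "weakly_o_minimal M l"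
begin

definition lt :: "'a \<Rightarrow> 'a \<Rightarrow> bool" (infix "\<prec>" 50) where
  "x \<prec> y \<longleftrightarrow> (x, y) \<in> less_rel M l"

abbreviation le :: "'a \<Rightarrow> 'a \<Rightarrow> bool" (infix "\<preceq>" 50) where
  "x \<preceq> y \<equiv> x \<prec> y \<or> x = y"

lemma order_facts: "trans (less_rel M l)" "irrefl (less_rel M l)" "total_on (carr M) (less_rel M l)"
    "length (rel_args M l) = 2"
  using wom by (auto simp: weakly_o_minimal_def linearly_ordered_def strict_linear_order_on_def)

lemma lt_irrefl [simp]: "\<not> x \<prec> x"
  using order_facts(2) by (auto simp: lt_def irrefl_def)

lemma lt_trans [trans]: "x \<prec> y \<Longrightarrow> y \<prec> w \<Longrightarrow> x \<prec> w"
  using order_facts(1) by (auto simp: lt_def elim: transE)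

lemma lt_asym: "x \<prec> y \<Longrightarrow> \<not> y \<prec> x"
  using lt_trans lt_irrefl by blast

lemma lt_linear: "x \<in> carr M \<Longrightarrow> y \<in> carr M \<Longrightarrow> x \<prec> y \<or> x = y \<or> y \<prec> x"
  using order_facts(3) by (auto simp: lt_def total_on_def)

lemma lt_carr: "x \<prec> y \<Longrightarrow> x \<in> carr M" "x \<prec> y \<Longrightarrow> y \<in> carr M"
  by (auto simp: lt_def less_rel_def)

lemma dfn_lt [dfn_intros]:
  assumes "dfn_tm g" "dfn_tm h"
  shows "dfn (\<lambda>e. g e \<prec> h e)"
proof -
  have "dfn_tm f" if "f \<in> set [g, h]" for f using that assms by auto
  from dfn_rel[of "[g, h]" l, OF this] have "dfn (\<lambda>e. rel_int M l [g e, h e])" using order_facts(4) by simp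
  then show ?thesis
    by (rule dfn_cong[rotated]) (auto simp: lt_def less_rel_def dfn_tm_closed assms)
qed

section \<open>Saturation for finite tuples\<close>

lemma saturatedD:
  assumes "ps \<in> cart_pow M k" "\<And>\<phi>. \<phi> \<in> \<Phi> \<Longrightarrow> wf_fm M (replicate (Suc k) ()) \<phi>"
    and "\<And>\<Phi>0. finite \<Phi>0 \<Longrightarrow> \<Phi>0 \<subseteq> \<Phi> \<Longrightarrow> \<exists>a\<in>carr M. \<forall>\<phi>\<in>\<Phi>0. sat M (a # ps) \<phi>"
  shows "\<exists>a\<in>carr M. \<forall>\<phi>\<in>\<Phi>. sat M (a # ps) \<phi>"
proof -
  have "(\<forall>\<phi>\<in>\<Phi>. wf_fm M (replicate (Suc k) ()) \<phi>) \<and>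
      (\<forall>\<Phi>0. finite \<Phi>0 \<and> \<Phi>0 \<subseteq> \<Phi> \<longrightarrow> (\<exists>a\<in>carr M. \<forall>\<phi>\<in>\<Phi>0. sat M (a # ps) \<phi>)) \<longrightarrow>
      (\<exists>a\<in>carr M. \<forall>\<phi>\<in>\<Phi>. sat M (a # ps) \<phi>)"
    using saturated assms(1) unfolding aleph0_saturated_def by (elim allE ballE) auto
  then show ?thesis using assms(2,3) by simp
qed

text \<open>Saturation realises types in one variable, so the tuple is found entry by entry. The
  invariant is that for each \<open>k\<close> the entries chosen so far extend to a realisation of
  \<open>P k\<close>. As the \<open>P k\<close> decrease, finitely many conditions on the next entry
  follow from a single one.\<close>

lemma saturated_tuple:
  assumes dfn: "\<And>k. dfn (P k)"
    and supp: "\<And>k e e'. e \<in> Env \<Longrightarrow> e' \<in> Env \<Longrightarrow> (\<And>i. i < n \<Longrightarrow> e i = e' i) \<Longrightarrow> P k e \<longleftrightarrow> P k e'"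
    and decr: "\<And>k e. e \<in> Env \<Longrightarrow> P (Suc k) e \<Longrightarrow> P k e"
    and ex: "\<And>k. \<exists>e\<in>Env. P k e"
  shows "\<exists>e\<in>Env. \<forall>k. P k e"
proof -
  have mono: "P k e" if "P m e" "k \<le> m" "e \<in> Env" for k m :: nat and e
    using that(2,1)
  proof (induction rule: dec_induct)
    case (step m)
    then show ?case using decr[OF that(3)] by blast
  qed
  have "\<exists>a\<in>Env. \<forall>k. \<exists>e\<in>Env. (\<forall>i<j. e i = a i) \<and> P k e" for j
  proof (induction j)
    case 0
    then show ?case using ex Env_nonempty by auto
  next
    case (Suc j)
    then obtain a where a: "a \<in> Env" "\<And>k. \<exists>e\<in>Env. (\<forall>i<j. e i = a i) \<and> P k e" by blast
    \<comment> \<open>Entry 0 of \<open>w\<close> is the candidate for entry \<open>j\<close>; the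
      entries chosen before follow it.\<close>
    define Q where "Q k w \<longleftrightarrow> (\<exists>e\<in>Env. (\<forall>i<j. e i = w (Suc i)) \<and> e j = w 0 \<and> P k e)" for k w
    have dQ: "dfn (Q k)" for k
      unfolding Q_def by (intro dfn_intros dfn_all_less dfn_reindex[OF dfn])
    have "\<exists>\<phi>. wf_fm M (replicate (Suc j) ()) \<phi> \<and> (\<forall>w\<in>Env. Q k w \<longleftrightarrow> sat M (map w [0..<Suc j]) \<phi>)" for k
      by (rule dfn_support[OF dQ]) (auto simp: Q_def)
    then obtain \<phi> where \<phi>: "\<And>k. wf_fm M (replicate (Suc j) ()) (\<phi> k)"
      "\<And>k w. w \<in> Env \<Longrightarrow> Q k w \<longleftrightarrow> sat M (map w [0..<Suc j]) (\<phi> k)" by metis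
    have \<phi>': "sat M (v # map a [0..<j]) (\<phi> k) \<longleftrightarrow> Q k (case_nat v a)" if "v \<in> carr M" for v k
      using \<phi>(2)[of "case_nat v a" k] that a(1) by (simp add: map_upt_Suc del: upt_Suc)
    have "\<exists>v\<in>carr M. \<forall>\<psi>\<in>range \<phi>. sat M (v # map a [0..<j]) \<psi>"
    proof (rule saturatedD[where k = j])
      show "map a [0..<j] \<in> cart_pow M j"
        using map_Env[OF a(1), of "[0..<j]"] by (simp add: cart_pow_def)
      fix \<psi> assume "\<psi> \<in> range \<phi>"
      then show "wf_fm M (replicate (Suc j) ()) \<psi>" using \<phi>(1) by blast
    next
      fix \<Phi> assume "finite \<Phi>" "\<Phi> \<subseteq> range \<phi>"
      then obtain I where I: "finite I" "\<Phi> = \<phi> ` I" using finite_subset_image by metis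
      then obtain m where m: "\<forall>i\<in>I. i \<le> m" using finite_nat_set_iff_bounded_le by auto
      obtain e where e: "e \<in> Env" "\<forall>i<j. e i = a i" "P m e" using a(2) by blast
      have "Q i (case_nat (e j) a)" if "i \<in> I" for i
        unfolding Q_def using e mono[of m e i] m that by (intro bexI[of _ e]) auto
      then show "\<exists>v\<in>carr M. \<forall>\<psi>\<in>\<Phi>. sat M (v # map a [0..<j]) \<psi>"
        using \<phi>' e(1) I(2) by (intro bexI[of _ "e j"]) (auto simp: EnvD)
    qed
    then obtain v where v: "v \<in> carr M" "\<And>k. Q k (case_nat v a)" using \<phi>' by blast
    show ?case
    proof (rule bexI[of _ "a(j := v)"], rule allI)
      show "a(j := v) \<in> Env" using a(1) v(1) by (auto simp: Env_def)
    next
      fix k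
      obtain e where "e \<in> Env" "\<forall>i<j. e i = a i" "e j = v" "P k e" using v(2)[of k] by (auto simp: Q_def)
      then show "\<exists>e\<in>Env. (\<forall>i<Suc j. e i = (a(j := v)) i) \<and> P k e"
        by (intro bexI[of _ e]) (auto simp: less_Suc_eq)
    qed
  qed
  then obtain a where a: "a \<in> Env" "\<And>k. \<exists>e\<in>Env. (\<forall>i<n. e i = a i) \<and> P k e" by blast
  have "P k a" for k
  proof -
    obtain e where e: "e \<in> Env" "\<forall>i<n. e i = a i" "P k e" using a(2) by blast
    then show ?thesis using supp[OF e(1) a(1), of k] by simp
  qed
  then show ?thesis using a(1) by blast
qed

section \<open>Alternations and convex components\<close>

text \<open>
  \<open>alt X k s c\<close>: there are \<open>k\<close> points \<open>\<ge> c\<close>, in increasing order and alternately inside and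
  outside \<open>X\<close>, the first one inside if \<open>s\<close> and outside otherwise.
\<close>

primrec alt :: "'a set \<Rightarrow> nat \<Rightarrow> bool \<Rightarrow> 'a \<Rightarrow> bool" where
  "alt X 0 s c \<longleftrightarrow> True"
| "alt X (Suc k) s c \<longleftrightarrow> (\<exists>a\<in>carr M. c \<preceq> a \<and> (a \<in> X \<longleftrightarrow> s) \<and> alt X k (\<not> s) a)"

lemma alt_downward: "alt X k s c \<Longrightarrow> c' \<preceq> c \<Longrightarrow> alt X k s c'"
  by (cases k) (auto dest: lt_trans)

lemma alt_tail: "alt X (Suc k) s c \<Longrightarrow> alt X k (\<not> s) c"
  using alt_downward by auto

lemma alt_SucD: "alt X (Suc k) s c \<Longrightarrow> alt X k s c"
proof (induction k arbitrary: s c)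
  case (Suc k)
  then obtain a where "a \<in> carr M" "c \<preceq> a" "a \<in> X \<longleftrightarrow> s" "alt X (Suc k) (\<not> s) a" by auto
  then show ?case using Suc.IH[of "\<not> s" a] by auto
qed simp

lemma dfam_alt: "dfam S \<Longrightarrow> dfam (\<lambda>x. {c \<in> carr M. alt (S x) k s c})"
proof (induction k arbitrary: s)
  case 0
  show ?case unfolding alt.simps by (rule dfamI) (intro dfn_intros)
next
  case (Suc k)
  have "dfn (\<lambda>e. e 0 \<in> {c \<in> carr M. alt (S (\<lambda>i. e (Suc (Suc i)))) k (\<not> s) c})"
    by (rule dfn_mem[OF Suc.IH[OF Suc.prems]]) (rule dfn_intros)
  then have "dfn (\<lambda>e. alt (S (\<lambda>i. e (Suc (Suc i)))) k (\<not> s) (e 0))"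
    by (rule dfn_cong[rotated]) (simp add: EnvD)
  then show ?case unfolding alt.simps
    by (intro dfamI dfn_intros dfn_mem[OF Suc.prems])
qed

text \<open>Once an alternation has left \<open>X\<close>, the convex set that contained its
  previous point is used up, since it cannot contain anything beyond the gap. Two points of the
  alternation thus cost at least one of the sets, whence the factor 2.\<close>

lemma alt_bounded_convex:
  assumes "finite \<C>" "\<And>C. C \<in> \<C> \<Longrightarrow> order_convex M l C" "X = \<Union> \<C>"
  shows "alt X k True c \<Longrightarrow> k \<le> 2 * card {C \<in> \<C>. \<exists>y\<in>C. c \<preceq> y}"
proof (induction k arbitrary: c rule: induct_nat_012)
  case 0
  then show ?case by simp
next
  case 1
  then obtain a C where "c \<preceq> a" "a \<in> C" "C \<in> \<C>" using assms(3) by auto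
  then have "{C \<in> \<C>. \<exists>y\<in>C. c \<preceq> y} \<noteq> {}" by blast
  then have "card {C \<in> \<C>. \<exists>y\<in>C. c \<preceq> y} \<noteq> 0" using assms(1) by simp
  then show ?case by linarith
next
  case (ge2 k)
  from ge2.prems obtain a b where a: "c \<preceq> a" "a \<in> X" and b: "a \<preceq> b" "b \<notin> X" "alt X k True b" by auto
  obtain C where C: "C \<in> \<C>" "a \<in> C" using a(2) assms(3) by auto
  have bC: "b \<notin> C" using b(2) C assms(3) by blast
  have "\<not> b \<preceq> y" if y: "y \<in> C" for y
  proof
    assume "b \<preceq> y"
    then have "b \<prec> y" "a \<prec> b" using bC y b(1) C(2) by auto
    then show False using assms(2)[OF C(1)] C(2) y bC lt_carr(2)[of a b]
      unfolding order_convex_def lt_def by blast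
  qed
  then have "C \<notin> {C \<in> \<C>. \<exists>y\<in>C. b \<preceq> y}" by blast
  moreover have "{C \<in> \<C>. \<exists>y\<in>C. b \<preceq> y} \<subseteq> {C \<in> \<C>. \<exists>y\<in>C. c \<preceq> y}"
  proof clarify
    fix D y assume "y \<in> D" "b \<preceq> y"
    then have "c \<preceq> y" using a(1) b(1) lt_trans by blast
    then show "\<exists>y\<in>D. c \<preceq> y" using \<open>y \<in> D\<close> by blast
  qed
  moreover have "C \<in> {C \<in> \<C>. \<exists>y\<in>C. c \<preceq> y}" using C a(1) by blast
  ultimately have "{C \<in> \<C>. \<exists>y\<in>C. b \<preceq> y} \<subset> {C \<in> \<C>. \<exists>y\<in>C. c \<preceq> y}" by blast
  then have "card {C \<in> \<C>. \<exists>y\<in>C. b \<preceq> y} < card {C \<in> \<C>. \<exists>y\<in>C. c \<preceq> y}"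
    using assms(1) by (intro psubset_card_mono) auto
  then show ?case using ge2.IH(1)[OF b(3)] by linarith
qed

lemma dfam_definable:
  assumes "dfam S" "x \<in> Env"
  shows "definable M [()] {[a] | a. a \<in> S x}"
proof -
  obtain n \<phi> where \<phi>: "wf_fm M (replicate (Suc n) ()) \<phi>"
    "\<forall>e\<in>Env. e 0 \<in> S (\<lambda>i. e (Suc i)) \<longleftrightarrow> sat M (map e [0..<Suc n]) \<phi>"
    using dfn_mono[of "\<lambda>e. e 0 \<in> S (\<lambda>i. e (Suc i))"] assms(1) unfolding dfam_def
    by (meson le_SucI order_refl)
  have "a \<in> S x \<longleftrightarrow> sat M (a # map x [0..<n]) \<phi>" if "a \<in> carr M" for a
    using bspec[OF \<phi>(2), of "case_nat a x"] that assms(2)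
    by (simp add: map_upt_Suc del: upt_Suc)
  then have "a \<in> S x \<longleftrightarrow> a \<in> carr M \<and> sat M (a # map x [0..<n]) \<phi>" for a
    using dfam_subset[OF assms] by blast
  then have "{[a] | a. a \<in> S x} = {xs \<in> tuples M [()]. sat M (xs @ map x [0..<n]) \<phi>}"
    by (auto simp: tuples_def list_all2_Cons2)
  then show ?thesis unfolding definable_def definable_over_def
    using \<phi>(1) map_Env[OF assms(2), of "[0..<n]"]
    by (intro conjI exI[of _ "replicate n ()"] exI[of _ "map x [0..<n]"] exI[of _ \<phi>]) auto
qed

lemma alt_bounded_single:
  assumes "dfam S" "x \<in> Env"
  shows "\<exists>K. \<forall>k c. alt (S x) k True c \<longrightarrow> k \<le> K"
proof -
  have "\<exists>\<C>. finite \<C> \<and> (\<forall>C\<in>\<C>. order_convex M l C) \<and> S x = \<Union> \<C>"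
    using conjunct2[OF wom[unfolded weakly_o_minimal_def], rule_format, OF dfam_definable[OF assms]] .
  then obtain \<C> where \<C>: "finite \<C>" "\<And>C. C \<in> \<C> \<Longrightarrow> order_convex M l C" "S x = \<Union> \<C>"
    by blast
  have "k \<le> 2 * card \<C>" if "alt (S x) k True c" for k c
  proof -
    have "card {C \<in> \<C>. \<exists>y\<in>C. c \<preceq> y} \<le> card \<C>" using \<C>(1) by (intro card_mono) auto
    then show ?thesis using alt_bounded_convex[OF \<C> that] by linarith
  qed
  then show ?thesis by blast
qed

text \<open>Weak o-minimality bounds the alternations of one member at a time. If these bounds were
  not uniform, saturation would provide a single member with alternations of every length.\<close>

lemma alt_bounded:
  assumes "dfam S"
  obtains K where "\<And>x c k s. x \<in> Env \<Longrightarrow> c \<in> carr M \<Longrightarrow> alt (S x) k s c \<Longrightarrow> k \<le> K"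
proof -
  define P where "P k x \<longleftrightarrow> (\<exists>c\<in>carr M. alt (S x) k True c)" for k x
  have "\<exists>k. \<forall>x\<in>Env. \<not> P k x"
  proof (rule ccontr)
    assume "\<not> ?thesis"
    then have ex: "\<exists>x\<in>Env. P k x" for k by blast
    obtain n where "\<And>x y. x \<in> Env \<Longrightarrow> y \<in> Env \<Longrightarrow> (\<And>i. i < n \<Longrightarrow> x i = y i) \<Longrightarrow> S x = S y"
      using dfam_finite_support[OF assms] by blast
    then have supp: "P k e \<longleftrightarrow> P k e'" if "e \<in> Env" "e' \<in> Env" "\<And>i. i < n \<Longrightarrow> e i = e' i" for k e e'
      unfolding P_def using that by metis
    have "dfn (\<lambda>e. e 0 \<in> {c \<in> carr M. alt (S (\<lambda>i. e (Suc i))) k True c})" for k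
      by (rule dfn_mem[OF dfam_alt[OF assms]]) (rule dfn_intros)
    then have "dfn (\<lambda>e. alt (S (\<lambda>i. e (Suc i))) k True (e 0))" for k
      by (rule dfn_cong[rotated]) (simp add: EnvD)
    then have "dfn (P k)" for k unfolding P_def by (rule dfn_ex)
    moreover have "P k e" if "P (Suc k) e" for k e
      using that alt_SucD unfolding P_def by blast
    ultimately obtain x where x: "x \<in> Env" "\<And>k. P k x"
      using saturated_tuple[of P n] supp ex by blast
    obtain K where "\<And>k c. alt (S x) k True c \<Longrightarrow> k \<le> K" using alt_bounded_single[OF assms x(1)] by blast
    then show False using x(2)[of "Suc K"] unfolding P_def by (meson Suc_n_not_le_n)
  qed
  then obtain K where K: "\<And>x. x \<in> Env \<Longrightarrow> \<not> P K x" by blast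
  have alt_le: "alt X k s c" if "alt X m s c" "k \<le> m" for X k m s c
    using that(2,1)
  proof (induction rule: dec_induct)
    case (step m)
    then show ?case using alt_SucD[of X m s c] by blast
  qed
  \<comment> \<open>The strict inequality leaves room for the shift by one below: shortening an
    alternation that starts outside by its first point gives one that starts inside.\<close>
  have T: "k < K" if "x \<in> Env" "c \<in> carr M" "alt (S x) k True c" for x c k
    using K[OF that(1)] alt_le[OF that(3), of K] that(2) by (auto simp: P_def not_le[symmetric])
  have "k \<le> K" if "x \<in> Env" "c \<in> carr M" "alt (S x) k s c" for x c k s
  proof (cases "s \<or> k = 0")
    case True
    then show ?thesis using T that by (cases s) (auto intro: less_imp_le)
  next
    case False
    then obtain k' where k': "k = Suc k'" "\<not> s" by (cases k) auto
    then have "alt (S x) k' True c" using alt_tail[of "S x" k' s c] that(3) by auto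
    then show ?thesis using T[OF that(1,2)] k' by (simp add: Suc_le_eq)
  qed
  then show ?thesis by (rule that)
qed

text \<open>
  The alternations recover \<open>X\<close>: from a point of \<open>X\<close> one can extend every alternation starting
  outside \<open>X\<close>, and conversely.
\<close>

lemma mem_iff_alt:
  assumes "c \<in> carr M" and K: "\<And>k s. alt X k s c \<Longrightarrow> k \<le> K"
  shows "c \<in> X \<longleftrightarrow> (\<exists>k\<le>K. alt X k True c \<and> \<not> alt X k False c)"
proof
  assume c: "c \<in> X"
  \<comment> \<open>The longest alternation above \<open>c\<close> that starts outside
    \<open>X\<close> has \<open>k - 1\<close> points; putting \<open>c\<close> in front of it gives
    one with \<open>k\<close> points that starts inside.\<close>
  define k where "k = (LEAST k. \<not> alt X k False c)"
  have ex: "\<not> alt X (Suc K) False c" using K by fastforce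
  then have k: "\<not> alt X k False c" unfolding k_def by (rule LeastI)
  then obtain k' where k': "k = Suc k'" by (cases k) auto
  have "alt X k' False c" using not_less_Least[of k' "\<lambda>k. \<not> alt X k False c"] k' by (auto simp: k_def)
  then have "alt X k True c" using c assms(1) k' by auto
  then show "\<exists>k\<le>K. alt X k True c \<and> \<not> alt X k False c" using k K by blast
next
  assume "\<exists>k\<le>K. alt X k True c \<and> \<not> alt X k False c"
  then obtain k where k: "alt X k True c" "\<not> alt X k False c" by blast
  show "c \<in> X"
  proof (rule ccontr)
    assume "c \<notin> X"
    then have "alt X (Suc k) False c" using k(1) assms(1) by auto
    then show False using k(2) alt_SucD by blast
  qed
qed

text \<open>The cuts are the sets of starting points of alternations of prescribed length and
  prescribed first side: an alternation above \<open>c\<close> is also one above every smaller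
  point. The uniform bound \<open>K\<close> leaves finitely many such sets for each member.\<close>

lemma ufin_if_downsets:
  assumes "\<And>T. dfam T \<Longrightarrow> (\<And>x a b. x \<in> Env \<Longrightarrow> b \<in> T x \<Longrightarrow> a \<prec> b \<Longrightarrow> a \<in> T x) \<Longrightarrow> ufin T"
    and S: "dfam S"
  shows "ufin S"
proof -
  obtain K where K: "\<And>x c k s. x \<in> Env \<Longrightarrow> c \<in> carr M \<Longrightarrow> alt (S x) k s c \<Longrightarrow> k \<le> K"
    using alt_bounded[OF S] by blast
  define T where "T j x = {c \<in> carr M. alt (S x) (snd j) (fst j) c}" for j x
  show ?thesis
  proof (rule ufin_determined[of "UNIV \<times> {..K}"])
    fix j
    show "ufin (T j)"
    proof (rule assms(1))
      show "dfam (T j)" unfolding T_def by (rule dfam_alt[OF S])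
    qed (use alt_downward lt_carr in \<open>auto simp: T_def\<close>)
  next
    fix x y assume x: "x \<in> Env" and y: "y \<in> Env"
    show "S x = S y \<longleftrightarrow> (\<forall>j\<in>UNIV \<times> {..K}. T j x = T j y)"
    proof
      assume T: "\<forall>j\<in>UNIV \<times> {..K}. T j x = T j y"
      have "c \<in> S x \<longleftrightarrow> c \<in> S y" if c: "c \<in> carr M" for c
      proof -
        have "alt (S x) k s c \<longleftrightarrow> alt (S y) k s c" if "k \<le> K" for k s
          using T[rule_format, of "(s, k)"] that c by (auto simp: T_def)
        then show ?thesis
          using mem_iff_alt[OF c, of "S x" K] mem_iff_alt[OF c, of "S y" K] K[OF x c] K[OF y c] by blast
      qed
      then show "S x = S y" using dfam_subset[OF S] x y by blast
    qed (simp add: T_def)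
  qed simp
qed

end

section \<open>Cuts in definable ordered groups\<close>

text \<open>The carrier is only a definable subset of \<open>M\<close>, because the positive
  elements of a field under multiplication are one of the two instances.\<close>

locale definable_ordered_group = wom_structure M l + group G
  for M :: "('f, 'r, 'a) struct" and l :: 'r and G :: "('a, 'b) monoid_scheme" (structure) +
  fixes f :: 'f
  assumes dfam_G: "dfam (\<lambda>_. carrier G)"
    and args_f: "length (fun_args M f) = 2"
    and mult_f: "\<And>x y. x \<otimes> y = fun_int M f [x, y]"
    and mult_left_mono: "\<And>x y w. x \<in> carrier G \<Longrightarrow> y \<in> carrier G \<Longrightarrow> w \<in> carrier G \<Longrightarrow>
      x \<prec> y \<Longrightarrow> w \<otimes> x \<prec> w \<otimes> y"
    and mult_right_mono: "\<And>x y w. x \<in> carrier G \<Longrightarrow> y \<in> carrier G \<Longrightarrow> w \<in> carrier G \<Longrightarrow>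
      x \<prec> y \<Longrightarrow> x \<otimes> w \<prec> y \<otimes> w"
begin

lemma G_carr: "x \<in> carrier G \<Longrightarrow> x \<in> carr M"
  using dfam_subset[OF dfam_G] Env_nonempty by blast

lemma G_linear: "x \<in> carrier G \<Longrightarrow> y \<in> carrier G \<Longrightarrow> x \<prec> y \<or> x = y \<or> y \<prec> x"
  using lt_linear G_carr by blast

lemma dfn_tm_mult [dfn_intros]:
  assumes "dfn_tm g" "dfn_tm h"
  shows "dfn_tm (\<lambda>e. g e \<otimes> h e)"
proof -
  have "dfn_tm k" if "k \<in> set [g, h]" for k using that assms by auto
  from dfn_tm_app[of "[g, h]" f, OF this] show ?thesis using args_f by (simp add: mult_f)
qed

lemma dfn_mem_G [dfn_intros]: "dfn_tm g \<Longrightarrow> dfn (\<lambda>e. g e \<in> carrier G)"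
  by (rule dfn_mem[OF dfam_G])

lemma dfn_ex_G [dfn_intros]:
  assumes "dfn (\<lambda>e. Q (\<lambda>i. e (Suc i)) (e 0))"
  shows "dfn (\<lambda>e. \<exists>a\<in>carrier G. Q e a)"
proof -
  have "dfn (\<lambda>e. \<exists>a\<in>carr M. a \<in> carrier G \<and> Q e a)" by (intro dfn_intros assms)
  then show ?thesis by (rule dfn_cong[rotated]) (use G_carr in blast)
qed

lemma dfn_all_G [dfn_intros]:
  assumes "dfn (\<lambda>e. Q (\<lambda>i. e (Suc i)) (e 0))"
  shows "dfn (\<lambda>e. \<forall>a\<in>carrier G. Q e a)"
  using dfn_not[OF dfn_ex_G[OF dfn_not[OF assms]]] by simp

lemma mult_pos: "x \<in> carrier G \<Longrightarrow> w \<in> carrier G \<Longrightarrow> \<one> \<prec> x \<Longrightarrow> w \<prec> w \<otimes> x"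
  using mult_left_mono[of \<one> x w] by simp

section \<open>Convexity of definable subgroups and its consequences\<close>

text \<open>A subgroup containing \<open>g\<close> but not some \<open>b\<close> with \<open>1 < b < g\<close> would alternate forever:
  \<open>c < c b < c g < c g b < \<dots>\<close>.\<close>

lemma definable_subgroup_convex:
  assumes S: "dfam S" "x \<in> Env" "subgroup (S x) G"
    and g: "g \<in> S x" "b \<in> carrier G" "\<one> \<prec> b" "b \<prec> g"
  shows "b \<in> S x"
proof (rule ccontr)
  assume b: "b \<notin> S x"
  interpret H: subgroup "S x" G by fact
  have alt: "alt (S x) k True c \<and> alt (S x) k False c" if "c \<in> S x" for c k
    using that
  proof (induction k arbitrary: c)
    case (Suc k)
    have c: "c \<in> carrier G" using Suc.prems H.subset by blast
    have cb: "c \<otimes> b \<notin> S x"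
    proof
      assume "c \<otimes> b \<in> S x"
      then have "inv c \<otimes> (c \<otimes> b) \<in> S x" using Suc.prems by blast
      then show False using b c g(2) by (simp add: m_assoc[symmetric])
    qed
    have "c \<prec> c \<otimes> b" using mult_pos[OF g(2) c g(3)] .
    moreover have "c \<otimes> b \<prec> c \<otimes> g" using g c by (intro mult_left_mono) (auto intro: H.subset[THEN subsetD])
    moreover have "alt (S x) k True (c \<otimes> g)" using Suc.IH[of "c \<otimes> g"] Suc.prems g(1) by blast
    ultimately have "alt (S x) (Suc k) False c"
      using cb alt_downward[of "S x" k True "c \<otimes> g" "c \<otimes> b"] G_carr[of "c \<otimes> b"] c g(2) by auto
    moreover have "alt (S x) (Suc k) True c" using Suc.IH[OF Suc.prems] Suc.prems G_carr[OF c] by auto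
    ultimately show ?case by blast
  qed simp
  obtain K where K: "\<And>x c k s. x \<in> Env \<Longrightarrow> c \<in> carr M \<Longrightarrow> alt (S x) k s c \<Longrightarrow> k \<le> K"
    using alt_bounded[OF S(1)] by blast
  have "alt (S x) (Suc K) True \<one>" using alt[OF H.one_closed] by blast
  from K[OF S(2) G_carr[OF one_closed] this] show False by simp
qed

text \<open>The centralizer of \<open>a\<close> is a definable subgroup that contains
  \<open>a\<close>, so by convexity it contains every \<open>b\<close> between \<open>\<one>\<close>
  and \<open>a\<close>.\<close>

lemma commute_pos:
  assumes "a \<in> carrier G" "b \<in> carrier G" "\<one> \<prec> b" "b \<prec> a"
  shows "b \<otimes> a = a \<otimes> b"
proof -
  define S where "S x = {y \<in> carr M. y \<in> carrier G \<and> y \<otimes> x 0 = x 0 \<otimes> y}" for x :: "nat \<Rightarrow> 'a"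
  have "dfam S" unfolding S_def by (rule dfamI) (intro dfn_intros)
  moreover have "(\<lambda>_. a) \<in> Env" using G_carr[OF assms(1)] by auto
  moreover have "subgroup (S (\<lambda>_. a)) G"
  proof (rule subgroupI)
    show "S (\<lambda>_. a) \<noteq> {}" using assms(1) G_carr by (auto simp: S_def intro: exI[of _ a])
  next
    fix y assume "y \<in> S (\<lambda>_. a)"
    then have y: "y \<in> carrier G" "y \<otimes> a = a \<otimes> y" by (auto simp: S_def)
    have "inv y \<otimes> a = inv y \<otimes> (a \<otimes> y) \<otimes> inv y" using y assms(1) by (simp add: m_assoc)
    also have "\<dots> = a \<otimes> inv y" using y(1) assms(1) unfolding y(2)[symmetric] by (simp add: m_assoc[symmetric])
    finally show "inv y \<in> S (\<lambda>_. a)" using y(1) G_carr by (auto simp: S_def)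
  next
    fix y w assume "y \<in> S (\<lambda>_. a)" "w \<in> S (\<lambda>_. a)"
    then have yw: "y \<in> carrier G" "y \<otimes> a = a \<otimes> y" "w \<in> carrier G" "w \<otimes> a = a \<otimes> w" by (auto simp: S_def)
    have "y \<otimes> w \<otimes> a = y \<otimes> a \<otimes> w" using yw(1,3,4) assms(1) by (simp add: m_assoc)
    also have "\<dots> = a \<otimes> y \<otimes> w" by (simp only: yw(2))
    also have "\<dots> = a \<otimes> (y \<otimes> w)" using yw assms(1) by (simp add: m_assoc)
    finally show "y \<otimes> w \<in> S (\<lambda>_. a)" using yw G_carr by (auto simp: S_def)
  qed (auto simp: S_def)
  moreover have "a \<in> S (\<lambda>_. a)" using assms(1) G_carr by (auto simp: S_def)
  ultimately have "b \<in> S (\<lambda>_. a)" using definable_subgroup_convex[of S "\<lambda>_. a" a b] assms by blast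
  then show ?thesis by (simp add: S_def)
qed

lemma inv_pos: "a \<in> carrier G \<Longrightarrow> a \<prec> \<one> \<Longrightarrow> \<one> \<prec> inv a"
  using mult_left_mono[of a \<one> "inv a"] by simp

lemma commute_inv:
  assumes "a \<in> carrier G" "b \<in> carrier G" "inv a \<otimes> b = b \<otimes> inv a"
  shows "a \<otimes> b = b \<otimes> a"
proof -
  have "a \<otimes> b = a \<otimes> (b \<otimes> inv a) \<otimes> a" using assms(1,2) by (simp add: m_assoc)
  also have "\<dots> = b \<otimes> a" using assms(1,2) unfolding assms(3)[symmetric] by (simp add: m_assoc[symmetric])
  finally show ?thesis .
qed

lemma commute:
  assumes a: "a \<in> carrier G" and b: "b \<in> carrier G"
  shows "a \<otimes> b = b \<otimes> a"
proof -
  have pos: "c \<otimes> d = d \<otimes> c" if "c \<in> carrier G" "d \<in> carrier G" "\<one> \<prec> c" "\<one> \<prec> d" for c d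
    using that commute_pos[of c d] commute_pos[of d c] G_linear[of c d] by auto
  have semi: "c \<otimes> d = d \<otimes> c" if cd: "c \<in> carrier G" "d \<in> carrier G" "\<one> \<prec> c" for c d
  proof -
    consider "\<one> \<prec> d" | "d = \<one>" | "d \<prec> \<one>" using G_linear[of \<one> d] cd by auto
    then show ?thesis
    proof cases
      case 3
      then have "inv d \<otimes> c = c \<otimes> inv d" using pos[of c "inv d"] cd inv_pos by auto
      then show ?thesis using commute_inv[of d c] cd by auto
    qed (use pos cd in auto)
  qed
  consider "\<one> \<prec> a" | "a = \<one>" | "a \<prec> \<one>" using G_linear[of \<one> a] a by auto
  then show ?thesis
  proof cases
    case 3
    then show ?thesis using commute_inv[OF a b] semi[of "inv a" b] a b inv_pos by auto
  qed (use semi a b in auto)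
qed

text \<open>By commutativity the squares form a subgroup, and it is definable. It contains
  \<open>a \<otimes> a\<close>, which lies above \<open>a\<close>, so convexity puts
  \<open>a\<close> into it.\<close>

lemma square_root:
  assumes "a \<in> carrier G" "\<one> \<prec> a"
  obtains u where "u \<in> carrier G" "\<one> \<prec> u" "u \<otimes> u = a"
proof -
  define S where "S x = {y \<in> carr M. \<exists>u\<in>carrier G. y = u \<otimes> u}" for x :: "nat \<Rightarrow> 'a"
  obtain x where x: "x \<in> Env" using Env_nonempty by blast
  have "dfam S" unfolding S_def by (rule dfamI) (intro dfn_intros)
  moreover have "subgroup (S x) G"
  proof (rule subgroupI)
    have "\<one> \<in> S x" using G_carr[OF one_closed] by (auto simp: S_def intro!: bexI[of _ \<one>])
    then show "S x \<noteq> {}" by blast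
  next
    fix y assume "y \<in> S x"
    then obtain u where u: "u \<in> carrier G" "y = u \<otimes> u" by (auto simp: S_def)
    then have "inv y = inv u \<otimes> inv u" by (simp add: inv_mult_group)
    then show "inv y \<in> S x" using u G_carr by (auto simp: S_def)
  next
    fix y w assume "y \<in> S x" "w \<in> S x"
    then obtain u v where u: "u \<in> carrier G" "y = u \<otimes> u" "v \<in> carrier G" "w = v \<otimes> v" by (auto simp: S_def)
    have "y \<otimes> w = u \<otimes> (u \<otimes> v) \<otimes> v" using u by (simp add: m_assoc)
    also have "\<dots> = u \<otimes> (v \<otimes> u) \<otimes> v" using commute[OF u(1,3)] by simp
    also have "\<dots> = (u \<otimes> v) \<otimes> (u \<otimes> v)" using u by (simp add: m_assoc)
    finally show "y \<otimes> w \<in> S x" using u G_carr by (auto simp: S_def)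
  qed (auto simp: S_def)
  moreover have "a \<otimes> a \<in> S x" using assms(1) G_carr by (auto simp: S_def)
  moreover have "a \<prec> a \<otimes> a" using mult_pos[of a a] assms by simp
  ultimately have "a \<in> S x" using definable_subgroup_convex[of S x "a \<otimes> a" a] assms x by blast
  then obtain u where u: "u \<in> carrier G" "u \<otimes> u = a" by (auto simp: S_def)
  have "\<one> \<prec> u"
  proof (rule ccontr)
    assume "\<not> \<one> \<prec> u"
    then have "u = \<one> \<or> u \<prec> \<one>" using G_linear[of \<one> u] u(1) by auto
    then have "a = \<one> \<or> a \<prec> \<one>" using u mult_left_mono[of u \<one> u] lt_trans[of "u \<otimes> u" u \<one>] by auto
    then show False using assms(2) lt_asym by auto
  qed
  then show ?thesis using that u by blast
qed

section \<open>Cuts, their stabilizers and translations\<close>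

definition downset :: "'a set \<Rightarrow> bool" where
  "downset C \<longleftrightarrow> C \<subseteq> carrier G \<and> (\<forall>b\<in>C. \<forall>a\<in>carrier G. a \<prec> b \<longrightarrow> a \<in> C)"

text \<open>The equivalence, rather than one implication, makes this a subgroup: for a downset
  \<open>C\<close>, membership of \<open>y\<close> implies that of \<open>y \<otimes> g\<close> for
  every \<open>g\<close> below \<open>\<one>\<close>.\<close>

definition stab :: "'a set \<Rightarrow> 'a set" where
  "stab C = {g \<in> carrier G. \<forall>y\<in>carrier G. y \<in> C \<longleftrightarrow> y \<otimes> g \<in> C}"

text \<open>\<open>C\<close> has a largest coset of its stabilizer.\<close>

definition has_top :: "'a set \<Rightarrow> bool" where
  "has_top C \<longleftrightarrow> (\<exists>a\<in>C. \<forall>b\<in>C. \<exists>h\<in>stab C. b \<preceq> a \<otimes> h)"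

lemma downset_linear: "downset C \<Longrightarrow> downset D \<Longrightarrow> C \<subseteq> D \<or> D \<subseteq> C"
  unfolding downset_def using G_linear by (metis subset_eq)

lemma downset_above: "downset C \<Longrightarrow> c \<in> C \<Longrightarrow> a \<in> carrier G \<Longrightarrow> a \<notin> C \<Longrightarrow> c \<prec> a"
  unfolding downset_def using G_linear by blast

lemma one_stab: "C \<subseteq> carrier G \<Longrightarrow> \<one> \<in> stab C"
  by (auto simp: stab_def)

lemma stab_mult: "C \<subseteq> carrier G \<Longrightarrow> g \<in> stab C \<Longrightarrow> y \<in> C \<Longrightarrow> y \<otimes> g \<in> C"
  by (auto simp: stab_def)

lemma stab_less:
  assumes "downset C" "h \<in> stab C" "\<epsilon> \<in> carrier G" "\<one> \<prec> \<epsilon>" "\<epsilon> \<notin> stab C"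
  shows "h \<prec> \<epsilon>"
proof (rule ccontr)
  have h: "h \<in> carrier G" using assms(2) by (simp add: stab_def)
  assume "\<not> h \<prec> \<epsilon>"
  then have le: "\<epsilon> \<preceq> h" using G_linear[OF assms(3) h] by auto
  have "y \<in> C \<longleftrightarrow> y \<otimes> \<epsilon> \<in> C" if y: "y \<in> carrier G" for y
  proof
    assume "y \<in> C"
    then have "y \<otimes> h \<in> C" using assms(1,2) stab_mult downset_def by blast
    moreover have "y \<otimes> \<epsilon> \<preceq> y \<otimes> h" using le mult_left_mono[OF assms(3) h y] by auto
    ultimately show "y \<otimes> \<epsilon> \<in> C" using assms(1,3) y by (auto simp: downset_def)
  next
    assume "y \<otimes> \<epsilon> \<in> C"
    then show "y \<in> C" using assms(1) mult_pos[OF assms(3) y assms(4)] y by (auto simp: downset_def)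
  qed
  then show False using assms(3,5) by (simp add: stab_def)
qed

lemma dfam_stab:
  assumes "dfam S"
  shows "dfam (\<lambda>x. stab (S x))"
proof -
  have "dfam (\<lambda>x. {a \<in> carr M. a \<in> stab (S x)})"
    unfolding stab_def mem_Collect_eq by (intro dfamI dfn_intros dfn_mem[OF assms])
  moreover have "{a \<in> carr M. a \<in> stab C} = stab C" for C using G_carr by (auto simp: stab_def)
  ultimately show ?thesis by simp
qed

lemma stab_subgroup:
  assumes "C \<subseteq> carrier G"
  shows "subgroup (stab C) G"
proof (rule subgroupI)
  show "stab C \<subseteq> carrier G" by (auto simp: stab_def)
  show "stab C \<noteq> {}" using one_stab[OF assms] by blast
next
  fix g assume g: "g \<in> stab C"
  then have gG: "g \<in> carrier G" by (simp add: stab_def)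
  have "y \<in> C \<longleftrightarrow> y \<otimes> inv g \<in> C" if y: "y \<in> carrier G" for y
  proof -
    have "y \<otimes> inv g \<in> carrier G" "y \<otimes> inv g \<otimes> g = y" using gG y by (simp_all add: m_assoc)
    then show ?thesis using g unfolding stab_def by force
  qed
  then show "inv g \<in> stab C" unfolding stab_def using inv_closed[OF gG] by blast
next
  fix g h assume g: "g \<in> stab C" and h: "h \<in> stab C"
  then have G: "g \<in> carrier G" "h \<in> carrier G" by (simp_all add: stab_def)
  have "y \<in> C \<longleftrightarrow> y \<otimes> (g \<otimes> h) \<in> C" if y: "y \<in> carrier G" for y
  proof -
    have "y \<in> C \<longleftrightarrow> y \<otimes> g \<in> C" using g y unfolding stab_def by blast
    also have "\<dots> \<longleftrightarrow> y \<otimes> g \<otimes> h \<in> C" using h m_closed[OF y G(1)] unfolding stab_def by blast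
    also have "y \<otimes> g \<otimes> h = y \<otimes> (g \<otimes> h)" using G y by (simp add: m_assoc)
    finally show ?thesis .
  qed
  then show "g \<otimes> h \<in> stab C" unfolding stab_def using m_closed[OF G] by blast
qed

lemma stab_convex:
  assumes C: "downset C" and "g \<in> stab C" "h \<in> stab C" "w \<in> carrier G" "g \<prec> w" "w \<prec> h"
  shows "w \<in> stab C"
proof -
  have gh: "g \<in> carrier G" "h \<in> carrier G" using assms by (auto simp: stab_def)
  have "y \<in> C \<longleftrightarrow> y \<otimes> w \<in> C" if y: "y \<in> carrier G" for y
  proof
    assume "y \<in> C"
    then have "y \<otimes> h \<in> C" using assms(3) y by (simp add: stab_def)
    then show "y \<otimes> w \<in> C" using C mult_left_mono[OF assms(4) gh(2) y assms(6)] y assms(4) by (auto simp: downset_def)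
  next
    assume "y \<otimes> w \<in> C"
    then have "y \<otimes> g \<in> C" using C mult_left_mono[OF gh(1) assms(4) y assms(5)] y gh by (auto simp: downset_def)
    then show "y \<in> C" using assms(2) y by (simp add: stab_def)
  qed
  then show ?thesis using assms(4) by (simp add: stab_def)
qed

text \<open>Without a largest coset, a point \<open>a\<close> of \<open>D\<close> outside
  \<open>C\<close> is followed in \<open>D\<close> by a point \<open>b\<close> beyond its coset, and
  the distance from \<open>a\<close> to \<open>b\<close> serves as \<open>\<epsilon>\<close>. With
  largest cosets, of \<open>e\<close> in \<open>C\<close> and of \<open>a\<close> in
  \<open>D\<close>, half the distance serves: a point of \<open>C\<close> is at most
  \<open>e \<otimes> h\<close> with \<open>h\<close> in the stabilizer, \<open>h\<close> is less
  than \<open>u\<close>, and \<open>e \<otimes> u \<otimes> u\<close> is \<open>a\<close>.\<close>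

lemma cut_gap:
  assumes C: "downset C" and D: "downset D" and "stab C = stab D" and "has_top C \<longleftrightarrow> has_top D" and "C \<subset> D"
  shows "\<exists>\<epsilon>\<in>carrier G. \<one> \<prec> \<epsilon> \<and> \<epsilon> \<notin> stab C \<and> (\<exists>b\<in>D. \<forall>c\<in>C. c \<otimes> \<epsilon> \<prec> b)"
proof (cases "has_top D")
  case False
  obtain a where a: "a \<in> D" "a \<notin> C" using assms(5) by blast
  have aG: "a \<in> carrier G" using a D by (auto simp: downset_def)
  obtain b where b: "b \<in> D" "\<And>h. h \<in> stab D \<Longrightarrow> \<not> b \<preceq> a \<otimes> h"
    using False a(1) unfolding has_top_def by blast
  have bG: "b \<in> carrier G" using b(1) D by (auto simp: downset_def)
  have ab: "a \<otimes> (inv a \<otimes> b) = b" using aG bG by (simp add: m_assoc[symmetric])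
  have "a \<prec> b" using b(2)[OF one_stab] D aG bG G_linear[OF aG bG] by (auto simp: downset_def)
  then have "\<one> \<prec> inv a \<otimes> b" using mult_left_mono[of a b "inv a"] aG bG by simp
  moreover have "inv a \<otimes> b \<notin> stab C" using b(2)[of "inv a \<otimes> b"] assms(3) ab by auto
  moreover have "c \<otimes> (inv a \<otimes> b) \<prec> b" if "c \<in> C" for c
    using mult_right_mono[of c a "inv a \<otimes> b"] downset_above[OF C that aG a(2)] that C aG bG
    by (auto simp: ab downset_def)
  ultimately show ?thesis using b(1) aG bG by (intro bexI[of _ "inv a \<otimes> b"]) auto
next
  case True
  obtain a where a: "a \<in> D" "\<And>b. b \<in> D \<Longrightarrow> \<exists>h\<in>stab D. b \<preceq> a \<otimes> h"
    using True unfolding has_top_def by blast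
  obtain e where e: "e \<in> C" "\<And>b. b \<in> C \<Longrightarrow> \<exists>h\<in>stab C. b \<preceq> e \<otimes> h"
    using True assms(4) unfolding has_top_def by blast
  have aG: "a \<in> carrier G" and eG: "e \<in> carrier G" using a e C D by (auto simp: downset_def)
  have CG: "C \<subseteq> carrier G" using C by (simp add: downset_def)
  have aC: "a \<notin> C"
  proof
    assume "a \<in> C"
    have "b \<in> C" if bD: "b \<in> D" for b
    proof -
      obtain h where h: "h \<in> stab D" "b \<preceq> a \<otimes> h" using a(2)[OF bD] by blast
      then have "a \<otimes> h \<in> C" using \<open>a \<in> C\<close> stab_mult[OF CG] assms(3) by simp
      then show ?thesis using h(2) C D bD by (auto simp: downset_def)
    qed
    then show False using assms(5) by blast
  qed
  define d where "d = inv e \<otimes> a"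
  have dG: "d \<in> carrier G" and ed: "e \<otimes> d = a" using aG eG by (auto simp: d_def m_assoc[symmetric])
  have "\<one> \<prec> d" using mult_left_mono[of e a "inv e"] downset_above[OF C e(1) aG aC] aG eG by (simp add: d_def)
  \<comment> \<open>The whole distance \<open>d\<close> would be too large, because it carries the
    largest coset of \<open>C\<close> onto that of \<open>D\<close>.\<close>
  then obtain u where u: "u \<in> carrier G" "\<one> \<prec> u" "u \<otimes> u = d" using square_root[OF dG] by blast
  have uC: "u \<notin> stab C"
  proof
    assume "u \<in> stab C"
    then have "e \<otimes> u \<otimes> u \<in> C" using e(1) stab_mult[OF CG] by simp
    then show False using aC ed eG u by (simp add: m_assoc)
  qed
  have "c \<otimes> u \<prec> a" if cC: "c \<in> C" for c
  proof -
    obtain h where h: "h \<in> stab C" "c \<preceq> e \<otimes> h" using e(2)[OF cC] by blast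
    have hG: "h \<in> carrier G" and cG: "c \<in> carrier G" using h cC CG by (auto simp: stab_def)
    have "c \<otimes> u \<preceq> e \<otimes> h \<otimes> u" using h(2) mult_right_mono[of c "e \<otimes> h" u] cG eG hG u(1) by auto
    moreover have "e \<otimes> h \<otimes> u \<prec> e \<otimes> u \<otimes> u"
      using stab_less[OF C h(1) u(1,2) uC] eG hG u(1) by (intro mult_right_mono mult_left_mono) auto
    moreover have "e \<otimes> u \<otimes> u = a" using ed u eG by (simp add: m_assoc)
    ultimately show ?thesis using lt_trans by auto
  qed
  then show ?thesis using u uC a(1) by blast
qed

text \<open>A smaller \<open>\<epsilon>\<close> serves a pair as well as a larger one, so the least
  of finitely many serves all pairs.\<close>

lemma common_gap:
  assumes "finite P" "P \<noteq> {}"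
    and "\<And>C D. (C, D) \<in> P \<Longrightarrow> C \<subseteq> carrier G \<and> D \<subseteq> carrier G \<and>
      (\<exists>\<epsilon>\<in>carrier G. \<one> \<prec> \<epsilon> \<and> \<epsilon> \<notin> H \<and> (\<exists>b\<in>D. \<forall>c\<in>C. c \<otimes> \<epsilon> \<prec> b))"
  shows "\<exists>\<epsilon>\<in>carrier G. \<one> \<prec> \<epsilon> \<and> \<epsilon> \<notin> H \<and> (\<forall>(C, D)\<in>P. \<exists>b\<in>D. \<forall>c\<in>C. c \<otimes> \<epsilon> \<prec> b)"
  using assms
proof (induction P rule: finite_ne_induct)
  case (singleton p)
  then show ?case by (cases p) auto
next
  case (insert p P)
  obtain C D where p: "p = (C, D)" by (cases p)
  from insert.IH insert.prems obtain \<epsilon> where \<epsilon>: "\<epsilon> \<in> carrier G" "\<one> \<prec> \<epsilon>" "\<epsilon> \<notin> H"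
    "\<And>C D. (C, D) \<in> P \<Longrightarrow> \<exists>b\<in>D. \<forall>c\<in>C. c \<otimes> \<epsilon> \<prec> b" by fastforce
  obtain \<delta> where \<delta>: "\<delta> \<in> carrier G" "\<one> \<prec> \<delta>" "\<delta> \<notin> H" "\<exists>b\<in>D. \<forall>c\<in>C. c \<otimes> \<delta> \<prec> b"
    using insert.prems[of C D] p by auto
  have shrink: "\<exists>b\<in>D'. \<forall>c\<in>C'. c \<otimes> \<zeta> \<prec> b"
    if D': "\<exists>b\<in>D'. \<forall>c\<in>C'. c \<otimes> \<eta> \<prec> b" and "\<zeta> \<preceq> \<eta>" "C' \<subseteq> carrier G" "\<zeta> \<in> carrier G" "\<eta> \<in> carrier G" for \<zeta> \<eta> C' D'
  proof -
    obtain b where b: "b \<in> D'" "\<And>c. c \<in> C' \<Longrightarrow> c \<otimes> \<eta> \<prec> b" using D' by blast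
    have "c \<otimes> \<zeta> \<prec> b" if "c \<in> C'" for c
      using mult_left_mono[of \<zeta> \<eta> c] b(2)[OF that] lt_trans[of "c \<otimes> \<zeta>" "c \<otimes> \<eta>" b]
        \<open>\<zeta> \<preceq> \<eta>\<close> \<open>C' \<subseteq> carrier G\<close> \<open>\<zeta> \<in> carrier G\<close> \<open>\<eta> \<in> carrier G\<close> that by auto
    then show ?thesis using b(1) by blast
  qed
  consider "\<epsilon> \<preceq> \<delta>" | "\<delta> \<preceq> \<epsilon>" using G_linear[of \<epsilon> \<delta>] \<epsilon>(1) \<delta>(1) by blast
  then show ?case
  proof cases
    case 1
    have "\<exists>b\<in>D. \<forall>c\<in>C. c \<otimes> \<epsilon> \<prec> b" using shrink[OF \<delta>(4) 1] insert.prems[of C D] p \<epsilon>(1) \<delta>(1) by auto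
    then show ?thesis using \<epsilon> p by (intro bexI[of _ \<epsilon>]) auto
  next
    case 2
    have "\<exists>b\<in>D'. \<forall>c\<in>C'. c \<otimes> \<delta> \<prec> b" if "(C', D') \<in> P" for C' D'
      using shrink[OF \<epsilon>(4)[OF that] 2] insert.prems[of C' D'] that \<epsilon>(1) \<delta>(1) by auto
    then show ?thesis using \<delta> p by (intro bexI[of _ \<delta>]) auto
  qed
qed

text \<open>
  Every \<open>C\<close> in a finite set \<open>\<T>\<close> of cuts with the same stabilizer contributes a component
  \<open>C \<epsilon> \<setminus> C\<close> to the set \<open>U\<close> below, as soon as \<open>\<epsilon>\<close> is small enough.
\<close>

lemma alt_cuts:
  assumes fin: "finite \<T>" and cuts: "\<And>C. C \<in> \<T> \<Longrightarrow> downset C \<and> stab C = H \<and> (has_top C \<longleftrightarrow> s)"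
    and card: "card \<T> \<ge> 2"
  shows "\<exists>\<epsilon>\<in>carrier G. \<exists>u\<in>carrier G. alt {y \<in> carrier G. \<exists>C\<in>\<T>. y \<notin> C \<and> (\<exists>c\<in>C. y = c \<otimes> \<epsilon>)} (card \<T>) True u"
proof -
  define P where "P = {(C, D). C \<in> \<T> \<and> D \<in> \<T> \<and> C \<subset> D}"
  have finP: "finite P" using finite_subset[of P "\<T> \<times> \<T>"] fin by (auto simp: P_def)
  \<comment> \<open>Two cuts are needed: a single cut may be stabilized by the whole group, and then
    there is no \<open>\<epsilon>\<close> outside \<open>H\<close>.\<close>
  have neP: "P \<noteq> {}"
  proof -
    obtain C D where "C \<in> \<T>" "D \<in> \<T>" "C \<noteq> D" using card by (auto simp: numeral_2_eq_2 card_le_Suc_iff)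
    then have "(C, D) \<in> P \<or> (D, C) \<in> P" using downset_linear[of C D] cuts by (auto simp: P_def)
    then show ?thesis by blast
  qed
  have "\<exists>\<epsilon>\<in>carrier G. \<one> \<prec> \<epsilon> \<and> \<epsilon> \<notin> H \<and> (\<forall>(C, D)\<in>P. \<exists>b\<in>D. \<forall>c\<in>C. c \<otimes> \<epsilon> \<prec> b)"
  proof (rule common_gap[OF finP neP])
    fix C D assume CD: "(C, D) \<in> P"
    then show "C \<subseteq> carrier G \<and> D \<subseteq> carrier G \<and>
      (\<exists>\<epsilon>\<in>carrier G. \<one> \<prec> \<epsilon> \<and> \<epsilon> \<notin> H \<and> (\<exists>b\<in>D. \<forall>c\<in>C. c \<otimes> \<epsilon> \<prec> b))"
      using cut_gap[of C D] cuts[of C] cuts[of D] by (auto simp: P_def downset_def)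
  qed
  then obtain \<epsilon> where \<epsilon>: "\<epsilon> \<in> carrier G" "\<one> \<prec> \<epsilon>" "\<epsilon> \<notin> H"
    "\<forall>(C, D)\<in>P. \<exists>b\<in>D. \<forall>c\<in>C. c \<otimes> \<epsilon> \<prec> b" by blast
  define U where "U = {y \<in> carrier G. \<exists>C\<in>\<T>. y \<notin> C \<and> (\<exists>c\<in>C. y = c \<otimes> \<epsilon>)}"
  have witness: "\<exists>c\<in>C. c \<otimes> \<epsilon> \<notin> C" if CT: "C \<in> \<T>" for C
  proof -
    have C: "downset C" "stab C = H" using cuts CT by auto
    obtain y where y: "y \<in> carrier G" "(y \<in> C) \<noteq> (y \<otimes> \<epsilon> \<in> C)" using \<epsilon>(1,3) C(2) by (auto simp: stab_def)
    have "y \<in> C" if "y \<otimes> \<epsilon> \<in> C" using C(1) that y(1) mult_pos[OF \<epsilon>(1) y(1) \<epsilon>(2)] by (auto simp: downset_def)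
    then show ?thesis using y by blast
  qed
  \<comment> \<open>Induction on the number of cuts beyond \<open>C\<close>. The alternation goes
    from a point \<open>c \<otimes> \<epsilon>\<close> outside \<open>C\<close> to a point
    \<open>b\<close> of the next cut \<open>D\<close> above all translates of points of
    \<open>C\<close>, and on to a point \<open>d \<otimes> \<epsilon>\<close> outside
    \<open>D\<close>.\<close>
  have main: "alt U (Suc n) True (c \<otimes> \<epsilon>)"
    if "n = card {D \<in> \<T>. C \<subset> D}" "C \<in> \<T>" "c \<in> C" "c \<otimes> \<epsilon> \<notin> C" for n C c
    using that
  proof (induction n arbitrary: C c)
    case 0
    have cG: "c \<otimes> \<epsilon> \<in> carrier G" using 0 cuts[of C] \<epsilon>(1) by (auto simp: downset_def)
    then have "c \<otimes> \<epsilon> \<in> U" using 0 by (auto simp: U_def)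
    then show ?case using G_carr[OF cG] by auto
  next
    case (Suc n)
    have C: "downset C" using cuts Suc.prems(2) by blast
    have cG: "c \<otimes> \<epsilon> \<in> carrier G" using Suc.prems C \<epsilon>(1) by (auto simp: downset_def)
    have cU: "c \<otimes> \<epsilon> \<in> U" using Suc.prems cG by (auto simp: U_def)
    have "{D \<in> \<T>. C \<subset> D} \<noteq> {}" using Suc.prems(1) by (metis card.empty nat.distinct(1))
    then have "\<exists>D\<in>{D \<in> \<T>. C \<subset> D}. \<forall>B\<in>{D \<in> \<T>. C \<subset> D}. B \<subseteq> D \<longrightarrow> D = B"
      using fin by (intro finite_has_minimal) auto
    then obtain D where D: "D \<in> \<T>" "C \<subset> D" "\<And>B. B \<in> \<T> \<Longrightarrow> C \<subset> B \<Longrightarrow> B \<subseteq> D \<Longrightarrow> D = B"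
      by blast
    have D_down: "downset D" using cuts D(1) by blast
    have D_min: "D \<subseteq> B" if "B \<in> \<T>" "C \<subset> B" for B
      using D(3)[OF that] downset_linear[of B D] cuts that(1) D_down by blast
    obtain b where b: "b \<in> D" "\<And>c. c \<in> C \<Longrightarrow> c \<otimes> \<epsilon> \<prec> b"
    proof -
      have "(C, D) \<in> P" using D(1,2) Suc.prems(2) by (simp add: P_def)
      then have "\<exists>b\<in>D. \<forall>c\<in>C. c \<otimes> \<epsilon> \<prec> b" using \<epsilon>(4) by blast
      then show ?thesis using that by blast
    qed
    \<comment> \<open>A cut inside \<open>C\<close> is not moved as far as \<open>b\<close>, and a
      cut beyond \<open>C\<close> contains \<open>D\<close> and with it \<open>b\<close>; so
      \<open>b\<close> lies in none of the differences.\<close>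
    have bU: "b \<notin> U"
    proof
      assume "b \<in> U"
      then obtain B c' where B: "B \<in> \<T>" "b \<notin> B" "c' \<in> B" "b = c' \<otimes> \<epsilon>" by (auto simp: U_def)
      have "\<not> B \<subseteq> C" using b(2)[of c'] B by auto
      then have "C \<subset> B" using downset_linear[of B C] cuts[OF B(1)] C by blast
      then show False using D_min[OF B(1)] b(1) B(2) by blast
    qed
    obtain d where d: "d \<in> D" "d \<otimes> \<epsilon> \<notin> D" using witness[OF D(1)] by blast
    have dG: "d \<otimes> \<epsilon> \<in> carrier G" using d D_down \<epsilon>(1) by (auto simp: downset_def)
    have "{B \<in> \<T>. C \<subset> B} = insert D {B \<in> \<T>. D \<subset> B}" using D(1,2) D_min by blast
    then have "card {B \<in> \<T>. C \<subset> B} = Suc (card {B \<in> \<T>. D \<subset> B})" using fin by simp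
    then have "alt U (Suc n) True (d \<otimes> \<epsilon>)" using Suc.IH[OF _ D(1) d] Suc.prems(1) by simp
    then have "alt U (Suc n) True b" using downset_above[OF D_down b(1) dG d(2)] alt_downward by blast
    moreover have "c \<otimes> \<epsilon> \<prec> b" using b(2) Suc.prems(3) by blast
    ultimately have "alt U (Suc (Suc n)) False (c \<otimes> \<epsilon>)" using bU lt_carr[of "c \<otimes> \<epsilon>" b] by (subst alt.simps) auto
    \<comment> \<open>Each further cut yields two more points of the alternation, of which only one
      is claimed, so the last point is dropped.\<close>
    then have "alt U (Suc n) False (c \<otimes> \<epsilon>)" by (rule alt_SucD)
    then show ?case using cU G_carr[OF cG] by (subst alt.simps) auto
  qed
  obtain C where C: "C \<in> \<T>" "\<And>B. B \<in> \<T> \<Longrightarrow> B \<subseteq> C \<Longrightarrow> C = B"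
  proof -
    have "\<T> \<noteq> {}" using card by auto
    then have "\<exists>C\<in>\<T>. \<forall>B\<in>\<T>. B \<subseteq> C \<longrightarrow> C = B" using finite_has_minimal[OF fin] by blast
    then show ?thesis using that by blast
  qed
  have "C \<subseteq> B" if "B \<in> \<T>" for B
    using C(2)[OF that] downset_linear[of B C] cuts that C(1) by blast
  then have "\<T> = insert C {D \<in> \<T>. C \<subset> D}" using C(1) by blast
  then have "card \<T> = card (insert C {D \<in> \<T>. C \<subset> D})" by (rule arg_cong)
  then have cardT: "card \<T> = Suc (card {D \<in> \<T>. C \<subset> D})" using fin by simp
  obtain c where c: "c \<in> C" "c \<otimes> \<epsilon> \<notin> C" using witness[OF C(1)] by blast
  have "alt U (card \<T>) True (c \<otimes> \<epsilon>)" unfolding cardT by (rule main[OF refl C(1) c])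
  moreover have "c \<otimes> \<epsilon> \<in> carrier G" using c(1) cuts[OF C(1)] \<epsilon>(1) by (auto simp: downset_def)
  ultimately show ?thesis using \<epsilon>(1) unfolding U_def by blast
qed

text \<open>The cuts fall into classes by stabilizer and existence of a largest coset. A class has
  at most \<open>max 1 K\<close> members, the 1 accounting for a class with a single cut. The bound
  on stabilizers is demanded only where the cuts are finite in number, which is the form in which
  the field case supplies it.\<close>

lemma ufin_downsets:
  assumes S: "dfam S" and down: "\<And>x. x \<in> Env \<Longrightarrow> downset (S x)"
    and stabs: "\<And>Z. drel Z \<Longrightarrow>
      \<exists>N. \<forall>t\<in>Env. finite (S ` slice Z t) \<longrightarrow> card ((\<lambda>x. stab (S x)) ` slice Z t) \<le> N"
  shows "ufin S"
  unfolding ufin_def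
proof (intro allI impI)
  fix Z assume Z: "drel Z"
  note d_stab = dfam_stab[OF S]
  have d_stab_eq: "dfn (\<lambda>e. stab (S (\<lambda>i. e (g i))) = stab (S (\<lambda>i. e (h i))))" for g h
  proof -
    have "dfn (\<lambda>e. \<forall>a\<in>carr M. a \<in> stab (S (\<lambda>i. e (g i))) \<longleftrightarrow> a \<in> stab (S (\<lambda>i. e (h i))))"
      by (intro dfn_intros dfn_mem[OF d_stab])
    then show ?thesis by (rule dfn_cong[rotated]) (use G_carr in \<open>auto simp: stab_def\<close>)
  qed
  have "dfn (\<lambda>e. \<exists>a\<in>carr M. a \<in> S e \<and> (\<forall>b\<in>carr M. b \<in> S e \<longrightarrow> (\<exists>h\<in>carr M. h \<in> stab (S e) \<and> b \<preceq> a \<otimes> h)))"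
    by (intro dfn_intros dfn_mem[OF S] dfn_mem[OF d_stab])
  then have "dfn (\<lambda>e. has_top (S e))"
  proof (rule dfn_cong[rotated])
    fix e assume "e \<in> Env"
    then have sub: "S e \<subseteq> carr M" "stab (S e) \<subseteq> carr M"
      using dfam_subset[OF S] dfam_subset[OF d_stab] by blast+
    show "(\<exists>a\<in>carr M. a \<in> S e \<and> (\<forall>b\<in>carr M. b \<in> S e \<longrightarrow> (\<exists>h\<in>carr M. h \<in> stab (S e) \<and> b \<preceq> a \<otimes> h))) \<longleftrightarrow> has_top (S e)"
      unfolding has_top_def by (meson subsetD[OF sub(1)] subsetD[OF sub(2)])
  qed
  note d_top = dfn_reindex[OF this]
  \<comment> \<open>Entry 0 of \<open>w\<close> is \<open>\<epsilon>\<close>; after it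
    \<open>t\<close> is interleaved with an index that names the class. The bound \<open>K\<close>
    is therefore independent of all three.\<close>
  define U where "U w = {y \<in> carr M. y \<in> carrier G \<and> (\<exists>x\<in>Env. Z (\<lambda>i. w (Suc (2 * i))) x \<and>
      stab (S x) = stab (S (\<lambda>i. w (Suc (Suc (2 * i))))) \<and> (has_top (S x) \<longleftrightarrow> has_top (S (\<lambda>i. w (Suc (Suc (2 * i)))))) \<and>
      y \<notin> S x \<and> (\<exists>c\<in>carr M. c \<in> S x \<and> y = c \<otimes> w 0))}" for w
  have "dfam U" unfolding U_def
    by (intro dfamI dfn_intros dfn_mem[OF S] d_stab_eq d_top dfn_drel[OF Z])
  then obtain K where K: "\<And>x c k s. x \<in> Env \<Longrightarrow> c \<in> carr M \<Longrightarrow> alt (U x) k s c \<Longrightarrow> k \<le> K"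
    using alt_bounded by blast
  obtain N where N: "\<And>t. t \<in> Env \<Longrightarrow> finite (S ` slice Z t) \<Longrightarrow> card ((\<lambda>x. stab (S x)) ` slice Z t) \<le> N"
    using stabs[OF Z] by blast
  have "card (S ` slice Z t) \<le> (N * 2) * max 1 K" if t: "t \<in> Env" and fin: "finite (S ` slice Z t)" for t
  proof (rule card_le_fibres[OF fin])
    have "(\<lambda>C. (stab C, has_top C)) ` S ` slice Z t \<subseteq> (stab ` S ` slice Z t) \<times> UNIV" by auto
    then have "card ((\<lambda>C. (stab C, has_top C)) ` S ` slice Z t) \<le> card ((stab ` S ` slice Z t) \<times> (UNIV :: bool set))"
      using fin by (intro card_mono) auto
    also have "\<dots> \<le> N * 2" using N[OF t fin] by (simp add: card_cartesian_product image_image)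
    finally show "card ((\<lambda>C. (stab C, has_top C)) ` S ` slice Z t) \<le> N * 2" .
  next
    fix A assume "A \<in> S ` slice Z t"
    then obtain x where x: "x \<in> Env" "Z t x" "A = S x" by (auto simp: slice_def)
    define \<T> where "\<T> = {B \<in> S ` slice Z t. (stab B, has_top B) = (stab A, has_top A)}"
    have "card \<T> \<le> max 1 K"
    proof (cases "card \<T> \<ge> 2")
      case True
      have "downset C \<and> stab C = stab A \<and> (has_top C \<longleftrightarrow> has_top A)" if "C \<in> \<T>" for C
        using that down by (auto simp: \<T>_def slice_def)
      moreover have "finite \<T>" using fin by (simp add: \<T>_def)
      ultimately obtain \<epsilon> u where \<epsilon>: "\<epsilon> \<in> carrier G" "u \<in> carrier G"
        "alt {y \<in> carrier G. \<exists>C\<in>\<T>. y \<notin> C \<and> (\<exists>c\<in>C. y = c \<otimes> \<epsilon>)} (card \<T>) True u"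
        using alt_cuts[of \<T> "stab A" "has_top A"] True by blast
      define w where "w = case_nat \<epsilon> (\<lambda>i. if even i then t (i div 2) else x (i div 2))"
      have w: "w \<in> Env" using t x(1) G_carr[OF \<epsilon>(1)] by (auto simp: w_def Env_def split: nat.split)
      have "{y \<in> carrier G. \<exists>C\<in>\<T>. y \<notin> C \<and> (\<exists>c\<in>C. y = c \<otimes> \<epsilon>)} = U w"
        unfolding U_def w_def \<T>_def using x dfam_subset[OF S] G_carr by (auto simp: slice_def)
      then show ?thesis using K[OF w G_carr[OF \<epsilon>(2)]] \<epsilon>(3) by fastforce
    qed auto
    then show "card {B \<in> S ` slice Z t. (stab B, has_top B) = (stab A, has_top A)} \<le> max 1 K"
      by (simp add: \<T>_def)
  qed
  then show "\<exists>N. \<forall>t\<in>Env. finite (S ` slice Z t) \<longrightarrow> card (S ` slice Z t) \<le> N" by blast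
qed

lemma ufin_if_convex_subgroups:
  assumes all: "carrier G = carr M"
    and conv: "\<And>T. dfam T \<Longrightarrow> (\<And>x. x \<in> Env \<Longrightarrow> subgroup (T x) G \<and> order_convex M l (T x)) \<Longrightarrow> ufin T"
    and "dfam S"
  shows "ufin S"
proof (rule ufin_if_downsets[OF _ \<open>dfam S\<close>])
  fix T assume T: "dfam T" and down: "\<And>x a b. x \<in> Env \<Longrightarrow> b \<in> T x \<Longrightarrow> a \<prec> b \<Longrightarrow> a \<in> T x"
  have dT: "downset (T x)" if "x \<in> Env" for x
    using down[OF that] dfam_subset[OF T that] all by (auto simp: downset_def)
  have "ufin (\<lambda>x. stab (T x))"
  proof (rule conv[OF dfam_stab[OF T]], rule conjI)
    fix x assume x: "x \<in> Env"
    show "subgroup (stab (T x)) G" using stab_subgroup dT[OF x] by (simp add: downset_def)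
    show "order_convex M l (stab (T x))"
      unfolding order_convex_def
    proof (intro conjI ballI impI)
      show "stab (T x) \<subseteq> carr M" using all by (auto simp: stab_def)
    next
      fix a b w assume "a \<in> stab (T x)" "b \<in> stab (T x)" "w \<in> carr M" "(a, w) \<in> less_rel M l \<and> (w, b) \<in> less_rel M l"
      then show "w \<in> stab (T x)" using stab_convex[OF dT[OF x], of a b w] all by (simp add: lt_def)
    qed
  qed
  show "ufin T"
  proof (rule ufin_downsets[OF T dT])
    fix Z assume "drel Z"
    then obtain N where N: "\<And>t. t \<in> Env \<Longrightarrow> finite ((\<lambda>x. stab (T x)) ` slice Z t) \<Longrightarrow>
        card ((\<lambda>x. stab (T x)) ` slice Z t) \<le> N"
      using ufinD[OF \<open>ufin (\<lambda>x. stab (T x))\<close>] by blast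
    have "finite ((\<lambda>x. stab (T x)) ` slice Z t)" if "finite (T ` slice Z t)" for t
      using finite_imageI[OF that, of stab] by (simp add: image_image)
    then show "\<exists>N. \<forall>t\<in>Env. finite (T ` slice Z t) \<longrightarrow> card ((\<lambda>x. stab (T x)) ` slice Z t) \<le> N"
      using N by blast
  qed
qed

end

section \<open>Imaginaries\<close>

lemma eq_struct_simps [simp]:
  "s \<in> sorts (eq_struct M) \<longleftrightarrow> s = HomeSort \<or> (\<exists>n E. s = QuotSort n E \<and> zero_definable_equiv M n E)"
  "univ (eq_struct M) HomeSort = Real ` carr M"
  "univ (eq_struct M) (QuotSort n E) = Imag ` (cart_pow M n // E)"
  "fun_args (eq_struct M) (Base g) = replicate (length (fun_args M g)) HomeSort"
  "fun_args (eq_struct M) (Proj n E) = replicate n HomeSort"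
  "fun_res (eq_struct M) (Base g) = HomeSort"
  "fun_res (eq_struct M) (Proj n E) = QuotSort n E"
  "rel_args (eq_struct M) r = replicate (length (rel_args M r)) HomeSort"
  "fun_int (eq_struct M) (Base g) as = Real (fun_int M g (map the_real as))"
  "fun_int (eq_struct M) (Proj n E) as = Imag (E `` {map the_real as})"
  "rel_int (eq_struct M) r as \<longleftrightarrow> rel_int M r (map the_real as)"
  by (auto simp: eq_struct_def)

text \<open>\<open>el s x\<close> is the element of the sort \<open>s\<close> represented by an initial segment of \<open>x\<close>; the
  coordinates of the representatives of the entries of a tuple are addressed by \<open>f\<close>.\<close>

fun el :: "'a eq_sort \<Rightarrow> (nat \<Rightarrow> 'a) \<Rightarrow> 'a eq_elem" where
  "el HomeSort x = Real (x 0)"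
| "el (QuotSort n E) x = Imag (E `` {map x [0..<n]})"

definition dec :: "'a eq_sort list \<Rightarrow> (nat \<Rightarrow> nat \<Rightarrow> nat) \<Rightarrow> (nat \<Rightarrow> 'a) \<Rightarrow> 'a eq_elem list" where
  "dec ss f e = map (\<lambda>i. el (ss ! i) (\<lambda>j. e (f i j))) [0..<length ss]"

lemma length_dec [simp]: "length (dec ss f e) = length ss"
  by (simp add: dec_def)

lemma dec_nth: "i < length ss \<Longrightarrow> dec ss f e ! i = el (ss ! i) (\<lambda>j. e (f i j))"
  by (simp add: dec_def)

lemma dec_append: "dec (ss @ ss') f e = dec ss f e @ dec ss' (\<lambda>i. f (length ss + i)) e"
  by (rule nth_equalityI) (auto simp: dec_nth nth_append)

lemma dec_cong:
  "(\<And>i j. i < length ss \<Longrightarrow> e (f i j) = e' (f' i j)) \<Longrightarrow> dec ss f e = dec ss f' e'"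
  by (rule nth_equalityI) (auto simp: dec_nth)

section \<open>Reading formulas of \<open>M\<^sup>e\<^sup>q\<close> in \<open>M\<close>\<close>

context fo_structure
begin

lemma el_univ: "x \<in> Env \<Longrightarrow> el s x \<in> univ (eq_struct M) s"
  by (cases s) (auto simp: EnvD cart_pow_def tuples_M intro!: imageI quotientI)

lemma univ_el:
  assumes "a \<in> univ (eq_struct M) s"
  shows "\<exists>x\<in>Env. a = el s x"
proof (cases s)
  case HomeSort
  then show ?thesis using assms by (auto intro!: bexI[of _ "\<lambda>_. the_real a"])
next
  case (QuotSort n E)
  then obtain xs where xs: "xs \<in> cart_pow M n" "a = Imag (E `` {xs})"
    using assms by (auto elim!: quotientE)
  then obtain x where "x \<in> Env" "xs = map x [0..<n]" using Env_extend by (auto simp: cart_pow_def)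
  then show ?thesis using xs QuotSort by auto
qed

lemma dec_tuples: "e \<in> Env \<Longrightarrow> dec ss f e \<in> tuples (eq_struct M) ss"
  unfolding tuples_def by (auto simp: list_all2_conv_all_nth dec_nth intro!: el_univ)

lemma tuples_dec:
  assumes "as \<in> tuples (eq_struct M) ss"
  obtains e where "e \<in> Env" "as = dec ss (\<lambda>i j. prod_encode (i, j)) e"
proof -
  have "\<forall>i<length ss. \<exists>x\<in>Env. as ! i = el (ss ! i) x"
    using assms univ_el by (auto simp: tuples_def list_all2_conv_all_nth)
  then obtain x where x: "\<And>i. i < length ss \<Longrightarrow> x i \<in> Env \<and> as ! i = el (ss ! i) (x i)" by metis
  obtain d where d: "d \<in> Env" using Env_nonempty by blast
  \<comment> \<open>The pairing function gives the entries of the tuple disjoint addresses;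
    addresses beyond the tuple receive arbitrary values from \<open>d\<close>.\<close>
  define e where "e k = (case prod_decode k of (i, j) \<Rightarrow> if i < length ss then x i j else d j)" for k :: nat
  have "e \<in> Env" using x d by (auto simp: e_def Env_def split: prod.split)
  moreover have "as = dec ss (\<lambda>i j. prod_encode (i, j)) e"
    using assms x by (intro nth_equalityI) (auto simp: dec_nth e_def tuples_def dest: list_all2_lengthD)
  ultimately show ?thesis by (rule that)
qed

lemma zero_definable_equivD:
  assumes "zero_definable_equiv M n E"
  shows "dfn (\<lambda>e. (map e [0..<n], map (\<lambda>i. e (n + i)) [0..<n]) \<in> E)"
proof -
  obtain ts ps \<phi> where \<phi>: "ps \<in> tuples M ts" "set ps \<subseteq> {}" "wf_fm M (replicate (n + n) () @ ts) \<phi>"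
    "{xs @ ys | xs ys. (xs, ys) \<in> E} = {xs \<in> tuples M (replicate (n + n) ()). sat M (xs @ ps) \<phi>}"
    using assms unfolding zero_definable_equiv_def definable_over_def by blast
  have [simp]: "ps = []" "ts = []" using \<phi>(1,2) by (auto simp: tuples_def)
  have E: "E \<subseteq> cart_pow M n \<times> cart_pow M n"
    using assms by (auto simp: zero_definable_equiv_def equiv_def)
  have "(map e [0..<n], map (\<lambda>i. e (n + i)) [0..<n]) \<in> E \<longleftrightarrow> sat M (map e [0..<n + n]) \<phi>" if "e \<in> Env" for e
  proof -
    have split: "map e [0..<n + n] = map e [0..<n] @ map (\<lambda>i. e (n + i)) [0..<n]"
      by (rule nth_equalityI) (auto simp: nth_append)
    have "(map e [0..<n], map (\<lambda>i. e (n + i)) [0..<n]) \<in> E \<longleftrightarrow> map e [0..<n + n] \<in> {xs @ ys | xs ys. (xs, ys) \<in> E}"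
    proof
      assume "map e [0..<n + n] \<in> {xs @ ys | xs ys. (xs, ys) \<in> E}"
      then obtain xs ys where xy: "map e [0..<n] @ map (\<lambda>i. e (n + i)) [0..<n] = xs @ ys" "(xs, ys) \<in> E"
        unfolding split by blast
      then have "length xs = n" using E by (auto simp: cart_pow_def tuples_M)
      then show "(map e [0..<n], map (\<lambda>i. e (n + i)) [0..<n]) \<in> E" using xy by simp
    qed (auto simp: split)
    also have "\<dots> \<longleftrightarrow> sat M (map e [0..<n + n]) \<phi>"
      unfolding \<phi>(4) using map_Env[OF that, of "[0..<n + n]"] by simp
    finally show ?thesis .
  qed
  then show ?thesis unfolding dfn_def using \<phi>(3)
    by (intro exI[of _ "n + n"] exI[of _ \<phi>]) auto
qed

text \<open>Two classes in a quotient sort are equal if their representatives are related by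
  \<open>E\<close>, and \<open>E\<close> is definable in \<open>M\<close> without
  parameters.\<close>

lemma dfn_el_eq:
  assumes "s \<in> sorts (eq_struct M)" "\<And>j. dfn_tm (g j)" "\<And>j. dfn_tm (h j)"
  shows "dfn (\<lambda>e. el s (\<lambda>j. g j e) = el s (\<lambda>j. h j e))"
proof (cases s)
  case HomeSort
  then show ?thesis using assms by (auto intro: dfn_intros)
next
  case (QuotSort n E)
  then have E: "zero_definable_equiv M n E" using assms(1) by auto
  have eqv: "equiv (cart_pow M n) E" using E by (simp add: zero_definable_equiv_def)
  have "dfn_tm (if i < n then g i else h (i - n))" for i using assms(2,3) by auto
  from dfn_subst[OF zero_definable_equivD[OF E], of "\<lambda>i. if i < n then g i else h (i - n)", OF this]
  have d: "dfn (\<lambda>e. (map (\<lambda>i. (if i < n then g i else h (i - n)) e) [0..<n], map (\<lambda>i. h i e) [0..<n]) \<in> E)"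
    by simp
  have "map (\<lambda>i. (if i < n then g i else h (i - n)) e) [0..<n] = map (\<lambda>i. g i e) [0..<n]" for e by simp
  with d have "dfn (\<lambda>e. (map (\<lambda>i. g i e) [0..<n], map (\<lambda>i. h i e) [0..<n]) \<in> E)" by simp
  then show ?thesis
  proof (rule dfn_cong[rotated])
    fix e assume "e \<in> Env"
    then have "map (\<lambda>i. g i e) [0..<n] \<in> cart_pow M n" "map (\<lambda>i. h i e) [0..<n] \<in> cart_pow M n"
      using dfn_tm_closed[OF assms(2)] dfn_tm_closed[OF assms(3)] by (auto simp: cart_pow_def tuples_M)
    from eq_equiv_class_iff[OF eqv this]
    show "(map (\<lambda>i. g i e) [0..<n], map (\<lambda>i. h i e) [0..<n]) \<in> E \<longleftrightarrow> el s (\<lambda>j. g j e) = el s (\<lambda>j. h j e)"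
      by (simp add: QuotSort)
  qed
qed

lemma has_sort_sorts: "has_sort S \<Gamma> t s \<Longrightarrow> set \<Gamma> \<subseteq> sorts S \<Longrightarrow> s \<in> sorts S"
  by (induction rule: has_sort.induct) auto

text \<open>Function symbols take arguments of the home sort only, so a term of a quotient sort is a
  variable or a projection of home terms. In either case it has a representative whose coordinates
  are terms of \<open>M\<close>.\<close>

lemma eq_term_dfn:
  assumes "has_sort (eq_struct M) ss t s"
  shows "\<exists>g. (\<forall>j. dfn_tm (g j)) \<and> (\<forall>e\<in>Env. eval_tm (eq_struct M) (dec ss f e) t = el s (\<lambda>j. g j e))"
  using assms
proof induction
  case (Var i)
  then show ?case
    by (intro exI[of _ "\<lambda>j e. e (f i j)"]) (auto simp: dec_nth intro: dfn_intros)
next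
  case (App ts F)
  have len: "length ts = length (fun_args (eq_struct M) F)"
    using App.IH(1) by (rule list_all2_lengthD)
  have home: "fun_args (eq_struct M) F ! k = HomeSort" if "k < length ts" for k
    using that len by (cases F) auto
  have "\<forall>k<length ts. \<exists>g. (\<forall>j. dfn_tm (g j)) \<and>
      (\<forall>e\<in>Env. eval_tm (eq_struct M) (dec ss f e) (ts ! k) = el HomeSort (\<lambda>j. g j e))"
    using App.IH(1) home by (auto simp: list_all2_conv_all_nth)
  then have "\<forall>k\<in>{..<length ts}. \<exists>g. (\<forall>j. dfn_tm (g j)) \<and>
      (\<forall>e\<in>Env. eval_tm (eq_struct M) (dec ss f e) (ts ! k) = el HomeSort (\<lambda>j. g j e))" by simp
  from bchoice[OF this] obtain g where "\<forall>k\<in>{..<length ts}. (\<forall>j. dfn_tm (g k j)) \<and>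
      (\<forall>e\<in>Env. eval_tm (eq_struct M) (dec ss f e) (ts ! k) = el HomeSort (\<lambda>j. g k j e))" ..
  then have g: "\<And>k j. k < length ts \<Longrightarrow> dfn_tm (g k j)"
    "\<And>k e. k < length ts \<Longrightarrow> e \<in> Env \<Longrightarrow> eval_tm (eq_struct M) (dec ss f e) (ts ! k) = Real (g k 0 e)"
    by auto
  have args: "map the_real (map (eval_tm (eq_struct M) (dec ss f e)) ts) = map (\<lambda>k. g k 0 e) [0..<length ts]"
    if "e \<in> Env" for e
    using g(2)[OF _ that] by (intro nth_equalityI) auto
  show ?case
  proof (cases F)
    case (Base b)
    have "dfn_tm (\<lambda>e. fun_int M b (map (\<lambda>k. k e) (map (\<lambda>k. g k 0) [0..<length ts])))"
      using len Base g(1) by (intro dfn_tm_app) auto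
    then show ?thesis using Base args
      by (intro exI[of _ "\<lambda>j e. fun_int M b (map (\<lambda>k. g k 0 e) [0..<length ts])"]) (auto simp: comp_def)
  next
    case (Proj n E)
    then have n: "length ts = n" using len by simp
    \<comment> \<open>The coordinates from \<open>n\<close> on do not affect the class and are
      filled with a variable.\<close>
    have "dfn_tm (if j < n then g j 0 else (\<lambda>e. e 0))" for j
      using g(1) n by (auto intro: dfn_intros)
    moreover have m: "map (\<lambda>j. (if j < n then g j 0 else (\<lambda>e. e 0)) e) [0..<n] = map (\<lambda>k. g k 0 e) [0..<n]" for e
      by simp
    have "eval_tm (eq_struct M) (dec ss f e) (App F ts) =
        el (fun_res (eq_struct M) F) (\<lambda>j. (if j < n then g j 0 else (\<lambda>e. e 0)) e)" if "e \<in> Env" for e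
      by (simp only: Proj eval_tm.simps eq_struct_simps el.simps m args[OF that] n)
    ultimately show ?thesis
      by (intro exI[of _ "\<lambda>j. if j < n then g j 0 else (\<lambda>e. e 0)"] conjI allI ballI)
  qed
qed

lemma eq_formula_dfn:
  assumes "wf_fm (eq_struct M) ss \<phi>" "set ss \<subseteq> sorts (eq_struct M)"
  shows "dfn (\<lambda>e. sat (eq_struct M) (dec ss f e) \<phi>)"
  using assms
proof (induction \<phi> arbitrary: ss f)
  case (Eq t u)
  then obtain s where s: "has_sort (eq_struct M) ss t s" "has_sort (eq_struct M) ss u s" by auto
  obtain g where g: "\<And>j. dfn_tm (g j)" "\<And>e. e \<in> Env \<Longrightarrow> eval_tm (eq_struct M) (dec ss f e) t = el s (\<lambda>j. g j e)"
    using eq_term_dfn[OF s(1)] by blast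
  obtain h where h: "\<And>j. dfn_tm (h j)" "\<And>e. e \<in> Env \<Longrightarrow> eval_tm (eq_struct M) (dec ss f e) u = el s (\<lambda>j. h j e)"
    using eq_term_dfn[OF s(2)] by blast
  have "s \<in> sorts (eq_struct M)" using has_sort_sorts[OF s(1) Eq.prems(2)] .
  from dfn_el_eq[OF this g(1) h(1)] show ?case
    by (rule dfn_cong[rotated]) (simp add: g(2) h(2))
next
  case (Rel r ts)
  have len: "length ts = length (rel_args M r)"
    using Rel.prems(1) by (auto dest: list_all2_lengthD)
  have "\<forall>k<length ts. has_sort (eq_struct M) ss (ts ! k) HomeSort"
    using Rel.prems(1) by (auto simp: list_all2_conv_all_nth)
  then have "\<forall>k<length ts. \<exists>g. (\<forall>j. dfn_tm (g j)) \<and>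
      (\<forall>e\<in>Env. eval_tm (eq_struct M) (dec ss f e) (ts ! k) = el HomeSort (\<lambda>j. g j e))"
    using eq_term_dfn by blast
  then have "\<forall>k\<in>{..<length ts}. \<exists>g. (\<forall>j. dfn_tm (g j)) \<and>
      (\<forall>e\<in>Env. eval_tm (eq_struct M) (dec ss f e) (ts ! k) = el HomeSort (\<lambda>j. g j e))" by simp
  from bchoice[OF this] obtain g where "\<forall>k\<in>{..<length ts}. (\<forall>j. dfn_tm (g k j)) \<and>
      (\<forall>e\<in>Env. eval_tm (eq_struct M) (dec ss f e) (ts ! k) = el HomeSort (\<lambda>j. g k j e))" ..
  then have g: "\<And>k j. k < length ts \<Longrightarrow> dfn_tm (g k j)"
    "\<And>k e. k < length ts \<Longrightarrow> e \<in> Env \<Longrightarrow> eval_tm (eq_struct M) (dec ss f e) (ts ! k) = Real (g k 0 e)"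
    by auto
  have args: "map the_real (map (eval_tm (eq_struct M) (dec ss f e)) ts) = map (\<lambda>k. g k 0 e) [0..<length ts]"
    if "e \<in> Env" for e
    using g(2)[OF _ that] by (intro nth_equalityI) auto
  have "dfn (\<lambda>e. rel_int M r (map (\<lambda>k. k e) (map (\<lambda>k. g k 0) [0..<length ts])))"
    using len g(1) by (intro dfn_rel) auto
  then show ?case
    by (rule dfn_cong[rotated]) (simp only: sat.simps eq_struct_simps args, simp add: comp_def)
next
  case (Neg \<phi>)
  then show ?case by (auto intro!: dfn_intros)
next
  case (Conj \<phi> \<psi>)
  then show ?case by (auto intro!: dfn_intros)
next
  case (Ex s \<phi>)
  \<comment> \<open>The bound variable is read from the odd positions and the old addresses are
    doubled, which is the coding that \<open>dfn_ex_Env\<close> expects.\<close>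
  have "dfn (\<lambda>e. sat (eq_struct M) (dec (s # ss) (case_nat (\<lambda>j. Suc (2 * j)) (\<lambda>i j. 2 * f i j)) e) \<phi>)"
    using Ex.prems by (intro Ex.IH) auto
  moreover have "dec (s # ss) (case_nat (\<lambda>j. Suc (2 * j)) (\<lambda>i j. 2 * f i j)) e =
      el s (\<lambda>j. e (Suc (2 * j))) # dec ss f (\<lambda>i. e (2 * i))" for e :: "nat \<Rightarrow> 'a"
    by (rule nth_equalityI) (auto simp: dec_nth nth_Cons split: nat.split)
  ultimately have "dfn (\<lambda>e. \<exists>x\<in>Env. sat (eq_struct M) (el s x # dec ss f e) \<phi>)"
    by (intro dfn_ex_Env) simp
  then show ?case
  proof (rule dfn_cong[rotated])
    fix e assume "e \<in> Env"
    have "univ (eq_struct M) s = el s ` Env" using el_univ univ_el by blast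
    then show "(\<exists>x\<in>Env. sat (eq_struct M) (el s x # dec ss f e) \<phi>) \<longleftrightarrow> sat (eq_struct M) (dec ss f e) (Ex s \<phi>)"
      by simp
  qed
qed

text \<open>A tuple \<open>D x\<close> of imaginaries is replaced by the set of all \<open>m\<close>
  that represent it. These sets are the slices of the definable relation \<open>D x = D m\<close>,
  and distinct tuples have distinct slices, so a bound on slices bounds the fibres of
  \<open>Y\<close>.\<close>

lemma eq_uniform_finitenessI:
  assumes ufin: "\<And>R. drel R \<Longrightarrow> ufin (slice R)"
  shows "eq_uniform_finiteness M"
  unfolding eq_uniform_finiteness_def uniformly_finite_set_def
proof (intro allI impI)
  fix ss X ts T Y
  assume X: "eq_definable M ss X"
    and TY: "eq_definable M ts T \<and> eq_definable M (ts @ ss) Y \<and> Y \<subseteq> {t @ x | t x. t \<in> T \<and> x \<in> X}"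
  have T: "T \<subseteq> tuples (eq_struct M) ts" and X: "X \<subseteq> tuples (eq_struct M) ss"
    using TY X by (auto simp: definable_def definable_over_def)
  obtain qs ps \<phi> where sorts: "set (ts @ ss) \<subseteq> sorts (eq_struct M)" "set qs \<subseteq> sorts (eq_struct M)"
    and ps: "ps \<in> tuples (eq_struct M) qs" and wf: "wf_fm (eq_struct M) ((ts @ ss) @ qs) \<phi>"
    and Y: "Y = {xs \<in> tuples (eq_struct M) (ts @ ss). sat (eq_struct M) (xs @ ps) \<phi>}"
    using TY unfolding definable_def definable_over_def by blast
  define pr where "pr i j = prod_encode (i, j)" for i j :: nat
  define D where "D x = dec ss pr x" for x :: "nat \<Rightarrow> 'a"
  define Z where "Z t x \<longleftrightarrow> sat (eq_struct M) (dec ts pr t @ D x @ dec qs (\<lambda>i. pr (length ts + i)) t) \<phi>" for t x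
  have dZ: "drel Z"
  proof -
    \<comment> \<open>Even positions hold a representative of \<open>t @ ps\<close>, so that the
      parameters travel with \<open>t\<close>, and odd positions one of the tuple from
      \<open>X\<close>. The subtraction of \<open>length ss\<close> skips that tuple, which stands
      between \<open>t\<close> and \<open>ps\<close>.\<close>
    define F where "F i j = (if i < length ts then 2 * pr i j
        else if i < length ts + length ss then Suc (2 * pr (i - length ts) j)
        else 2 * pr (i - length ss) j)" for i j
    have "dec ((ts @ ss) @ qs) F e = dec ts pr (\<lambda>i. e (2 * i)) @ D (\<lambda>i. e (Suc (2 * i))) @
        dec qs (\<lambda>i. pr (length ts + i)) (\<lambda>i. e (2 * i))" for e :: "nat \<Rightarrow> 'a"
      unfolding D_def dec_append append_assoc
      by (intro arg_cong2[where f = "(@)"] dec_cong) (auto simp: F_def)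
    then show ?thesis
      using eq_formula_dfn[OF wf, of F] sorts unfolding drel_def Z_def by simp
  qed
  have "drel (\<lambda>x m. \<forall>i<length ss. el (ss ! i) (\<lambda>j. x (pr i j)) = el (ss ! i) (\<lambda>j. m (pr i j)))"
    unfolding drel_def using sorts(1) nth_mem[of _ ss]
    by (intro dfn_all_less dfn_el_eq dfn_intros) (auto simp del: eq_struct_simps(1))
  moreover have "(\<forall>i<length ss. el (ss ! i) (\<lambda>j. x (pr i j)) = el (ss ! i) (\<lambda>j. m (pr i j))) \<longleftrightarrow> D x = D m" for x m
    unfolding D_def by (auto simp: list_eq_iff_nth_eq dec_nth)
  ultimately have "drel (\<lambda>x m. D x = D m)" by simp
  from ufinD[OF ufin[OF this] dZ] obtain N where N: "\<And>t. t \<in> Env \<Longrightarrow>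
    finite (slice (\<lambda>x m. D x = D m) ` slice Z t) \<Longrightarrow> card (slice (\<lambda>x m. D x = D m) ` slice Z t) \<le> N" by blast
  have "card {x \<in> X. t @ x \<in> Y} \<le> N" if t: "t \<in> T" and fin: "finite {x \<in> X. t @ x \<in> Y}" for t
  proof -
    have lt: "length t = length ts" using t T by (auto simp: tuples_def dest: list_all2_lengthD)
    have "t @ ps \<in> tuples (eq_struct M) (ts @ qs)"
      using t T ps by (auto simp: tuples_def intro: list_all2_appendI)
    then obtain e where e: "e \<in> Env" "t @ ps = dec (ts @ qs) pr e"
      using tuples_dec unfolding pr_def by blast
    then have t_eq: "t = dec ts pr e" and ps_eq: "ps = dec qs (\<lambda>i. pr (length ts + i)) e"
      using lt by (auto simp: dec_append)
    have fib: "{x \<in> X. t @ x \<in> Y} = D ` slice Z e"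
    proof (intro Set.set_eqI iffI)
      fix x assume x: "x \<in> {x \<in> X. t @ x \<in> Y}"
      then obtain y where y: "y \<in> Env" "x = D y" using X tuples_dec unfolding D_def pr_def by blast
      then have "Z e y" using x by (simp add: Y Z_def t_eq ps_eq)
      then show "x \<in> D ` slice Z e" using y by (auto simp: slice_def)
    next
      fix x assume "x \<in> D ` slice Z e"
      then obtain y where y: "y \<in> Env" "Z e y" "x = D y" by (auto simp: slice_def)
      have "t @ x \<in> tuples (eq_struct M) (ts @ ss)"
        using t T dec_tuples[OF y(1)] y(3) by (auto simp: tuples_def D_def intro: list_all2_appendI)
      then have Yx: "t @ x \<in> Y" using y by (simp add: Y Z_def t_eq ps_eq)
      then obtain t' x' where "t @ x = t' @ x'" "t' \<in> T" "x' \<in> X" using TY by blast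
      moreover from this have "length t' = length ts" using T by (auto simp: tuples_def dest: list_all2_lengthD)
      ultimately show "x \<in> {x \<in> X. t @ x \<in> Y}" using Yx lt by simp
    qed
    define h where "h d = {m \<in> Env. d = D m}" for d
    have "inj_on h (D ` slice Z e)"
      by (rule inj_onI) (auto simp: h_def slice_def)
    moreover have "slice (\<lambda>x m. D x = D m) ` slice Z e = h ` D ` slice Z e"
      by (auto simp: image_image h_def slice_def[of "\<lambda>x m. D x = D m"])
    ultimately show ?thesis using N[OF e(1)] fin unfolding fib by (simp add: card_image)
  qed
  then show "\<exists>n. \<forall>t\<in>T. infinite {x \<in> X. t @ x \<in> Y} \<longleftrightarrow>
      infinite {x \<in> X. t @ x \<in> Y} \<or> card {x \<in> X. t @ x \<in> Y} > n"
    by (meson not_le)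
qed

end

section \<open>Formulas of \<open>M\<close> as formulas of \<open>M\<^sup>e\<^sup>q\<close>\<close>

primrec emb_fm :: "('s, 'f, 'r) fm \<Rightarrow> ('a eq_sort, ('f, 'a) eq_fun, 'r) fm" where
  "emb_fm (Eq t u) = Eq (map_tm Base t) (map_tm Base u)"
| "emb_fm (Rel r ts) = Rel r (map (map_tm Base) ts)"
| "emb_fm (Neg \<phi>) = Neg (emb_fm \<phi>)"
| "emb_fm (Conj \<phi> \<psi>) = Conj (emb_fm \<phi>) (emb_fm \<psi>)"
| "emb_fm (Ex s \<phi>) = Ex HomeSort (emb_fm \<phi>)"

lemma has_sort_emb:
  assumes "has_sort M \<Gamma> t s"
  shows "has_sort (eq_struct M) (replicate (length \<Gamma>) HomeSort) (map_tm Base t) HomeSort"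
  using assms
proof induction
  case (Var i)
  then show ?case using has_sort.Var[of i "replicate (length \<Gamma>) HomeSort" "eq_struct M"] by simp
next
  case (App ts f)
  have "list_all2 (has_sort (eq_struct M) (replicate (length \<Gamma>) HomeSort)) (map (map_tm Base) ts)
      (fun_args (eq_struct M) (Base f))"
    using App.IH(1) by (auto simp: list_all2_conv_all_nth)
  from has_sort.App[OF this] show ?case by simp
qed

lemma eval_tm_emb:
  assumes "has_sort M \<Gamma> t s" "length xs = length \<Gamma>"
  shows "eval_tm (eq_struct M) (map Real xs) (map_tm Base t) = Real (eval_tm M xs t)"
  using assms(1)
proof induction
  case (App ts f)
  then have "map the_real (map (eval_tm (eq_struct M) (map Real xs)) (map (map_tm Base) ts)) = map (eval_tm M xs) ts"
    by (auto simp: list_all2_conv_all_nth in_set_conv_nth)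
  then show ?case by (simp only: tm.map eval_tm.simps eq_struct_simps)
qed (simp add: assms(2))

lemma wf_fm_emb:
  "wf_fm M \<Gamma> \<phi> \<Longrightarrow> wf_fm (eq_struct M) (replicate (length \<Gamma>) HomeSort) (emb_fm \<phi>)"
proof (induction \<phi> arbitrary: \<Gamma>)
  case (Eq t u)
  then show ?case using has_sort_emb[of M \<Gamma>] by (auto intro!: exI[of _ HomeSort])
next
  case (Rel r ts)
  then show ?case using has_sort_emb[of M \<Gamma>] by (fastforce simp: list_all2_conv_all_nth)
next
  case (Ex s \<phi>)
  then show ?case using Ex.IH[of "s # \<Gamma>"] by simp
qed auto

lemma sat_emb:
  fixes M :: "('f, 'r, 'a) struct"
  shows "wf_fm M \<Gamma> \<phi> \<Longrightarrow> length xs = length \<Gamma> \<Longrightarrow> sat (eq_struct M) (map Real xs) (emb_fm \<phi>) \<longleftrightarrow> sat M xs \<phi>"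
proof (induction \<phi> arbitrary: \<Gamma> xs)
  case (Eq t u)
  then obtain s where "has_sort M \<Gamma> t s" "has_sort M \<Gamma> u s" by auto
  then show ?case using Eq.prems(2) by (simp add: eval_tm_emb)
next
  case (Rel r ts)
  have "eval_tm (eq_struct M) (map Real xs) (map_tm Base t) = Real (eval_tm M xs t)" if "t \<in> set ts" for t
    using that Rel.prems eval_tm_emb[of M \<Gamma> t _ xs] by (auto simp: list_all2_conv_all_nth in_set_conv_nth)
  then have "map the_real (map (eval_tm (eq_struct M) (map Real xs)) (map (map_tm Base) ts)) = map (eval_tm M xs) ts"
    by auto
  then show ?case by (simp only: emb_fm.simps sat.simps eq_struct_simps)
next
  case (Ex s \<phi>)
  have "sat (eq_struct M) (map Real (a # xs)) (emb_fm \<phi>) \<longleftrightarrow> sat M (a # xs) \<phi>" for a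
    using Ex.prems by (intro Ex.IH[of "s # \<Gamma>"]) auto
  moreover have "s = ()" by simp
  ultimately show ?case by simp
next
  case (Neg \<phi>)
  then show ?case by auto
next
  case (Conj \<phi> \<psi>)
  then show ?case using Conj.IH[of \<Gamma> xs] by auto
qed

lemma wf_fm_Ex_power:
  assumes "s \<in> sorts S"
  shows "wf_fm S \<Gamma> ((Ex s ^^ n) \<phi>) \<longleftrightarrow> wf_fm S (replicate n s @ \<Gamma>) \<phi>"
  using assms
  by (induction n arbitrary: \<Gamma>) (simp_all add: replicate_app_Cons_same)

lemma sat_Ex_power:
  "sat S xs ((Ex s ^^ n) \<phi>) \<longleftrightarrow> (\<exists>ys. length ys = n \<and> set ys \<subseteq> univ S s \<and> sat S (ys @ xs) \<phi>)"
proof (induction n arbitrary: xs)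
  case (Suc n)
  have "sat S xs ((Ex s ^^ Suc n) \<phi>) \<longleftrightarrow>
      (\<exists>a\<in>univ S s. \<exists>ys. length ys = n \<and> set ys \<subseteq> univ S s \<and> sat S (ys @ a # xs) \<phi>)"
    using Suc by simp
  also have "\<dots> \<longleftrightarrow> (\<exists>ys. length ys = Suc n \<and> set ys \<subseteq> univ S s \<and> sat S (ys @ xs) \<phi>)"
  proof
    assume "\<exists>a\<in>univ S s. \<exists>ys. length ys = n \<and> set ys \<subseteq> univ S s \<and> sat S (ys @ a # xs) \<phi>"
    then obtain a ys where "a \<in> univ S s" "length ys = n" "set ys \<subseteq> univ S s" "sat S (ys @ a # xs) \<phi>" by blast
    then show "\<exists>ys. length ys = Suc n \<and> set ys \<subseteq> univ S s \<and> sat S (ys @ xs) \<phi>"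
      by (intro exI[of _ "ys @ [a]"]) auto
  next
    assume "\<exists>ys. length ys = Suc n \<and> set ys \<subseteq> univ S s \<and> sat S (ys @ xs) \<phi>"
    then obtain ys where ys: "length ys = Suc n" "set ys \<subseteq> univ S s" "sat S (ys @ xs) \<phi>" by blast
    then obtain zs a where "ys = zs @ [a]" by (metis length_Suc_conv_rev)
    then show "\<exists>a\<in>univ S s. \<exists>ys. length ys = n \<and> set ys \<subseteq> univ S s \<and> sat S (ys @ a # xs) \<phi>"
      using ys by (intro bexI[of _ a] exI[of _ zs]) auto
  qed
  finally show ?case .
qed simp

lemma wf_fm_foldr_Conj: "wf_fm S \<Gamma> (foldr Conj \<phi>s \<psi>) \<longleftrightarrow> (\<forall>\<phi>\<in>set \<phi>s. wf_fm S \<Gamma> \<phi>) \<and> wf_fm S \<Gamma> \<psi>"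
  by (induction \<phi>s) auto

lemma sat_foldr_Conj: "sat S xs (foldr Conj \<phi>s \<psi>) \<longleftrightarrow> (\<forall>\<phi>\<in>set \<phi>s. sat S xs \<phi>) \<and> sat S xs \<psi>"
  by (induction \<phi>s) auto

fun el_tm :: "'a eq_sort \<Rightarrow> (nat \<Rightarrow> nat) \<Rightarrow> ('f, 'a) eq_fun tm" where
  "el_tm HomeSort g = Var (g 0)"
| "el_tm (QuotSort n E) g = App (Proj n E) (map (\<lambda>j. Var (g j)) [0..<n])"

section \<open>Definable sets of imaginaries and codes for definable families\<close>

context fo_structure
begin

text \<open>The converse of \<open>eq_formula_dfn\<close>. The formula says that some elements of
  the home sort satisfy \<open>P\<close> and that each entry of the tuple is represented by those of
  them that \<open>f\<close> assigns to it.\<close>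

lemma eq_definable_dec:
  assumes "dfn P" "set ss \<subseteq> sorts (eq_struct M)"
  shows "eq_definable M ss {dec ss f e | e. e \<in> Env \<and> P e}"
proof -
  obtain m where m: "\<And>k. k \<ge> m \<Longrightarrow> \<exists>\<phi>. wf_fm M (replicate k ()) \<phi> \<and> (\<forall>e\<in>Env. P e \<longleftrightarrow> sat M (map e [0..<k]) \<phi>)"
    using dfn_mono[OF assms(1)] by blast
  \<comment> \<open>Only this many coordinates of a representative matter, so finitely many
    addresses are in use; \<open>n\<close> below is large enough for all of them and for a formula
    for \<open>P\<close>.\<close>
  define ar where "ar s = (case s of HomeSort \<Rightarrow> 1 | QuotSort n E \<Rightarrow> n)" for s :: "'a eq_sort"
  have "finite {f i j | i j. i < length ss \<and> j < ar (ss ! i)}"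
    by (rule finite_subset[of _ "(\<lambda>(i, j). f i j) ` (SIGMA i:{..<length ss}. {..<ar (ss ! i)})"]) auto
  then obtain k where k: "\<And>i j. i < length ss \<Longrightarrow> j < ar (ss ! i) \<Longrightarrow> f i j < k"
    using finite_nat_set_iff_bounded by (smt (verit) mem_Collect_eq)
  define n where "n = m + k"
  obtain \<phi> where \<phi>: "wf_fm M (replicate n ()) \<phi>" "\<And>e. e \<in> Env \<Longrightarrow> P e \<longleftrightarrow> sat M (map e [0..<n]) \<phi>"
    using m[of n] by (auto simp: n_def)
  have fn: "f i j < n" if "i < length ss" "j < ar (ss ! i)" for i j
    using k[OF that] by (simp add: n_def)
  let ?\<Gamma> = "replicate n HomeSort @ ss"
  define \<psi> where "\<psi> = (Ex HomeSort ^^ n) (foldr Conj (map (\<lambda>i. Eq (Var (n + i)) (el_tm (ss ! i) (f i))) [0..<length ss])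
      (ren_fm id (emb_fm \<phi>)))"
  have emb: "wf_fm (eq_struct M) (replicate n HomeSort) (emb_fm \<phi> :: ('a eq_sort, ('f, 'a) eq_fun, 'r) fm)"
    using wf_fm_emb[OF \<phi>(1)] by simp
  have home: "has_sort (eq_struct M) ?\<Gamma> (Var j) HomeSort" if "j < n" for j
    using has_sort.Var[of j ?\<Gamma> "eq_struct M"] that by (simp add: nth_append)
  have sort_el: "has_sort (eq_struct M) ?\<Gamma> (el_tm (ss ! i) (f i)) (ss ! i)" if i: "i < length ss" for i
  proof (cases "ss ! i")
    case HomeSort
    then have "f i 0 < n" using fn[OF i, of 0] by (simp add: ar_def)
    then show ?thesis using home HomeSort by simp
  next
    case (QuotSort a E)
    then have "f i j < n" if "j < a" for j using fn[OF i, of j] that by (simp add: ar_def)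
    then have "list_all2 (has_sort (eq_struct M) ?\<Gamma>) (map (\<lambda>j. Var (f i j)) [0..<a]) (fun_args (eq_struct M) (Proj a E))"
      using home by (auto simp: list_all2_conv_all_nth)
    moreover have "fun_res (eq_struct M) (Proj a E) \<in> sorts (eq_struct M)"
      using assms(2) nth_mem[OF i] QuotSort by auto
    ultimately have "has_sort (eq_struct M) ?\<Gamma> (App (Proj a E) (map (\<lambda>j. Var (f i j)) [0..<a]))
        (fun_res (eq_struct M) (Proj a E))"
      by (rule has_sort.App)
    then show ?thesis by (simp add: QuotSort)
  qed
  have "wf_fm (eq_struct M) ?\<Gamma> (Eq (Var (n + i)) (el_tm (ss ! i) (f i)))" if "i < length ss" for i
    using sort_el[OF that] has_sort.Var[of "n + i" ?\<Gamma> "eq_struct M"] that by (auto simp: nth_append)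
  moreover have "wf_fm (eq_struct M) ?\<Gamma> (ren_fm id (emb_fm \<phi>))"
    by (rule wf_fm_ren[OF emb]) (auto simp: nth_append)
  ultimately have wf: "wf_fm (eq_struct M) ss \<psi>"
    unfolding \<psi>_def by (subst wf_fm_Ex_power) (auto simp: wf_fm_foldr_Conj simp del: wf_fm.simps(1))
  have sat: "sat (eq_struct M) xs \<psi> \<longleftrightarrow> (\<exists>e\<in>Env. P e \<and> xs = dec ss f e)" if xs: "xs \<in> tuples (eq_struct M) ss" for xs
  proof -
    have len: "length xs = length ss" using xs by (auto simp: tuples_def dest: list_all2_lengthD)
    have body: "sat (eq_struct M) (map Real (map e [0..<n]) @ xs) (foldr Conj (map (\<lambda>i. Eq (Var (n + i)) (el_tm (ss ! i) (f i))) [0..<length ss])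
        (ren_fm id (emb_fm \<phi>))) \<longleftrightarrow> P e \<and> xs = dec ss f e" if e: "e \<in> Env" for e
    proof -
      have "eval_tm (eq_struct M) (map Real (map e [0..<n]) @ xs) (el_tm (ss ! i) (f i)) = el (ss ! i) (\<lambda>j. e (f i j))"
        if i: "i < length ss" for i
      proof (cases "ss ! i")
        case HomeSort
        then show ?thesis using fn[OF i, of 0] by (simp add: ar_def nth_append)
      next
        case (QuotSort a E)
        have "map the_real (map (eval_tm (eq_struct M) (map Real (map e [0..<n]) @ xs)) (map (\<lambda>j. Var (f i j)) [0..<a])) =
            map (\<lambda>j. e (f i j)) [0..<a]"
          using fn[OF i] QuotSort by (auto simp: ar_def nth_append)
        then show ?thesis by (simp only: QuotSort el_tm.simps eval_tm.simps eq_struct_simps el.simps)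
      qed
      moreover have "sat (eq_struct M) (map Real (map e [0..<n]) @ xs) (ren_fm id (emb_fm \<phi>)) \<longleftrightarrow> P e"
      proof -
        have "sat (eq_struct M) (map Real (map e [0..<n]) @ xs) (ren_fm id (emb_fm \<phi>)) \<longleftrightarrow>
            sat (eq_struct M) (map Real (map e [0..<n])) (emb_fm \<phi>)"
          by (rule sat_ren[OF emb]) (auto simp: nth_append)
        also have "\<dots> \<longleftrightarrow> sat M (map e [0..<n]) \<phi>" by (rule sat_emb[OF \<phi>(1)]) simp
        finally show ?thesis using \<phi>(2)[OF e] by simp
      qed
      moreover have "xs = dec ss f e \<longleftrightarrow> (\<forall>i<length ss. xs ! i = el (ss ! i) (\<lambda>j. e (f i j)))"
        using len by (auto simp: list_eq_iff_nth_eq dec_nth)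
      ultimately show ?thesis using len
        by (auto simp: sat_foldr_Conj nth_append)
    qed
    have "sat (eq_struct M) xs \<psi> \<longleftrightarrow> (\<exists>e\<in>Env. sat (eq_struct M) (map Real (map e [0..<n]) @ xs)
        (foldr Conj (map (\<lambda>i. Eq (Var (n + i)) (el_tm (ss ! i) (f i))) [0..<length ss]) (ren_fm id (emb_fm \<phi>))))"
      unfolding \<psi>_def sat_Ex_power
    proof (intro iffI; elim exE conjE bexE)
      fix ys :: "'a eq_elem list"
      assume ys: "length ys = n" "set ys \<subseteq> univ (eq_struct M) HomeSort"
        "sat (eq_struct M) (ys @ xs) (foldr Conj (map (\<lambda>i. Eq (Var (n + i)) (el_tm (ss ! i) (f i))) [0..<length ss]) (ren_fm id (emb_fm \<phi>)))"
      have "map the_real ys \<in> tuples M (replicate n ())" using ys(1,2) by (auto simp: tuples_M)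
      then obtain e where e: "e \<in> Env" "map the_real ys = map e [0..<n]" using Env_extend by blast
      have "ys = map Real (map the_real ys)" using ys(2) by (auto intro!: map_idI[symmetric])
      then have "ys = map Real (map e [0..<n])" using e(2) by simp
      then show "\<exists>e\<in>Env. sat (eq_struct M) (map Real (map e [0..<n]) @ xs)
        (foldr Conj (map (\<lambda>i. Eq (Var (n + i)) (el_tm (ss ! i) (f i))) [0..<length ss]) (ren_fm id (emb_fm \<phi>)))"
        using ys(3) e(1) by (intro bexI[of _ e]) simp_all
    next
      fix e assume "e \<in> Env" "sat (eq_struct M) (map Real (map e [0..<n]) @ xs)
        (foldr Conj (map (\<lambda>i. Eq (Var (n + i)) (el_tm (ss ! i) (f i))) [0..<length ss]) (ren_fm id (emb_fm \<phi>)))"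
      then show "\<exists>ys. length ys = n \<and> set ys \<subseteq> univ (eq_struct M) HomeSort \<and> sat (eq_struct M) (ys @ xs)
        (foldr Conj (map (\<lambda>i. Eq (Var (n + i)) (el_tm (ss ! i) (f i))) [0..<length ss]) (ren_fm id (emb_fm \<phi>)))"
        by (intro exI[of _ "map Real (map e [0..<n])"]) (auto simp: EnvD simp del: map_map)
    qed
    also have "\<dots> \<longleftrightarrow> (\<exists>e\<in>Env. P e \<and> xs = dec ss f e)" using body by blast
    finally show ?thesis .
  qed
  have "{dec ss f e | e. e \<in> Env \<and> P e} = {xs \<in> tuples (eq_struct M) ss. sat (eq_struct M) xs \<psi>}"
    using sat dec_tuples[of _ ss f] by blast
  then have "{dec ss f e | e. e \<in> Env \<and> P e} = {xs \<in> tuples (eq_struct M) ss. sat (eq_struct M) (xs @ []) \<psi>}"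
    by simp
  moreover have "[] \<in> tuples (eq_struct M) []" by (simp add: tuples_def)
  moreover have "wf_fm (eq_struct M) (ss @ []) \<psi>" using wf by simp
  ultimately show ?thesis
    unfolding definable_def definable_over_def using assms(2)
    by (intro conjI exI[of _ "[]"] exI[of _ \<psi>]) (simp_all del: eq_struct_simps)
qed

lemma dfam_eq_definable:
  assumes "dfam S" "x \<in> Env"
  shows "eq_definable M [HomeSort] {[Real a] | a. a \<in> S x}"
proof -
  obtain n \<phi> where \<phi>: "wf_fm M (replicate (Suc n) ()) \<phi>"
    "\<forall>e\<in>Env. e 0 \<in> S (\<lambda>i. e (Suc i)) \<longleftrightarrow> sat M (map e [0..<Suc n]) \<phi>"
    using dfn_mono[of "\<lambda>e. e 0 \<in> S (\<lambda>i. e (Suc i))"] assms(1) unfolding dfam_def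
    by (meson le_SucI order_refl)
  have "a \<in> S x \<longleftrightarrow> sat M (a # map x [0..<n]) \<phi>" if "a \<in> carr M" for a
    using bspec[OF \<phi>(2), of "case_nat a x"] that assms(2)
    by (simp add: map_upt_Suc del: upt_Suc)
  then have mem: "a \<in> S x \<longleftrightarrow> a \<in> carr M \<and> sat M (a # map x [0..<n]) \<phi>" for a
    using dfam_subset[OF assms] by blast
  have emb: "sat (eq_struct M) (Real a # map Real (map x [0..<n])) (emb_fm \<phi>) \<longleftrightarrow> sat M (a # map x [0..<n]) \<phi>" for a
    using sat_emb[OF \<phi>(1), of "a # map x [0..<n]"] by simp
  have "{[Real a] | a. a \<in> S x} =
      {xs \<in> tuples (eq_struct M) [HomeSort]. sat (eq_struct M) (xs @ map Real (map x [0..<n])) (emb_fm \<phi>)}"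
    using mem emb by (auto simp: tuples_def list_all2_Cons2 simp del: map_map)
  moreover have "wf_fm (eq_struct M) ([HomeSort] @ replicate n HomeSort) (emb_fm \<phi>)"
    using wf_fm_emb[OF \<phi>(1)] by simp
  moreover have "map Real (map x [0..<n]) \<in> tuples (eq_struct M) (replicate n HomeSort)"
    using assms(2) by (auto simp: tuples_def list_all2_conv_all_nth EnvD)
  ultimately show ?thesis unfolding definable_def definable_over_def
    by (intro conjI exI[of _ "replicate n HomeSort"] exI[of _ "map Real (map x [0..<n])"] exI[of _ "emb_fm \<phi>"]) auto
qed

text \<open>Equality of \<open>S x\<close> and \<open>S y\<close> is an equivalence relation on a
  power of \<open>M\<close>, definable without parameters. Its quotient is thus a sort of
  \<open>M\<^sup>e\<^sup>q\<close> whose elements code the members of \<open>S\<close>. The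
  membership relation makes the whole sort a set of imaginaries from \<open>\<D>\<close>, and its
  uniform finiteness is transferred to \<open>S\<close>.\<close>

lemma ufin_if_collection:
  assumes uf: "collection_uniform_finiteness M \<D>" and S: "dfam S"
    and \<D>: "\<And>x. x \<in> Env \<Longrightarrow> {[h] | h. h \<in> S x} \<in> \<D>"
  shows "ufin S"
proof -
  obtain n where n: "\<And>x y. x \<in> Env \<Longrightarrow> y \<in> Env \<Longrightarrow> (\<And>i. i < n \<Longrightarrow> x i = y i) \<Longrightarrow> S x = S y"
    using dfam_finite_support[OF S] by blast
  define m where "m = Suc n"
  have supp: "S x = S y" if "x \<in> Env" "y \<in> Env" "\<And>i. i < m \<Longrightarrow> x i = y i" for x y
    using that by (intro n) (auto simp: m_def)
  define E where "E = {(map x [0..<m], map y [0..<m]) | x y. x \<in> Env \<and> y \<in> Env \<and> S x = S y}"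
  have E_iff: "(map x [0..<m], map y [0..<m]) \<in> E \<longleftrightarrow> S x = S y" if xy: "x \<in> Env" "y \<in> Env" for x y
  proof
    assume "(map x [0..<m], map y [0..<m]) \<in> E"
    then obtain x' y' where *: "x' \<in> Env" "y' \<in> Env" "S x' = S y'"
      "map x [0..<m] = map x' [0..<m]" "map y [0..<m] = map y' [0..<m]" by (auto simp: E_def)
    have "S x = S x'" using xy * by (intro supp) simp_all
    moreover have "S y = S y'" using xy * by (intro supp) simp_all
    ultimately show "S x = S y" using * by simp
  qed (use xy in \<open>auto simp: E_def\<close>)
  have cart: "xs \<in> cart_pow M m \<longleftrightarrow> (\<exists>x\<in>Env. xs = map x [0..<m])" for xs
    using Env_extend[of xs m] map_Env[of _ "[0..<m]"] by (auto simp: cart_pow_def)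
  have eqv: "equiv (cart_pow M m) E"
  proof (rule equivI)
    show "E \<subseteq> cart_pow M m \<times> cart_pow M m" by (auto simp: E_def cart)
    show "refl_on (cart_pow M m) E" by (auto simp: refl_on_def cart E_iff)
    show "sym E" by (auto simp: sym_def E_def)
    show "trans E"
    proof (rule transI)
      fix xs ys zs assume xy: "(xs, ys) \<in> E" and yz: "(ys, zs) \<in> E"
      obtain x y where *: "x \<in> Env" "y \<in> Env" "xs = map x [0..<m]" "ys = map y [0..<m]" "S x = S y"
        using xy unfolding E_def by blast
      obtain w where w: "w \<in> Env" "zs = map w [0..<m]" using yz unfolding E_def by blast
      have "S y = S w" using E_iff[OF *(2) w(1)] yz *(4) w(2) by simp
      then show "(xs, zs) \<in> E" using E_iff[OF *(1) w(1)] * w by simp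
    qed
  qed
  have zde: "zero_definable_equiv M m E"
  proof -
    \<comment> \<open>Clipping the indices at \<open>n\<close>, which is less than \<open>m\<close>,
      makes \<open>Q\<close> depend on the first \<open>m + m\<close> entries only, as
      \<open>dfn_support\<close> requires; the values of \<open>S\<close> are unaffected.\<close>
    define Q where "Q e \<longleftrightarrow> S (\<lambda>i. e (min i n)) = S (\<lambda>i. e (m + min i n))" for e
    have "dfn (\<lambda>e. \<forall>a\<in>carr M. a \<in> S (\<lambda>i. e (min i n)) \<longleftrightarrow> a \<in> S (\<lambda>i. e (m + min i n)))"
      by (intro dfn_intros dfn_mem[OF S])
    then have "dfn Q"
    proof (rule dfn_cong[rotated])
      fix e assume "e \<in> Env"
      then have "(\<lambda>i. e (min i n)) \<in> Env" "(\<lambda>i. e (m + min i n)) \<in> Env" by (auto simp: Env_def)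
      then show "(\<forall>a\<in>carr M. a \<in> S (\<lambda>i. e (min i n)) \<longleftrightarrow> a \<in> S (\<lambda>i. e (m + min i n))) \<longleftrightarrow> Q e"
        unfolding Q_def using dfam_subset[OF S] by blast
    qed
    moreover have "Q e \<longleftrightarrow> Q e'" if "\<And>i. i < m + m \<Longrightarrow> e i = e' i" for e e'
    proof -
      have "e (min i n) = e' (min i n)" "e (m + min i n) = e' (m + min i n)" for i
        by (rule that, simp add: m_def)+
      then show ?thesis by (simp add: Q_def)
    qed
    ultimately obtain \<phi> where \<phi>: "wf_fm M (replicate (m + m) ()) \<phi>"
      "\<And>e. e \<in> Env \<Longrightarrow> Q e \<longleftrightarrow> sat M (map e [0..<m + m]) \<phi>"
      using dfn_support[of Q "m + m"] unfolding m_def by blast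
    have Q: "Q e \<longleftrightarrow> (map e [0..<m], map (\<lambda>i. e (m + i)) [0..<m]) \<in> E" if e: "e \<in> Env" for e
    proof -
      have *: "S (\<lambda>i. e (min i n)) = S e"
        by (rule supp) (use e in \<open>auto simp: Env_def m_def\<close>)
      have **: "S (\<lambda>i. e (m + min i n)) = S (\<lambda>i. e (m + i))"
        by (rule supp) (use e in \<open>auto simp: Env_def m_def\<close>)
      have "(\<lambda>i. e (m + i)) \<in> Env" using e by (auto simp: Env_def)
      then show ?thesis using E_iff[OF e] by (simp add: Q_def * **)
    qed
    have split: "map e [0..<m + m] = map e [0..<m] @ map (\<lambda>i. e (m + i)) [0..<m]" for e :: "nat \<Rightarrow> 'a"
      by (rule nth_equalityI) (auto simp: nth_append)
    have "{xs @ ys | xs ys. (xs, ys) \<in> E} = {zs \<in> tuples M (replicate (m + m) ()). sat M (zs @ []) \<phi>}"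
    proof (intro Set.set_eqI iffI)
      fix zs assume "zs \<in> {xs @ ys | xs ys. (xs, ys) \<in> E}"
      then obtain x y where xy: "x \<in> Env" "y \<in> Env" "(map x [0..<m], map y [0..<m]) \<in> E" "zs = map x [0..<m] @ map y [0..<m]"
        unfolding E_def by blast
      define e where "e i = (if i < m then x i else y (i - m))" for i
      have e: "e \<in> Env" using xy by (auto simp: e_def Env_def)
      have ex: "map e [0..<m] = map x [0..<m]" and ey: "map (\<lambda>i. e (m + i)) [0..<m] = map y [0..<m]"
        by (auto simp: e_def)
      have "zs = map e [0..<m + m]" "Q e"
        unfolding split[of e] Q[OF e] ex ey by (fact xy(4), fact xy(3))
      then show "zs \<in> {zs \<in> tuples M (replicate (m + m) ()). sat M (zs @ []) \<phi>}"
        using \<phi>(2)[OF e] map_Env[OF e, of "[0..<m + m]"] by simp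
    next
      fix zs assume zs: "zs \<in> {zs \<in> tuples M (replicate (m + m) ()). sat M (zs @ []) \<phi>}"
      then obtain e where e: "e \<in> Env" "zs = map e [0..<m + m]" using Env_extend by blast
      then have "Q e" using zs \<phi>(2)[OF e(1)] by simp
      then show "zs \<in> {xs @ ys | xs ys. (xs, ys) \<in> E}" using Q[OF e(1)] e(2) split[of e] by blast
    qed
    moreover have "[] \<in> tuples M []" by (simp add: tuples_def)
    ultimately show ?thesis unfolding zero_definable_equiv_def definable_over_def using eqv \<phi>(1)
      by (intro conjI exI[of _ "[]"] exI[of _ \<phi>]) auto
  qed
  define q where "q = QuotSort m E"
  define cls where "cls x = el q x" for x
  have q: "q \<in> sorts (eq_struct M)" using zde by (auto simp: q_def)
  have cls_iff: "cls x = cls y \<longleftrightarrow> S x = S y" if "x \<in> Env" "y \<in> Env" for x y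
  proof -
    have "map x [0..<m] \<in> cart_pow M m" "map y [0..<m] \<in> cart_pow M m" using cart that by blast+
    from eq_equiv_class_iff[OF eqv this] show ?thesis using E_iff[OF that] by (simp add: cls_def q_def)
  qed
  define X where "X = {[cls x] | x. x \<in> Env}"
  have X: "eq_definable M [q] X"
    using eq_definable_dec[OF dfn_True, of "[q]" "\<lambda>i j. j"] q
    by (simp add: X_def cls_def dec_def del: eq_struct_simps)
  define R where "R = {[cls x, Real a] | x a. x \<in> Env \<and> a \<in> S x}"
  have dec_q: "dec [q, HomeSort] (case_nat Suc (\<lambda>_ _. 0)) e = [cls (\<lambda>i. e (Suc i)), Real (e 0)]" for e
    by (simp add: dec_def cls_def upt_rec)
  have dec_R: "{[cls (\<lambda>i. e (Suc i)), Real (e 0)] | e. e \<in> Env \<and> e 0 \<in> S (\<lambda>i. e (Suc i))} = R"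
  proof (intro Set.set_eqI iffI)
    fix r assume "r \<in> {[cls (\<lambda>i. e (Suc i)), Real (e 0)] | e. e \<in> Env \<and> e 0 \<in> S (\<lambda>i. e (Suc i))}"
    then show "r \<in> R" unfolding R_def using Env_comp by blast
  next
    fix r assume "r \<in> R"
    then obtain x a where "r = [cls x, Real a]" "x \<in> Env" "a \<in> S x" by (auto simp: R_def)
    then show "r \<in> {[cls (\<lambda>i. e (Suc i)), Real (e 0)] | e. e \<in> Env \<and> e 0 \<in> S (\<lambda>i. e (Suc i))}"
      using dfam_subset[OF S] by (auto intro!: exI[of _ "case_nat a x"])
  qed
  have dR: "eq_definable M [q, HomeSort] R"
  proof -
    have "dfn (\<lambda>e. e 0 \<in> S (\<lambda>i. e (Suc i)))" using S by (simp add: dfam_def)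
    moreover have "set [q, HomeSort] \<subseteq> sorts (eq_struct M)" using q by simp
    ultimately have "eq_definable M [q, HomeSort]
        {dec [q, HomeSort] (case_nat Suc (\<lambda>_ _. 0)) e | e. e \<in> Env \<and> e 0 \<in> S (\<lambda>i. e (Suc i))}"
      by (rule eq_definable_dec)
    then show ?thesis unfolding dec_q dec_R .
  qed
  have fibre: "{k \<in> cart_pow M 1. [cls x] @ map Real k \<in> R} = {[a] | a. a \<in> S x}" if x: "x \<in> Env" for x
  proof (intro Set.set_eqI iffI)
    fix k assume "k \<in> {k \<in> cart_pow M 1. [cls x] @ map Real k \<in> R}"
    then obtain y a where y: "y \<in> Env" "a \<in> S y" "cls x = cls y" "map Real k = [Real a]" by (auto simp: R_def)
    then have "k = [a]" by (auto simp: map_eq_Cons_conv)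
    then show "k \<in> {[a] | a. a \<in> S x}" using y cls_iff[OF x y(1)] by auto
  next
    fix k assume "k \<in> {[a] | a. a \<in> S x}"
    then show "k \<in> {k \<in> cart_pow M 1. [cls x] @ map Real k \<in> R}"
      using x dfam_subset[OF S x] by (auto simp: R_def cart_pow_def tuples_def)
  qed
  have "imaginaries_from M \<D> [q] X"
    unfolding imaginaries_from_def
  proof (intro exI[of _ 1] exI[of _ R] conjI ballI)
    show "eq_definable M ([q] @ replicate 1 HomeSort) R" using dR by simp
    show "R \<subseteq> {x @ map Real k | x k. x \<in> X \<and> k \<in> cart_pow M 1}"
    proof
      fix r assume "r \<in> R"
      then obtain x a where r: "r = [cls x] @ map Real [a]" "x \<in> Env" "a \<in> S x" by (auto simp: R_def)
      then have "[a] \<in> cart_pow M 1" "[cls x] \<in> X"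
        using dfam_subset[OF S] by (auto simp: cart_pow_def tuples_def X_def)
      then show "r \<in> {x @ map Real k | x k. x \<in> X \<and> k \<in> cart_pow M 1}" using r(1) by blast
    qed
    show "inj_on (\<lambda>x. {k \<in> cart_pow M 1. x @ map Real k \<in> R}) X"
    proof (rule inj_onI)
      fix c d assume "c \<in> X" "d \<in> X" and eq: "{k \<in> cart_pow M 1. c @ map Real k \<in> R} = {k \<in> cart_pow M 1. d @ map Real k \<in> R}"
      then obtain x y where xy: "c = [cls x]" "d = [cls y]" "x \<in> Env" "y \<in> Env" by (auto simp: X_def)
      then have "{[a] | a. a \<in> S x} = {[a] | a. a \<in> S y}" using eq fibre by simp
      then have "S x = S y" by blast
      then show "c = d" using xy cls_iff by simp
    qed
    fix c assume "c \<in> X"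
    then obtain x where "c = [cls x]" "x \<in> Env" by (auto simp: X_def)
    then show "{k \<in> cart_pow M 1. c @ map Real k \<in> R} \<in> \<D>" using fibre \<D> by simp
  qed
  then have ufX: "uniformly_finite_set M [q] X"
    using uf X unfolding collection_uniform_finiteness_def by blast
  show ?thesis unfolding ufin_def
  proof (intro allI impI)
    fix Z assume Z: "drel Z"
    \<comment> \<open>\<open>Z\<close> has a sequence \<open>t\<close> as parameter, whereas a
      definable family in \<open>M\<^sup>e\<^sup>q\<close> is indexed by finite tuples; the first
      \<open>k\<close> entries of \<open>t\<close> suffice.\<close>
    obtain k where k: "\<And>e e'. e \<in> Env \<Longrightarrow> e' \<in> Env \<Longrightarrow> (\<And>i. i < k \<Longrightarrow> e i = e' i) \<Longrightarrow>
        Z (\<lambda>i. e (2 * i)) (\<lambda>i. e (Suc (2 * i))) \<longleftrightarrow> Z (\<lambda>i. e' (2 * i)) (\<lambda>i. e' (Suc (2 * i)))"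
      using dfn_finite_support[OF Z[unfolded drel_def]] by blast
    have Z_supp: "Z t x \<longleftrightarrow> Z t' x" if "t \<in> Env" "t' \<in> Env" "x \<in> Env" "\<And>i. i < k \<Longrightarrow> t i = t' i" for t t' x
      using k[of "\<lambda>i. if even i then t (i div 2) else x (i div 2)" "\<lambda>i. if even i then t' (i div 2) else x (i div 2)"]
        that by (auto simp: Env_def)
    define tup where "tup t = map Real (map t [0..<k])" for t :: "nat \<Rightarrow> 'a"
    define ts where "ts = replicate k (HomeSort :: 'a eq_sort)"
    define T where "T = {tup t | t. t \<in> Env}"
    define Y where "Y = {tup t @ [cls x] | t x. t \<in> Env \<and> x \<in> Env \<and> Z t x}"
    have dec_T: "dec ts (\<lambda>i j. i) t = tup t" for t
      by (rule nth_equalityI) (auto simp: dec_nth ts_def tup_def)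
    have "set ts \<subseteq> sorts (eq_struct M)" by (auto simp: ts_def)
    from eq_definable_dec[OF dfn_True this, of "\<lambda>i j. i"]
    have dT: "eq_definable M ts T" unfolding dec_T T_def by simp
    define F where "F i j = (if i < k then 2 * i else Suc (2 * j))" for i j
    have dec_F: "dec (ts @ [q]) F e = tup (\<lambda>i. e (2 * i)) @ [cls (\<lambda>i. e (Suc (2 * i)))]" for e
      by (rule nth_equalityI) (auto simp: dec_nth ts_def tup_def nth_append F_def cls_def less_Suc_eq)
    have dec_Y: "{tup (\<lambda>i. e (2 * i)) @ [cls (\<lambda>i. e (Suc (2 * i)))] | e. e \<in> Env \<and> Z (\<lambda>i. e (2 * i)) (\<lambda>i. e (Suc (2 * i)))} = Y"
    proof (intro Set.set_eqI iffI)
      fix y assume "y \<in> {tup (\<lambda>i. e (2 * i)) @ [cls (\<lambda>i. e (Suc (2 * i)))] | e. e \<in> Env \<and> Z (\<lambda>i. e (2 * i)) (\<lambda>i. e (Suc (2 * i)))}"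
      then obtain e where e: "e \<in> Env" "Z (\<lambda>i. e (2 * i)) (\<lambda>i. e (Suc (2 * i)))"
        "y = tup (\<lambda>i. e (2 * i)) @ [cls (\<lambda>i. e (Suc (2 * i)))]" by blast
      have "(\<lambda>i. e (2 * i)) \<in> Env" "(\<lambda>i. e (Suc (2 * i))) \<in> Env" using e(1) by (auto simp: Env_def)
      then show "y \<in> Y" unfolding Y_def using e by blast
    next
      fix y assume "y \<in> Y"
      then obtain t x where tx: "t \<in> Env" "x \<in> Env" "Z t x" "y = tup t @ [cls x]" by (auto simp: Y_def)
      define e where "e i = (if even i then t (i div 2) else x (i div 2))" for i
      have "e \<in> Env" "(\<lambda>i. e (2 * i)) = t" "(\<lambda>i. e (Suc (2 * i))) = x" using tx by (auto simp: e_def Env_def)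
      then show "y \<in> {tup (\<lambda>i. e (2 * i)) @ [cls (\<lambda>i. e (Suc (2 * i)))] | e. e \<in> Env \<and> Z (\<lambda>i. e (2 * i)) (\<lambda>i. e (Suc (2 * i)))}"
        using tx by (auto intro!: exI[of _ e])
    qed
    have "set (ts @ [q]) \<subseteq> sorts (eq_struct M)" using q by (auto simp: ts_def)
    from eq_definable_dec[OF Z[unfolded drel_def] this, of F]
    have dY: "eq_definable M (ts @ [q]) Y" unfolding dec_F dec_Y .
    have sub: "Y \<subseteq> {t @ x | t x. t \<in> T \<and> x \<in> X}" unfolding Y_def T_def X_def by blast
    have "\<exists>N. \<forall>t\<in>T. infinite {x \<in> X. t @ x \<in> Y} \<longleftrightarrow>
        infinite {x \<in> X. t @ x \<in> Y} \<or> card {x \<in> X. t @ x \<in> Y} > N"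
      using ufX[unfolded uniformly_finite_set_def, THEN spec[of _ ts], THEN spec[of _ T], THEN spec[of _ Y]]
        dT dY sub by simp
    then obtain N where N: "\<And>t. t \<in> T \<Longrightarrow> infinite {x \<in> X. t @ x \<in> Y} \<longleftrightarrow>
        infinite {x \<in> X. t @ x \<in> Y} \<or> card {x \<in> X. t @ x \<in> Y} > N"
      by blast
    have "card (S ` slice Z t) \<le> N" if t: "t \<in> Env" and fin: "finite (S ` slice Z t)" for t
    proof -
      have fib: "{x \<in> X. tup t @ x \<in> Y} = (\<lambda>x. [cls x]) ` slice Z t"
      proof (intro Set.set_eqI iffI)
        fix c assume "c \<in> {x \<in> X. tup t @ x \<in> Y}"
        then obtain t' x where c: "t' \<in> Env" "x \<in> Env" "Z t' x" "tup t @ c = tup t' @ [cls x]" by (auto simp: Y_def)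
        have len: "length (tup t) = length (tup t')" by (simp add: tup_def)
        then have "tup t = tup t'" "c = [cls x]" using c(4) by auto
        then have "map t [0..<k] = map t' [0..<k]" unfolding tup_def by (auto dest: map_injective intro: injI)
        then have "t i = t' i" if "i < k" for i using that by simp
        then have "Z t x" using Z_supp[OF t c(1,2)] c(3) by blast
        then have "x \<in> slice Z t" using c(2) by (simp add: slice_def)
        then show "c \<in> (\<lambda>x. [cls x]) ` slice Z t" using \<open>c = [cls x]\<close> by blast
      next
        fix c assume "c \<in> (\<lambda>x. [cls x]) ` slice Z t"
        then obtain x where "x \<in> Env" "Z t x" "c = [cls x]" by (auto simp: slice_def)
        then show "c \<in> {x \<in> X. tup t @ x \<in> Y}" using t unfolding X_def Y_def by blast
      qed
      \<comment> \<open>\<open>g\<close> decodes a class to the member it stands for; being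
        injective, it carries finiteness and cardinality between codes and members.\<close>
      define g where "g c = S (SOME x. x \<in> Env \<and> [cls x] = c)" for c
      have g: "g [cls x] = S x" if "x \<in> Env" for x
      proof -
        have "(SOME y. y \<in> Env \<and> [cls y] = [cls x]) \<in> Env \<and> [cls (SOME y. y \<in> Env \<and> [cls y] = [cls x])] = [cls x]"
          using that by (intro someI[of "\<lambda>y. y \<in> Env \<and> [cls y] = [cls x]"]) auto
        then show ?thesis unfolding g_def using cls_iff[of "SOME y. y \<in> Env \<and> [cls y] = [cls x]" x] that by simp
      qed
      have inj: "inj_on g ((\<lambda>x. [cls x]) ` slice Z t)"
      proof (rule inj_onI)
        fix c d assume "c \<in> (\<lambda>x. [cls x]) ` slice Z t" "d \<in> (\<lambda>x. [cls x]) ` slice Z t" and eq: "g c = g d"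
        then obtain x y where xy: "x \<in> Env" "y \<in> Env" "c = [cls x]" "d = [cls y]" by (auto simp: slice_def)
        then have "S x = S y" using eq g by simp
        then show "c = d" using xy cls_iff by simp
      qed
      have img: "g ` (\<lambda>x. [cls x]) ` slice Z t = S ` slice Z t"
        unfolding image_image by (rule image_cong) (auto simp: slice_def g)
      have "finite ((\<lambda>x. [cls x]) ` slice Z t)" using fin finite_imageD[OF _ inj] img by simp
      then have "card ((\<lambda>x. [cls x]) ` slice Z t) \<le> N"
        using N[of "tup t"] t unfolding fib by (auto simp: T_def not_less)
      then show ?thesis using card_image[OF inj] img by simp
    qed
    then show "\<exists>N. \<forall>t\<in>Env. finite (S ` slice Z t) \<longrightarrow> card (S ` slice Z t) \<le> N" by blast
  qed
qed

end

section \<open>Convex subgroups of definable ordered fields\<close>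

locale definable_ordered_field = wom_structure M l + field K
  for M :: "('f, 'r, 'a) struct" and l :: 'r and K :: "('a, 'b) ring_scheme" (structure) +
  fixes p t :: 'f
  assumes carrier_K: "carrier K = carr M"
    and args: "length (fun_args M p) = 2" "length (fun_args M t) = 2"
    and add_p: "\<And>x y. x \<oplus> y = fun_int M p [x, y]"
    and mult_t: "\<And>x y. x \<otimes> y = fun_int M t [x, y]"
    and add_mono: "\<And>x y w. x \<in> carrier K \<Longrightarrow> y \<in> carrier K \<Longrightarrow> w \<in> carrier K \<Longrightarrow> x \<prec> y \<Longrightarrow> w \<oplus> x \<prec> w \<oplus> y"
    and mult_pos: "\<And>x y. x \<in> carrier K \<Longrightarrow> y \<in> carrier K \<Longrightarrow> \<zero> \<prec> x \<Longrightarrow> \<zero> \<prec> y \<Longrightarrow> \<zero> \<prec> x \<otimes> y"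
begin

section \<open>Ordered fields and the group of positive elements\<close>

lemma dfn_tm_ring [dfn_intros]:
  assumes "dfn_tm g" "dfn_tm h"
  shows "dfn_tm (\<lambda>e. g e \<oplus> h e)" "dfn_tm (\<lambda>e. g e \<otimes> h e)"
proof -
  have gh: "dfn_tm k" if "k \<in> set [g, h]" for k using that assms by auto
  show "dfn_tm (\<lambda>e. g e \<oplus> h e)" using dfn_tm_app[of "[g, h]" p, OF gh] args by (simp add: add_p)
  show "dfn_tm (\<lambda>e. g e \<otimes> h e)" using dfn_tm_app[of "[g, h]" t, OF gh] args by (simp add: mult_t)
qed

lemma neg_pos: "a \<in> carrier K \<Longrightarrow> a \<prec> \<zero> \<Longrightarrow> \<zero> \<prec> \<ominus> a"
  using add_mono[of a \<zero> "\<ominus> a"] by (simp add: l_neg)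

lemma pos_neg: "a \<in> carrier K \<Longrightarrow> \<zero> \<prec> a \<Longrightarrow> \<ominus> a \<prec> \<zero>"
  using add_mono[of \<zero> a "\<ominus> a"] by (simp add: l_neg)

lemma sign_cases:
  assumes "a \<in> carrier K"
  obtains "\<zero> \<prec> a" | "a = \<zero>" | "\<zero> \<prec> \<ominus> a"
  using lt_linear[of a \<zero>] assms carrier_K neg_pos zero_closed by auto

lemma mult_mono:
  assumes "x \<in> carrier K" "y \<in> carrier K" "w \<in> carrier K" "x \<prec> y" "\<zero> \<prec> w"
  shows "w \<otimes> x \<prec> w \<otimes> y"
proof -
  have "\<zero> \<prec> \<ominus> x \<oplus> y" using add_mono[of x y "\<ominus> x"] assms by (simp add: l_neg)
  then have "\<zero> \<prec> w \<otimes> (\<ominus> x \<oplus> y)" using assms by (intro mult_pos) auto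
  from add_mono[OF _ _ _ this, of "w \<otimes> x"]
  have "w \<otimes> x \<prec> w \<otimes> x \<oplus> w \<otimes> (\<ominus> x \<oplus> y)" using assms by simp
  also have "w \<otimes> x \<oplus> w \<otimes> (\<ominus> x \<oplus> y) = w \<otimes> y"
    using assms by (simp add: r_distr r_minus a_assoc[symmetric] r_neg)
  finally show ?thesis .
qed

lemma one_pos: "\<zero> \<prec> \<one>"
proof (rule sign_cases[of \<one>])
  assume "\<zero> \<prec> \<ominus> \<one>"
  then have "\<zero> \<prec> \<ominus> \<one> \<otimes> \<ominus> \<one>" by (intro mult_pos) auto
  then show ?thesis by (simp add: l_minus r_minus)
qed auto

lemma inverse_pos:
  assumes "x \<in> carrier K" "\<zero> \<prec> x"
  shows "inv x \<in> carrier K" "x \<otimes> inv x = \<one>" "\<zero> \<prec> inv x"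
proof -
  have x: "x \<in> Units K" using assms by (auto simp: field_Units)
  show y: "inv x \<in> carrier K" and one: "x \<otimes> inv x = \<one>" using x by auto
  show "\<zero> \<prec> inv x"
  proof (rule sign_cases[OF y])
    assume "inv x = \<zero>"
    then show ?thesis using one assms(1) by simp
  next
    assume "\<zero> \<prec> \<ominus> (inv x)"
    then have "\<zero> \<prec> x \<otimes> \<ominus> (inv x)" using assms y by (intro mult_pos) auto
    then have "\<zero> \<prec> \<ominus> \<one>" using assms(1) y one by (simp add: r_minus)
    then show ?thesis using pos_neg[OF one_closed one_pos] lt_asym by blast
  qed
qed

definition pos_group :: "'a monoid" where
  "pos_group = \<lparr> carrier = {x \<in> carrier K. \<zero> \<prec> x}, mult = mult K, one = \<one> \<rparr>"

lemma pos_group_simps [simp]: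
  "x \<in> carrier pos_group \<longleftrightarrow> x \<in> carrier K \<and> \<zero> \<prec> x"
  "mult pos_group = mult K" "one pos_group = \<one>"
  by (auto simp: pos_group_def)

lemma pos_group: "definable_ordered_group M l pos_group t"
proof -
  have grp: "group pos_group"
  proof (rule groupI)
    fix x assume "x \<in> carrier pos_group"
    then show "\<exists>y\<in>carrier pos_group. y \<otimes>\<^bsub>pos_group\<^esub> x = \<one>\<^bsub>pos_group\<^esub>"
      using inverse_pos[of x] m_comm[of x "inv x"] by (intro bexI[of _ "inv x"]) auto
  qed (auto intro: mult_pos one_pos simp: m_assoc)
  have dP: "dfam (\<lambda>_. carrier pos_group)"
  proof -
    \<comment> \<open>Zero need not be named by the language, so it is defined as the only solution
      of \<open>y \<oplus> y = y\<close>.\<close>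
    have "dfam (\<lambda>_. {x \<in> carr M. \<exists>y\<in>carr M. y \<oplus> y = y \<and> y \<prec> x})"
      by (rule dfamI) (intro dfn_intros)
    moreover have "y \<oplus> y = y \<longleftrightarrow> y = \<zero>" if "y \<in> carrier K" for y
      using that by (metis add.r_cancel_one' zero_closed l_zero)
    then have "{x \<in> carr M. \<exists>y\<in>carr M. y \<oplus> y = y \<and> y \<prec> x} = carrier pos_group"
      using zero_closed by (auto simp: pos_group_def carrier_K)
    ultimately show ?thesis by simp
  qed
  show ?thesis
  proof (intro definable_ordered_group.intro wom_structure_axioms grp definable_ordered_group_axioms.intro dP args(2))
    fix x y w
    show "x \<otimes>\<^bsub>pos_group\<^esub> y = fun_int M t [x, y]" by (simp add: mult_t)
    assume x: "x \<in> carrier pos_group" and y: "y \<in> carrier pos_group" and w: "w \<in> carrier pos_group" and "x \<prec> y"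
    then have "w \<otimes> x \<prec> w \<otimes> y" by (intro mult_mono) simp_all
    then show "w \<otimes>\<^bsub>pos_group\<^esub> x \<prec> w \<otimes>\<^bsub>pos_group\<^esub> y" "x \<otimes>\<^bsub>pos_group\<^esub> w \<prec> y \<otimes>\<^bsub>pos_group\<^esub> w"
      using x y w by (simp_all add: m_comm)
  qed
qed

section \<open>The multiplier ring of a convex subgroup\<close>

definition multiplier :: "'a set \<Rightarrow> 'a set" where
  "multiplier A = {y \<in> carrier K. \<forall>s\<in>A. y \<otimes> s \<in> A}"

context
  fixes A
  assumes subgroup: "subgroup A (add_monoid K)" and convex: "order_convex M l A"
begin

lemma A_facts: "A \<subseteq> carrier K" "\<zero> \<in> A" "a \<in> A \<Longrightarrow> b \<in> A \<Longrightarrow> a \<oplus> b \<in> A" "a \<in> A \<Longrightarrow> \<ominus> a \<in> A"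
  using subgroup.subset[OF subgroup] subgroup.one_closed[OF subgroup]
    subgroup.m_closed[OF subgroup] subgroup.m_inv_closed[OF subgroup]
  by (auto simp: a_inv_def)

lemma A_convex: "a \<in> A \<Longrightarrow> b \<in> A \<Longrightarrow> a \<prec> w \<Longrightarrow> w \<prec> b \<Longrightarrow> w \<in> A"
  using convex lt_carr(2)[of a w] unfolding order_convex_def lt_def by blast

lemma multiplier_convex:
  assumes "x \<in> multiplier A" "y \<in> multiplier A" "x \<prec> w" "w \<prec> y"
  shows "w \<in> multiplier A"
proof -
  have xy: "x \<in> carrier K" "y \<in> carrier K" using assms(1,2) by (auto simp: multiplier_def)
  have w: "w \<in> carrier K" using lt_carr(2)[OF assms(3)] carrier_K by simp
  have pos: "w \<otimes> s \<in> A" if s: "s \<in> A" "\<zero> \<prec> s" for s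
  proof -
    have sK: "s \<in> carrier K" using s A_facts by blast
    have "x \<otimes> s \<in> A" "y \<otimes> s \<in> A" using assms(1,2) s by (auto simp: multiplier_def)
    moreover have "x \<otimes> s \<prec> w \<otimes> s" "w \<otimes> s \<prec> y \<otimes> s"
      using mult_mono[OF xy(1) w sK assms(3) s(2)] mult_mono[OF w xy(2) sK assms(4) s(2)] xy w sK
      by (simp_all add: m_comm)
    ultimately show ?thesis using A_convex by blast
  qed
  have "w \<otimes> s \<in> A" if s: "s \<in> A" for s
  proof -
    have sK: "s \<in> carrier K" using s A_facts by blast
    show ?thesis
    proof (rule sign_cases[OF sK])
      assume "\<zero> \<prec> \<ominus> s"
      then have "\<ominus> (w \<otimes> \<ominus> s) \<in> A" using pos A_facts(4) s by blast
      then show ?thesis using w sK by (simp add: r_minus)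
    qed (use s pos w A_facts(2) in auto)
  qed
  then show ?thesis using w by (simp add: multiplier_def)
qed

text \<open>A convex subring is a valuation ring: for positive \<open>x\<close> one of
  \<open>x\<close> and its inverse lies between \<open>\<zero>\<close> and \<open>\<one>\<close>,
  and a negative \<open>x\<close> is handled through \<open>\<ominus> x\<close>.\<close>

lemma multiplier_valuation_subring: "valuation_subring (multiplier A) K"
  unfolding valuation_subring_def
proof (intro conjI ballI)
  show sub: "subring (multiplier A) K"
  proof (rule subringI)
    fix x y assume x: "x \<in> multiplier A" and y: "y \<in> multiplier A"
    have xy: "x \<in> carrier K" "y \<in> carrier K" using x y by (auto simp: multiplier_def)
    have "x \<otimes> y \<otimes> s \<in> A" if "s \<in> A" for s
    proof -
      have "x \<otimes> (y \<otimes> s) \<in> A" using x y that by (auto simp: multiplier_def)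
      then show ?thesis using xy that A_facts(1) by (simp add: m_assoc subset_iff)
    qed
    then show "x \<otimes> y \<in> multiplier A" using xy by (simp add: multiplier_def)
    have "(x \<oplus> y) \<otimes> s \<in> A" if "s \<in> A" for s
    proof -
      have "x \<otimes> s \<oplus> y \<otimes> s \<in> A" using x y that A_facts(3) by (auto simp: multiplier_def)
      then show ?thesis using xy that A_facts(1) by (simp add: l_distr subset_iff)
    qed
    then show "x \<oplus> y \<in> multiplier A" using xy by (simp add: multiplier_def)
  next
    fix x assume x: "x \<in> multiplier A"
    have xK: "x \<in> carrier K" using x by (auto simp: multiplier_def)
    have "\<ominus> x \<otimes> s \<in> A" if "s \<in> A" for s
    proof -
      have "\<ominus> (x \<otimes> s) \<in> A" using x that A_facts(4) by (auto simp: multiplier_def)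
      then show ?thesis using xK that A_facts(1) by (simp add: l_minus subset_iff)
    qed
    then show "\<ominus> x \<in> multiplier A" using xK by (simp add: multiplier_def)
  qed (use A_facts(1) in \<open>auto simp: multiplier_def\<close>)
  have zero: "\<zero> \<in> multiplier A" using A_facts(1,2) by (auto simp: multiplier_def subset_iff)
  have one: "\<one> \<in> multiplier A" using A_facts(1) by (auto simp: multiplier_def subset_iff)
  have neg: "\<ominus> x \<in> multiplier A" if "x \<in> multiplier A" for x
    using sub that by (rule subringE(5))
  have pos: "x \<in> multiplier A \<or> inv x \<in> multiplier A" if x: "x \<in> carrier K" "\<zero> \<prec> x" for x
  proof (cases "\<one> \<prec> x")
    case True
    have i: "inv x \<in> carrier K" "x \<otimes> inv x = \<one>" "\<zero> \<prec> inv x" using inverse_pos[OF x] by auto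
    have "inv x \<prec> \<one>" using mult_mono[OF one_closed x(1) i(1) True i(3)] i x(1) by (simp add: m_comm)
    then show ?thesis using multiplier_convex[OF zero one i(3)] by blast
  next
    case False
    then have "x \<prec> \<one> \<or> x = \<one>" using lt_linear[of x \<one>] x(1) carrier_K one_closed by auto
    then show ?thesis using multiplier_convex[OF zero one x(2)] one by blast
  qed
  fix x assume "x \<in> carrier K - {\<zero>}"
  then have x: "x \<in> carrier K" "x \<noteq> \<zero>" by auto
  show "x \<in> multiplier A \<or> inv x \<in> multiplier A"
  proof (rule sign_cases[OF x(1)])
    assume n: "\<zero> \<prec> \<ominus> x"
    have nx: "\<ominus> x \<in> carrier K" using x(1) by simp
    have i: "inv (\<ominus> x) \<in> carrier K" "\<ominus> x \<otimes> inv (\<ominus> x) = \<one>" using inverse_pos[OF nx n] by auto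
    have "x \<otimes> \<ominus> (inv (\<ominus> x)) = \<one>" using i x(1) by (simp add: l_minus r_minus)
    then have "inv x = \<ominus> (inv (\<ominus> x))" using x(1) i(1) comm_inv_char[of x "\<ominus> (inv (\<ominus> x))"] by simp
    moreover have "x = \<ominus> (\<ominus> x)" using x(1) by simp
    ultimately show ?thesis using pos[OF nx n] neg by metis
  qed (use x pos in auto)
qed

text \<open>On the right are the positive units of the multiplier ring, so the stabilizer of the
  positive part of \<open>A\<close> depends on that ring alone. The two implications in the
  stabilizer correspond to \<open>g\<close> and its inverse being multipliers.\<close>

lemma stab_pos:
  "definable_ordered_group.stab pos_group {a \<in> A. \<zero> \<prec> a} =
    {g \<in> multiplier A. \<zero> \<prec> g \<and> (\<exists>h\<in>multiplier A. g \<otimes> h = \<one>)}"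
proof -
  interpret P: definable_ordered_group M l pos_group t by (rule pos_group)
  have mult: "g \<in> multiplier A" if g: "g \<in> P.stab {a \<in> A. \<zero> \<prec> a}" for g
  proof -
    have gK: "g \<in> carrier K" "\<zero> \<prec> g" using g by (auto simp: P.stab_def)
    have pos: "g \<otimes> s \<in> A" if s: "s \<in> A" "\<zero> \<prec> s" for s
    proof -
      have sK: "s \<in> carrier K" using s A_facts by blast
      then have "s \<otimes> g \<in> A" using g s by (auto simp: P.stab_def)
      then show ?thesis using gK sK by (simp add: m_comm)
    qed
    have "g \<otimes> s \<in> A" if s: "s \<in> A" for s
    proof -
      have sK: "s \<in> carrier K" using s A_facts by blast
      show ?thesis
      proof (rule sign_cases[OF sK])
        assume "\<zero> \<prec> \<ominus> s"
        then have "\<ominus> (g \<otimes> \<ominus> s) \<in> A" using pos A_facts(4) s by blast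
        then show ?thesis using gK sK by (simp add: r_minus)
      qed (use s pos gK A_facts(2) in auto)
    qed
    then show ?thesis using gK by (simp add: multiplier_def)
  qed
  have sub: "subgroup (P.stab {a \<in> A. \<zero> \<prec> a}) pos_group"
    using A_facts(1) by (intro P.stab_subgroup) auto
  show ?thesis
  proof (intro Set.set_eqI iffI)
    fix g assume g: "g \<in> P.stab {a \<in> A. \<zero> \<prec> a}"
    then have gG: "g \<in> carrier pos_group" by (simp add: P.stab_def)
    have "inv\<^bsub>pos_group\<^esub> g \<in> P.stab {a \<in> A. \<zero> \<prec> a}" using subgroup.m_inv_closed[OF sub g] .
    moreover have "g \<otimes> inv\<^bsub>pos_group\<^esub> g = \<one>" using P.r_inv[OF gG] by simp
    ultimately show "g \<in> {g \<in> multiplier A. \<zero> \<prec> g \<and> (\<exists>h\<in>multiplier A. g \<otimes> h = \<one>)}"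
      using mult g gG by auto
  next
    fix g assume "g \<in> {g \<in> multiplier A. \<zero> \<prec> g \<and> (\<exists>h\<in>multiplier A. g \<otimes> h = \<one>)}"
    then obtain h where gh: "g \<in> multiplier A" "\<zero> \<prec> g" "h \<in> multiplier A" "g \<otimes> h = \<one>" by blast
    have K: "g \<in> carrier K" "h \<in> carrier K" using gh by (auto simp: multiplier_def)
    have "y \<in> A \<longleftrightarrow> y \<otimes> g \<in> A" if y: "y \<in> carrier K" for y
    proof
      assume "y \<in> A"
      then have "g \<otimes> y \<in> A" using gh(1) by (simp add: multiplier_def)
      then show "y \<otimes> g \<in> A" using K y by (simp add: m_comm)
    next
      assume "y \<otimes> g \<in> A"
      then have "h \<otimes> (y \<otimes> g) \<in> A" using gh(3) by (simp add: multiplier_def)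
      moreover have "h \<otimes> (y \<otimes> g) = y \<otimes> (g \<otimes> h)" using K y by (simp add: m_ac)
      ultimately show "y \<in> A" using gh(4) y by simp
    qed
    then show "g \<in> P.stab {a \<in> A. \<zero> \<prec> a}" using K gh(2) mult_pos by (auto simp: P.stab_def)
  qed
qed

end

text \<open>A convex subgroup is determined by its positive part, which is a downset of the group of
  positive elements. As the stabilizer there is a function of the multiplier ring, a bound on the
  rings is one on the stabilizers.\<close>

lemma ufin_convex_subgroups:
  assumes rings: "\<And>T. dfam T \<Longrightarrow> (\<And>x. x \<in> Env \<Longrightarrow> valuation_subring (T x) K \<and> order_convex M l (T x)) \<Longrightarrow> ufin T"
    and S: "dfam S" and sub: "\<And>x. x \<in> Env \<Longrightarrow> subgroup (S x) (add_monoid K)"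
    and conv: "\<And>x. x \<in> Env \<Longrightarrow> order_convex M l (S x)"
  shows "ufin S"
proof -
  interpret P: definable_ordered_group M l pos_group t by (rule pos_group)
  have facts: "S x \<subseteq> carrier K" "\<zero> \<in> S x" "\<And>a. a \<in> S x \<Longrightarrow> \<ominus> a \<in> S x" if "x \<in> Env" for x
    by (fact A_facts(1)[OF sub[OF that] conv[OF that]] A_facts(2)[OF sub[OF that] conv[OF that]]
      A_facts(4)[OF sub[OF that] conv[OF that]])+
  have "dfam (\<lambda>x. {y \<in> carr M. \<forall>s\<in>carr M. s \<in> S x \<longrightarrow> y \<otimes> s \<in> S x})"
    by (intro dfamI dfn_intros dfn_mem[OF S])
  moreover have "{y \<in> carr M. \<forall>s\<in>carr M. s \<in> S x \<longrightarrow> y \<otimes> s \<in> S x} = multiplier (S x)" if "x \<in> Env" for x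
    using facts(1)[OF that] by (auto simp: multiplier_def carrier_K)
  ultimately have "dfam (\<lambda>x. multiplier (S x))" by (rule dfam_cong[rotated])
  then have "ufin (\<lambda>x. multiplier (S x))"
  proof (rule rings, intro conjI)
    fix x assume x: "x \<in> Env"
    show "valuation_subring (multiplier (S x)) K"
      by (rule multiplier_valuation_subring[OF sub[OF x] conv[OF x]])
    show "order_convex M l (multiplier (S x))"
      unfolding order_convex_def
    proof (intro conjI ballI impI)
      show "multiplier (S x) \<subseteq> carr M" by (auto simp: multiplier_def carrier_K)
    next
      fix a b w assume "a \<in> multiplier (S x)" "b \<in> multiplier (S x)" "(a, w) \<in> less_rel M l \<and> (w, b) \<in> less_rel M l"
      then show "w \<in> multiplier (S x)"
        using multiplier_convex[OF sub[OF x] conv[OF x], of a b w] by (simp add: lt_def)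
    qed
  qed
  define T where "T x = {a \<in> S x. \<zero> \<prec> a}" for x
  have ST: "S x = S y \<longleftrightarrow> T x = T y" if "x \<in> Env" "y \<in> Env" for x y
  proof
    assume eq: "T x = T y"
    have half: "S v \<subseteq> S w" if v: "v \<in> Env" and w: "w \<in> Env" and "T v = T w" for v w
    proof
      fix a assume a: "a \<in> S v"
      then have aK: "a \<in> carrier K" using facts(1)[OF v] by blast
      show "a \<in> S w"
      proof (rule sign_cases[OF aK])
        assume "\<zero> \<prec> a"
        then have "a \<in> T w" using a \<open>T v = T w\<close> by (auto simp: T_def)
        then show ?thesis by (simp add: T_def)
      next
        assume "a = \<zero>"
        then show ?thesis using facts(2)[OF w] by simp
      next
        assume "\<zero> \<prec> \<ominus> a"
        then have "\<ominus> a \<in> T w" using facts(3)[OF v a] \<open>T v = T w\<close> by (auto simp: T_def)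
        then have "\<ominus> (\<ominus> a) \<in> S w" using facts(3)[OF w] by (simp add: T_def)
        then show ?thesis using aK by simp
      qed
    qed
    show "S x = S y" using half[OF that eq] half[OF that(2,1) eq[symmetric]] by blast
  qed (simp add: T_def)
  have "ufin T"
  proof (rule P.ufin_downsets)
    have "dfam (\<lambda>x. {a \<in> carr M. a \<in> S x \<and> a \<in> carrier pos_group})"
      by (intro dfamI dfn_intros dfn_mem[OF S] P.dfn_mem_G)
    moreover have "{a \<in> carr M. a \<in> S x \<and> a \<in> carrier pos_group} = T x" if "x \<in> Env" for x
      using facts(1)[OF that] by (auto simp: T_def carrier_K)
    ultimately show "dfam T" by (rule dfam_cong[rotated])
    show "P.downset (T x)" if x: "x \<in> Env" for x
      using facts(1,2)[OF x] A_convex[OF sub[OF x] conv[OF x], of \<zero>] by (auto simp: P.downset_def T_def)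
  next
    fix Z assume "drel Z"
    then obtain N where N: "\<And>t. t \<in> Env \<Longrightarrow> finite ((\<lambda>x. multiplier (S x)) ` slice Z t) \<Longrightarrow>
        card ((\<lambda>x. multiplier (S x)) ` slice Z t) \<le> N"
      using ufinD[OF \<open>ufin (\<lambda>x. multiplier (S x))\<close>] by blast
    have "card ((\<lambda>x. P.stab (T x)) ` slice Z t) \<le> N" if t: "t \<in> Env" and fin: "finite (T ` slice Z t)" for t
    proof -
      \<comment> \<open>\<open>g\<close> recovers \<open>S x\<close> from its positive part.
        Finitely many positive parts therefore give finitely many multiplier rings, and the bound on
        rings applies.\<close>
      define g where "g B = S (SOME x. x \<in> Env \<and> T x = B)" for B
      have g: "g (T x) = S x" if "x \<in> Env" for x
      proof -
        have "(SOME y. y \<in> Env \<and> T y = T x) \<in> Env \<and> T (SOME y. y \<in> Env \<and> T y = T x) = T x"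
          using that by (intro someI[of "\<lambda>y. y \<in> Env \<and> T y = T x"]) auto
        then show ?thesis unfolding g_def using ST[of "SOME y. y \<in> Env \<and> T y = T x" x] that by blast
      qed
      have "(\<lambda>x. multiplier (S x)) ` slice Z t = multiplier ` g ` T ` slice Z t"
        unfolding image_image by (rule image_cong) (auto simp: slice_def g)
      then have fin': "finite ((\<lambda>x. multiplier (S x)) ` slice Z t)" using fin by simp
      define h where "h V = {g \<in> V. \<zero> \<prec> g \<and> (\<exists>h\<in>V. g \<otimes> h = \<one>)}" for V
      have "P.stab (T x) = h (multiplier (S x))" if "x \<in> Env" for x
        unfolding T_def h_def by (rule stab_pos[OF sub[OF that] conv[OF that]])
      then have "(\<lambda>x. P.stab (T x)) ` slice Z t = h ` (\<lambda>x. multiplier (S x)) ` slice Z t"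
        unfolding image_image by (intro image_cong) (auto simp: slice_def)
      then have "card ((\<lambda>x. P.stab (T x)) ` slice Z t) \<le> card ((\<lambda>x. multiplier (S x)) ` slice Z t)"
        using card_image_le[OF fin', of h] by simp
      then show ?thesis using N[OF t fin'] by linarith
    qed
    then show "\<exists>N. \<forall>t\<in>Env. finite (T ` slice Z t) \<longrightarrow> card ((\<lambda>x. P.stab (T x)) ` slice Z t) \<le> N" by blast
  qed
  show ?thesis
    by (rule ufin_determined[of "{()}" "\<lambda>_. T"]) (use \<open>ufin T\<close> ST in auto)
qed

end

theorem theorem1:
  fixes M :: "('f, 'r, 'a) struct" and l :: 'r and p :: 'f and z :: 'a
  assumes "is_struct M"
    and "aleph0_saturated M"
    and "weakly_o_minimal M l"
    and "expands_ordered_group M l p z"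
  shows "(eq_uniform_finiteness M \<longleftrightarrow>
           collection_uniform_finiteness M (definable_convex_subgroups M l p z)) \<and>
         (\<forall>t u. expands_ordered_field M l p z t u \<longrightarrow>
           (eq_uniform_finiteness M \<longleftrightarrow>
             collection_uniform_finiteness M (definable_convex_valuation_subrings M l p z t u)))"
proof -
  interpret wom_structure M l
    using assms by (simp add: wom_structure_def fo_structure_def wom_structure_axioms_def)
  let ?A = "additive_group M p z"
  have A_simps: "carrier ?A = carr M" "x \<otimes>\<^bsub>?A\<^esub> y = fun_int M p [x, y]" for x y
    by (simp_all add: additive_group_def)
  have grp: "group ?A" and args_p: "length (fun_args M p) = 2"
    and mono: "\<And>x y w. x \<in> carr M \<Longrightarrow> y \<in> carr M \<Longrightarrow> w \<in> carr M \<Longrightarrow> x \<prec> y \<Longrightarrow>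
      fun_int M p [w, x] \<prec> fun_int M p [w, y] \<and> fun_int M p [x, w] \<prec> fun_int M p [y, w]"
    using assms(4) by (auto simp: expands_ordered_group_def lt_def)
  have "dfam (\<lambda>_. carrier ?A)"
    using dfamI[of "\<lambda>_ _. True", OF dfn_True] by (simp add: A_simps)
  then interpret A: definable_ordered_group M l ?A p
  proof (intro definable_ordered_group.intro wom_structure_axioms grp definable_ordered_group_axioms.intro args_p)
    fix x y w
    show "x \<otimes>\<^bsub>?A\<^esub> y = fun_int M p [x, y]" by (rule A_simps)
    assume "x \<in> carrier ?A" "y \<in> carrier ?A" "w \<in> carrier ?A" "x \<prec> y"
    then show "w \<otimes>\<^bsub>?A\<^esub> x \<prec> w \<otimes>\<^bsub>?A\<^esub> y" "x \<otimes>\<^bsub>?A\<^esub> w \<prec> y \<otimes>\<^bsub>?A\<^esub> w"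
      using mono[of x y w] unfolding A_simps by blast+
  qed
  \<comment> \<open>Shared by both parts: what remains in each of them is the uniform finiteness of
    definable families of convex subgroups.\<close>
  have eq_uf: "eq_uniform_finiteness M"
    if conv: "\<And>T. dfam T \<Longrightarrow> (\<And>x. x \<in> Env \<Longrightarrow> subgroup (T x) ?A \<and> order_convex M l (T x)) \<Longrightarrow> ufin T"
  proof (rule eq_uniform_finitenessI, rule ufin_slice)
    fix S :: "(nat \<Rightarrow> 'a) \<Rightarrow> 'a set"
    assume S: "dfam S"
    show "ufin S"
    proof (rule A.ufin_if_convex_subgroups[OF A_simps(1) _ S])
      fix T assume "dfam T" "\<And>x. x \<in> Env \<Longrightarrow> subgroup (T x) ?A \<and> order_convex M l (T x)"
      then show "ufin T" by (rule conv)
    qed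
  qed
  \<comment> \<open>The easy direction of both equivalences: a definable set of imaginaries from a
    collection is in particular a definable set in \<open>M\<^sup>e\<^sup>q\<close>.\<close>
  have eq_imp: "eq_uniform_finiteness M \<Longrightarrow> collection_uniform_finiteness M \<D>" for \<D>
    by (simp add: eq_uniform_finiteness_def collection_uniform_finiteness_def)
  have groups: "eq_uniform_finiteness M"
    if uf: "collection_uniform_finiteness M (definable_convex_subgroups M l p z)"
  proof (rule eq_uf, rule ufin_if_collection[OF uf])
    fix T x
    assume T: "dfam T" "\<And>x. x \<in> Env \<Longrightarrow> subgroup (T x) ?A \<and> order_convex M l (T x)" and x: "x \<in> Env"
    show "{[h] | h. h \<in> T x} \<in> definable_convex_subgroups M l p z"
      unfolding definable_convex_subgroups_def using T(2)[OF x] dfam_eq_definable[OF T(1) x] by blast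
  qed
  have rings: "eq_uniform_finiteness M"
    if field: "expands_ordered_field M l p z t u"
      and uf: "collection_uniform_finiteness M (definable_convex_valuation_subrings M l p z t u)" for t u
  proof -
    let ?K = "ring_of M p z t u"
    have K_simps: "carrier ?K = carr M" "x \<oplus>\<^bsub>?K\<^esub> y = fun_int M p [x, y]" "x \<otimes>\<^bsub>?K\<^esub> y = fun_int M t [x, y]"
      "\<zero>\<^bsub>?K\<^esub> = z" "add_monoid ?K = ?A" for x y
      by (simp_all add: ring_of_def additive_group_def)
    have fld: "field ?K" and args_t: "length (fun_args M t) = 2"
      and pos: "\<And>x y. x \<in> carr M \<Longrightarrow> y \<in> carr M \<Longrightarrow> z \<prec> x \<Longrightarrow> z \<prec> y \<Longrightarrow> z \<prec> fun_int M t [x, y]"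
      using field by (auto simp: expands_ordered_field_def lt_def)
    interpret K: definable_ordered_field M l ?K p t
    proof (intro definable_ordered_field.intro wom_structure_axioms fld definable_ordered_field_axioms.intro args_p args_t)
      fix x y w
      show "carrier ?K = carr M" "x \<oplus>\<^bsub>?K\<^esub> y = fun_int M p [x, y]" "x \<otimes>\<^bsub>?K\<^esub> y = fun_int M t [x, y]"
        by (rule K_simps)+
      assume xy: "x \<in> carrier ?K" "y \<in> carrier ?K"
      show "\<zero>\<^bsub>?K\<^esub> \<prec> x \<otimes>\<^bsub>?K\<^esub> y" if "\<zero>\<^bsub>?K\<^esub> \<prec> x" "\<zero>\<^bsub>?K\<^esub> \<prec> y"
        using pos[of x y] xy that unfolding K_simps by blast
      assume "w \<in> carrier ?K" "x \<prec> y"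
      then show "w \<oplus>\<^bsub>?K\<^esub> x \<prec> w \<oplus>\<^bsub>?K\<^esub> y"
        using mono[of x y w] xy unfolding K_simps by blast
    qed
    have val: "ufin T" if T: "dfam T" "\<And>x. x \<in> Env \<Longrightarrow> valuation_subring (T x) ?K \<and> order_convex M l (T x)" for T
    proof (rule ufin_if_collection[OF uf T(1)])
      fix x assume x: "x \<in> Env"
      show "{[h] | h. h \<in> T x} \<in> definable_convex_valuation_subrings M l p z t u"
        unfolding definable_convex_valuation_subrings_def using T(2)[OF x] dfam_eq_definable[OF T(1) x] by blast
    qed
    \<comment> \<open>The argument on cuts runs twice: multiplicatively, to pass from valuation
      rings to convex subgroups, and additively, to pass from these to all definable
      families.\<close>
    show ?thesis
    proof (rule eq_uf)
      fix T assume T: "dfam T" "\<And>x. x \<in> Env \<Longrightarrow> subgroup (T x) ?A \<and> order_convex M l (T x)"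
      show "ufin T"
      proof (rule K.ufin_convex_subgroups[OF _ T(1)])
        fix V assume "dfam V" "\<And>x. x \<in> Env \<Longrightarrow> valuation_subring (V x) ?K \<and> order_convex M l (V x)"
        then show "ufin V" by (rule val)
      qed (use T(2) in \<open>simp_all only: K_simps(5)\<close>)
    qed
  qed
  show ?thesis using eq_imp groups rings by blast
qed

end
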